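(* Let $R$ be an fqf-ring with a unique minimal prime ideal $N$. The following assertions hold: (1) if $R$ is not arithmetical, then $R_P$ is not a chain ring for each maximal ideal $P$ of $R$; (2) $R$ is an fqp-ring.
   Context: All rings are commutative with unity. A chain ring (valuation ring) is a ring whose ideals are totally ordered by inclusion. $R$ is arithmetical if $R_P$ is a chain ring for each maximal ideal $P$. An $R$-module $V$ is quasi-projective if the natural homomorphism $\mathrm{Hom}_R(V,V)\rightarrow\mathrm{Hom}_R(V,V/X)$ is surjective for every submodule $X$ of $V$. $R$ is an fqp-ring if every finitely generated ideal of $R$ is quasi-projective. For $R$-modules $M$ and $V$, $V$ is $M$-\underline{flat} (the underlining distinguishes this notion from ordinary flatness) if for any $R$-module $M'$, any epimorphism $p:M\rightarrow M'$, any homomorphism $u:V\rightarrow M'$, any finitely presented $R$-module $G$ and any homomorphism $v:G\rightarrow V$, there exists a homomorphism $q:G\rightarrow M$ such that $pq=uv$. $V$ is quasi-flat if $V$ is $V^n$-\underline{flat} for each integer $n>0$. $R$ is an fqf-ring if each finitely generated ideal of $R$ is quasi-flat. *)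

theory Defs
  imports "HOL-Algebra.Module" "HOL-Algebra.QuotRing"
begin

section \<open>Modules\<close>

text \<open>Homomorphisms are not required to be extensional, so equalities between them are
  always stated on the carrier.\<close>

definition module_homs ::
  "('a, 'r) ring_scheme \<Rightarrow> ('a, 'b, 's) module_scheme \<Rightarrow> ('a, 'c, 't) module_scheme \<Rightarrow> ('b \<Rightarrow> 'c) set"
  where "module_homs R M N =
    {f \<in> hom (add_monoid M) (add_monoid N).
       \<forall>a\<in>carrier R. \<forall>x\<in>carrier M. f (a \<odot>\<^bsub>M\<^esub> x) = a \<odot>\<^bsub>N\<^esub> f x}"

text \<open>Module records extend ring records; the fields \<open>mult\<close> and \<open>one\<close> are irrelevant for a
  module and are left \<open>undefined\<close> below.\<close>

definition quot_module ::
  "('a, 'r) ring_scheme \<Rightarrow> ('a, 'b, 's) module_scheme \<Rightarrow> 'b set \<Rightarrow> ('a, 'b set) module"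
  where "quot_module R M X =
    \<lparr>carrier = a_rcosets\<^bsub>M\<^esub> X, mult = undefined, one = undefined, zero = X, add = set_add M,
     smult = (\<lambda>a A. \<Union>x\<in>A. X +>\<^bsub>M\<^esub> (a \<odot>\<^bsub>M\<^esub> x))\<rparr>"

definition power_module ::
  "('a, 'b, 's) module_scheme \<Rightarrow> nat \<Rightarrow> ('a, nat \<Rightarrow> 'b) module"
  where "power_module M n =
    \<lparr>carrier = {..<n} \<rightarrow>\<^sub>E carrier M, mult = undefined, one = undefined,
     zero = (\<lambda>i\<in>{..<n}. \<zero>\<^bsub>M\<^esub>),
     add = (\<lambda>x y. \<lambda>i\<in>{..<n}. x i \<oplus>\<^bsub>M\<^esub> y i),
     smult = (\<lambda>a x. \<lambda>i\<in>{..<n}. a \<odot>\<^bsub>M\<^esub> x i)\<rparr>"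

definition ideal_module :: "('a, 'r) ring_scheme \<Rightarrow> 'a set \<Rightarrow> ('a, 'a) module"
  where "ideal_module R I =
    \<lparr>carrier = I, mult = undefined, one = undefined, zero = \<zero>\<^bsub>R\<^esub>, add = add R, smult = mult R\<rparr>"

definition free_module :: "('a, 'r) ring_scheme \<Rightarrow> nat \<Rightarrow> ('a, nat \<Rightarrow> 'a) module"
  where "free_module R n = power_module (ideal_module R (carrier R)) n"

definition fin_gen_submodule ::
  "('a, 'r) ring_scheme \<Rightarrow> ('a, 'b, 's) module_scheme \<Rightarrow> 'b set \<Rightarrow> bool"
  where "fin_gen_submodule R M K \<longleftrightarrow>
    (\<exists>S. finite S \<and> S \<subseteq> carrier M \<and> K = \<Inter>{H. submodule H R M \<and> S \<subseteq> H})"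

definition finitely_presented ::
  "('a, 'r) ring_scheme \<Rightarrow> ('a, 'b, 's) module_scheme \<Rightarrow> bool"
  where "finitely_presented R G \<longleftrightarrow> module R G \<and>
    (\<exists>n. \<exists>f \<in> module_homs R (free_module R n) G.
       f ` carrier (free_module R n) = carrier G \<and>
       fin_gen_submodule R (free_module R n) {x \<in> carrier (free_module R n). f x = \<zero>\<^bsub>G\<^esub>})"

definition quasi_projective ::
  "('a, 'r) ring_scheme \<Rightarrow> ('a, 'b, 's) module_scheme \<Rightarrow> bool"
  where "quasi_projective R V \<longleftrightarrow>
    (\<forall>X. submodule X R V \<longrightarrow>
       (\<forall>f \<in> module_homs R V (quot_module R V X).
          \<exists>g \<in> module_homs R V V. \<forall>x\<in>carrier V. f x = X +>\<^bsub>V\<^esub> g x))"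

text \<open>\<open>relatively_flat R M V\<close> says that \<open>V\<close> is \<open>M\<close>-flat in the underlined sense. A HOL definition
  cannot quantify over modules of all types, so \<open>M'\<close> and \<open>G\<close> are taken over fixed types: every
  epimorphic image of \<open>M\<close> is isomorphic to one whose elements are subsets of \<open>M\<close>, and every
  finitely presented module to one whose elements are subsets of some \<open>R\<^sup>n\<close>.
  Lemma \<open>relatively_flat_all_types\<close> below shows that this is no restriction.\<close>

definition relatively_flat ::
  "('a, 'r) ring_scheme \<Rightarrow> ('a, 'm, 's) module_scheme \<Rightarrow> ('a, 'v, 't) module_scheme \<Rightarrow> bool"
  where "relatively_flat R M V \<longleftrightarrow>
    (\<forall>(M' :: ('a, 'm set) module) p u (G :: ('a, (nat \<Rightarrow> 'a) set) module) v.
       module R M' \<longrightarrow> p \<in> module_homs R M M' \<longrightarrow> p ` carrier M = carrier M' \<longrightarrow>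
       u \<in> module_homs R V M' \<longrightarrow> finitely_presented R G \<longrightarrow> v \<in> module_homs R G V \<longrightarrow>
       (\<exists>q \<in> module_homs R G M. \<forall>x\<in>carrier G. p (q x) = u (v x)))"

definition quasi_flat ::
  "('a, 'r) ring_scheme \<Rightarrow> ('a, 'v, 't) module_scheme \<Rightarrow> bool"
  where "quasi_flat R V \<longleftrightarrow> (\<forall>n>0. relatively_flat R (power_module V n) V)"


section \<open>Rings\<close>

definition fin_gen_ideal :: "'a set \<Rightarrow> ('a, 'r) ring_scheme \<Rightarrow> bool"
  where "fin_gen_ideal I R \<longleftrightarrow> (\<exists>S. finite S \<and> S \<subseteq> carrier R \<and> I = Idl\<^bsub>R\<^esub> S)"

definition fqp_ring :: "('a, 'r) ring_scheme \<Rightarrow> bool"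
  where "fqp_ring R \<longleftrightarrow> cring R \<and>
    (\<forall>I. fin_gen_ideal I R \<longrightarrow> quasi_projective R (ideal_module R I))"

definition fqf_ring :: "('a, 'r) ring_scheme \<Rightarrow> bool"
  where "fqf_ring R \<longleftrightarrow> cring R \<and>
    (\<forall>I. fin_gen_ideal I R \<longrightarrow> quasi_flat R (ideal_module R I))"

definition chain_ring :: "('a, 'r) ring_scheme \<Rightarrow> bool"
  where "chain_ring R \<longleftrightarrow> cring R \<and>
    (\<forall>I J. ideal I R \<longrightarrow> ideal J R \<longrightarrow> I \<subseteq> J \<or> J \<subseteq> I)"

definition minimal_primeideal :: "'a set \<Rightarrow> ('a, 'r) ring_scheme \<Rightarrow> bool"
  where "minimal_primeideal N R \<longleftrightarrow> primeideal N R \<and>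
    (\<forall>Q. primeideal Q R \<longrightarrow> Q \<subseteq> N \<longrightarrow> Q = N)"

text \<open>The fractions of \<open>R\<close> with denominators in \<open>S\<close>: \<open>frac R S a s\<close> is the class of the pair
  \<open>(a, s)\<close>, where \<open>(a, s)\<close> and \<open>(b, t)\<close> are identified if \<open>u (a t - b s) = 0\<close> for some \<open>u\<close>
  in \<open>S\<close>.\<close>

definition frac_rel :: "('a, 'r) ring_scheme \<Rightarrow> 'a set \<Rightarrow> (('a \<times> 'a) \<times> ('a \<times> 'a)) set"
  where "frac_rel R S =
    {((a, s), (b, t)) | a s b t. a \<in> carrier R \<and> s \<in> S \<and> b \<in> carrier R \<and> t \<in> S \<and>
       (\<exists>u\<in>S. u \<otimes>\<^bsub>R\<^esub> (a \<otimes>\<^bsub>R\<^esub> t \<ominus>\<^bsub>R\<^esub> b \<otimes>\<^bsub>R\<^esub> s) = \<zero>\<^bsub>R\<^esub>)}"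

definition frac :: "('a, 'r) ring_scheme \<Rightarrow> 'a set \<Rightarrow> 'a \<Rightarrow> 'a \<Rightarrow> ('a \<times> 'a) set"
  where "frac R S a s = frac_rel R S `` {(a, s)}"

definition localization :: "('a, 'r) ring_scheme \<Rightarrow> 'a set \<Rightarrow> ('a \<times> 'a) set ring"
  where "localization R S =
    \<lparr>carrier = (carrier R \<times> S) // frac_rel R S,
     mult = (\<lambda>A B. \<Union>(a, s)\<in>A. \<Union>(b, t)\<in>B. frac R S (a \<otimes>\<^bsub>R\<^esub> b) (s \<otimes>\<^bsub>R\<^esub> t)),
     one = frac R S \<one>\<^bsub>R\<^esub> \<one>\<^bsub>R\<^esub>,
     zero = frac R S \<zero>\<^bsub>R\<^esub> \<one>\<^bsub>R\<^esub>,
     add = (\<lambda>A B. \<Union>(a, s)\<in>A. \<Union>(b, t)\<in>B.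
        frac R S (a \<otimes>\<^bsub>R\<^esub> t \<oplus>\<^bsub>R\<^esub> b \<otimes>\<^bsub>R\<^esub> s) (s \<otimes>\<^bsub>R\<^esub> t))\<rparr>"

abbreviation localization_at :: "('a, 'r) ring_scheme \<Rightarrow> 'a set \<Rightarrow> ('a \<times> 'a) set ring"
  where "localization_at R P \<equiv> localization R (carrier R - P)"

definition arithmetical :: "('a, 'r) ring_scheme \<Rightarrow> bool"
  where "arithmetical R \<longleftrightarrow> cring R \<and>
    (\<forall>P. maximalideal P R \<longrightarrow> chain_ring (localization_at R P))"


section \<open>Well-definedness\<close>

text \<open>The constructions above yield modules and rings.\<close>

lemma module_ideal_module:
  assumes "cring R" "ideal I R"
  shows "module R (ideal_module R I)"
proof -
  interpret cring R by fact
  interpret I: ideal I R by fact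
  show ?thesis
  proof (rule moduleI[OF \<open>cring R\<close>])
    show "abelian_group (ideal_module R I)"
    proof (rule abelian_groupI)
      fix x assume "x \<in> carrier (ideal_module R I)"
      then show "\<exists>y\<in>carrier (ideal_module R I).
          y \<oplus>\<^bsub>ideal_module R I\<^esub> x = \<zero>\<^bsub>ideal_module R I\<^esub>"
        by (intro bexI[of _ "\<ominus>\<^bsub>R\<^esub> x"]) (auto simp: ideal_module_def l_neg)
    qed (auto simp: ideal_module_def a_ac)
  qed (auto simp: ideal_module_def l_distr r_distr m_assoc I.I_l_closed)
qed

lemma module_power_module:
  assumes "module R M"
  shows "module R (power_module M n)"
proof -
  interpret module R M by fact
  let ?P = "power_module M n"
  show ?thesis
  proof (rule moduleI)
    show "cring R" ..
    show "abelian_group ?P"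
    proof (rule abelian_groupI)
      fix x assume "x \<in> carrier ?P"
      then show "\<exists>y\<in>carrier ?P. y \<oplus>\<^bsub>?P\<^esub> x = \<zero>\<^bsub>?P\<^esub>"
        by (intro bexI[of _ "\<lambda>i\<in>{..<n}. \<ominus>\<^bsub>M\<^esub> x i"])
          (auto simp: power_module_def PiE_iff extensional_def restrict_def M.l_neg)
    qed (auto simp: power_module_def PiE_iff extensional_def restrict_def M.a_ac
         intro!: ext)
  qed (auto simp: power_module_def PiE_iff extensional_def restrict_def smult_l_distr
       smult_r_distr smult_assoc1 intro!: ext)
qed

lemma module_quot_module:
  assumes "module R M" "submodule X R M"
  shows "module R (quot_module R M X)"
proof -
  interpret module R M by fact
  interpret X: submodule X R M by fact
  interpret A: abelian_subgroup X M
    using additive_subgroup.intro[OF X.subgroup_axioms] module.axioms(2)[OF assms(1)]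
    by (rule abelian_subgroupI3)
  let ?Q = "quot_module R M X"
  have sm: "a \<odot>\<^bsub>?Q\<^esub> (X +>\<^bsub>M\<^esub> x) = X +>\<^bsub>M\<^esub> (a \<odot>\<^bsub>M\<^esub> x)"
    if a: "a \<in> carrier R" and x: "x \<in> carrier M" for a x
  proof -
    have "X +>\<^bsub>M\<^esub> (a \<odot>\<^bsub>M\<^esub> y) = X +>\<^bsub>M\<^esub> (a \<odot>\<^bsub>M\<^esub> x)" if y: "y \<in> X +>\<^bsub>M\<^esub> x" for y
    proof -
      from y obtain h where h: "h \<in> X" and [simp]: "y = h \<oplus>\<^bsub>M\<^esub> x"
        by (auto simp: a_r_coset_def')
      have hM: "h \<in> carrier M" using h A.a_subset by auto
      have "a \<odot>\<^bsub>M\<^esub> y \<in> X +>\<^bsub>M\<^esub> (a \<odot>\<^bsub>M\<^esub> x)"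
        using a x h hM by (auto simp: smult_r_distr a_r_coset_def')
      then show ?thesis using a x A.a_repr_independence' by simp
    qed
    then have "a \<odot>\<^bsub>?Q\<^esub> (X +>\<^bsub>M\<^esub> x) = (\<Union>y\<in>X +>\<^bsub>M\<^esub> x. X +>\<^bsub>M\<^esub> (a \<odot>\<^bsub>M\<^esub> x))"
      by (simp add: quot_module_def cong: SUP_cong)
    also have "\<dots> = X +>\<^bsub>M\<^esub> (a \<odot>\<^bsub>M\<^esub> x)" using A.a_rcos_self[OF x] by blast
    finally show ?thesis .
  qed
  have ad: "(X +>\<^bsub>M\<^esub> x) \<oplus>\<^bsub>?Q\<^esub> (X +>\<^bsub>M\<^esub> y) = X +>\<^bsub>M\<^esub> (x \<oplus>\<^bsub>M\<^esub> y)"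
    if "x \<in> carrier M" "y \<in> carrier M" for x y
    using that A.a_rcos_sum by (auto simp: quot_module_def)
  have car: "carrier ?Q = (\<lambda>x. X +>\<^bsub>M\<^esub> x) ` carrier M"
    by (auto simp: quot_module_def A_RCOSETS_def')
  have z: "\<zero>\<^bsub>?Q\<^esub> = X +>\<^bsub>M\<^esub> \<zero>\<^bsub>M\<^esub>"
    using A.a_subset by (auto simp: quot_module_def a_coset_add_zero)
  show ?thesis
  proof (rule moduleI)
    show "cring R" ..
    show "abelian_group ?Q"
    proof (rule abelian_groupI)
      fix A assume "A \<in> carrier ?Q"
      then obtain x where "x \<in> carrier M" "A = X +>\<^bsub>M\<^esub> x" by (auto simp: car)
      then show "\<exists>B\<in>carrier ?Q. B \<oplus>\<^bsub>?Q\<^esub> A = \<zero>\<^bsub>?Q\<^esub>"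
        by (intro bexI[of _ "X +>\<^bsub>M\<^esub> (\<ominus>\<^bsub>M\<^esub> x)"]) (auto simp: car ad z M.l_neg)
    qed (auto simp: car ad z M.a_ac)
  qed (auto simp: car ad sm smult_l_distr smult_r_distr smult_assoc1)
qed

text \<open>Transport of structure along an injection of the carrier.\<close>

lemma module_transport:
  fixes N :: "('a, 'b, 's) module_scheme" and \<phi> :: "'b \<Rightarrow> 'c"
  assumes "module R N" and inj: "inj_on \<phi> (carrier N)"
  obtains N' :: "('a, 'c) module" where "module R N'" "\<phi> \<in> module_homs R N N'"
    "carrier N' = \<phi> ` carrier N" "\<zero>\<^bsub>N'\<^esub> = \<phi> \<zero>\<^bsub>N\<^esub>"
proof -
  interpret module R N by fact
  let ?i = "inv_into (carrier N) \<phi>"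
  define N' :: "('a, 'c) module" where "N' =
    \<lparr>carrier = \<phi> ` carrier N, mult = undefined, one = undefined, zero = \<phi> \<zero>\<^bsub>N\<^esub>,
     add = (\<lambda>x y. \<phi> (?i x \<oplus>\<^bsub>N\<^esub> ?i y)), smult = (\<lambda>a x. \<phi> (a \<odot>\<^bsub>N\<^esub> ?i x))\<rparr>"
  have [simp]: "?i (\<phi> x) = x" if "x \<in> carrier N" for x
    using inj that by simp
  have m: "module R N'"
  proof (rule moduleI)
    show "cring R" ..
    show "abelian_group N'"
    proof (rule abelian_groupI)
      fix x assume "x \<in> carrier N'"
      then show "\<exists>y\<in>carrier N'. y \<oplus>\<^bsub>N'\<^esub> x = \<zero>\<^bsub>N'\<^esub>"
        by (intro bexI[of _ "\<phi> (\<ominus>\<^bsub>N\<^esub> (?i x))"]) (auto simp: N'_def M.l_neg)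
    qed (auto simp: N'_def M.a_ac)
  qed (auto simp: N'_def smult_l_distr smult_r_distr smult_assoc1)
  show thesis
    by (rule that[OF m]) (auto simp: module_homs_def hom_def N'_def)
qed

lemma module_homs_comp:
  assumes "f \<in> module_homs R L M" "g \<in> module_homs R M N"
  shows "(\<lambda>x. g (f x)) \<in> module_homs R L N"
  using assms by (auto simp: module_homs_def hom_def Pi_def)

lemma module_homs_inv_into:
  assumes "module R N" "\<phi> \<in> module_homs R N N'" "inj_on \<phi> (carrier N)"
    "carrier N' = \<phi> ` carrier N"
  shows "inv_into (carrier N) \<phi> \<in> module_homs R N' N"
proof -
  interpret module R N by fact
  have "inv_into (carrier N) \<phi> (\<phi> x \<oplus>\<^bsub>N'\<^esub> \<phi> y) = x \<oplus>\<^bsub>N\<^esub> y"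
    if "x \<in> carrier N" "y \<in> carrier N" for x y
    using that assms inv_into_f_f[OF assms(3), of "x \<oplus>\<^bsub>N\<^esub> y"]
    by (auto simp: module_homs_def hom_def)
  moreover have "inv_into (carrier N) \<phi> (a \<odot>\<^bsub>N'\<^esub> \<phi> x) = a \<odot>\<^bsub>N\<^esub> x"
    if "a \<in> carrier R" "x \<in> carrier N" for a x
    using that assms inv_into_f_f[OF assms(3), of "a \<odot>\<^bsub>N\<^esub> x"]
    by (auto simp: module_homs_def hom_def)
  ultimately show ?thesis
    using assms(3,4) by (auto simp: module_homs_def hom_def)
qed

lemma relatively_flat_all_types:
  fixes M :: "('a, 'm, 's) module_scheme" and M' :: "('a, 'x, 'y) module_scheme"
    and G :: "('a, 'g, 'h) module_scheme"
  assumes flat: "relatively_flat R M V"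
    and M': "module R M'" and p: "p \<in> module_homs R M M'" and ps: "p ` carrier M = carrier M'"
    and u: "u \<in> module_homs R V M'" and G: "finitely_presented R G"
    and v: "v \<in> module_homs R G V"
  shows "\<exists>q \<in> module_homs R G M. \<forall>x\<in>carrier G. p (q x) = u (v x)"
proof -
  define \<phi> where "\<phi> y = {x \<in> carrier M. p x = y}" for y
  have \<phi>: "inj_on \<phi> (carrier M')"
  proof (rule inj_onI)
    fix y z assume "y \<in> carrier M'" and e: "\<phi> y = \<phi> z"
    then have "y \<in> p ` carrier M" using ps by simp
    then obtain x where "x \<in> carrier M" "y = p x" ..
    then have "x \<in> \<phi> y" by (simp add: \<phi>_def)
    then have "x \<in> \<phi> y" "x \<in> \<phi> z" unfolding e by simp_all
    then show "y = z" by (simp add: \<phi>_def)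
  qed
  obtain N' :: "('a, 'm set) module" where N': "module R N'" "\<phi> \<in> module_homs R M' N'"
    "carrier N' = \<phi> ` carrier M'"
    by (rule module_transport[OF M' \<phi>])
  from G obtain n f where Gm: "module R G" and f: "f \<in> module_homs R (free_module R n) G"
    and fs: "f ` carrier (free_module R n) = carrier G"
    and fk: "fin_gen_submodule R (free_module R n) {x \<in> carrier (free_module R n). f x = \<zero>\<^bsub>G\<^esub>}"
    by (auto simp: finitely_presented_def)
  define \<psi> where "\<psi> y = {x \<in> carrier (free_module R n). f x = y}" for y
  have \<psi>: "inj_on \<psi> (carrier G)"
  proof (rule inj_onI)
    fix y z assume "y \<in> carrier G" and e: "\<psi> y = \<psi> z"
    then have "y \<in> f ` carrier (free_module R n)" using fs by simp
    then obtain x where "x \<in> carrier (free_module R n)" "y = f x" ..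
    then have "x \<in> \<psi> y" by (simp add: \<psi>_def)
    then have "x \<in> \<psi> y" "x \<in> \<psi> z" unfolding e by simp_all
    then show "y = z" by (simp add: \<psi>_def)
  qed
  obtain H :: "('a, (nat \<Rightarrow> 'a) set) module" where H: "module R H" "\<psi> \<in> module_homs R G H"
    "carrier H = \<psi> ` carrier G" "\<zero>\<^bsub>H\<^esub> = \<psi> \<zero>\<^bsub>G\<^esub>"
    by (rule module_transport[OF Gm \<psi>])
  interpret G: module R G by fact
  have "finitely_presented R H"
    unfolding finitely_presented_def
  proof (intro conjI exI bexI)
    show "(\<lambda>x. \<psi> (f x)) \<in> module_homs R (free_module R n) H"
      by (rule module_homs_comp[OF f H(2)])
    show "(\<lambda>x. \<psi> (f x)) ` carrier (free_module R n) = carrier H"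
      using fs H(3) by (auto simp: image_image[symmetric])
    have "{x \<in> carrier (free_module R n). \<psi> (f x) = \<zero>\<^bsub>H\<^esub>} =
          {x \<in> carrier (free_module R n). f x = \<zero>\<^bsub>G\<^esub>}"
    proof (intro Collect_cong conj_cong refl)
      fix x assume "x \<in> carrier (free_module R n)"
      then have "f x \<in> carrier G" using fs by blast
      then show "\<psi> (f x) = \<zero>\<^bsub>H\<^esub> \<longleftrightarrow> f x = \<zero>\<^bsub>G\<^esub>"
        using H(4) inj_on_eq_iff[OF \<psi>] by simp
    qed
    with fk show "fin_gen_submodule R (free_module R n)
        {x \<in> carrier (free_module R n). \<psi> (f x) = \<zero>\<^bsub>H\<^esub>}" by simp
  qed (rule H)
  moreover have "(\<lambda>x. v (inv_into (carrier G) \<psi> x)) \<in> module_homs R H V"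
    by (rule module_homs_comp[OF module_homs_inv_into[OF Gm H(2) \<psi> H(3)] v])
  moreover have "(\<lambda>x. \<phi> (p x)) \<in> module_homs R M N'" "(\<lambda>x. \<phi> (u x)) \<in> module_homs R V N'"
    using module_homs_comp N'(2) p u by blast+
  moreover have "(\<lambda>x. \<phi> (p x)) ` carrier M = carrier N'"
    using ps N'(3) by (auto simp: image_image[symmetric])
  ultimately obtain q where q: "q \<in> module_homs R H M"
    and qe: "\<And>x. x \<in> carrier H \<Longrightarrow> \<phi> (p (q x)) = \<phi> (u (v (inv_into (carrier G) \<psi> x)))"
    using flat N'(1) unfolding relatively_flat_def by meson
  have "p (q (\<psi> x)) = u (v x)" if x: "x \<in> carrier G" for x
  proof -
    have "q (\<psi> x) \<in> carrier M" "v x \<in> carrier V"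
      using x q v H(3) by (auto simp: module_homs_def hom_def Pi_def)
    then have "p (q (\<psi> x)) \<in> carrier M'" "u (v x) \<in> carrier M'"
      using p u by (auto simp: module_homs_def hom_def Pi_def)
    moreover have "\<phi> (p (q (\<psi> x))) = \<phi> (u (v x))"
      using qe[of "\<psi> x"] x H(3) \<psi> by simp
    ultimately show ?thesis using \<phi> by (meson inj_onD)
  qed
  moreover have "(\<lambda>x. q (\<psi> x)) \<in> module_homs R G M"
    by (rule module_homs_comp[OF H(2) q])
  ultimately show ?thesis by (intro bexI[of _ "\<lambda>x. q (\<psi> x)"] ballI)
qed

lemma equiv_frac_rel:
  assumes "cring R" and S: "S \<subseteq> carrier R" "\<one>\<^bsub>R\<^esub> \<in> S"
    "\<And>s t. s \<in> S \<Longrightarrow> t \<in> S \<Longrightarrow> s \<otimes>\<^bsub>R\<^esub> t \<in> S"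
  shows "equiv (carrier R \<times> S) (frac_rel R S)"
proof -
  interpret cring R by fact
  show ?thesis
  proof (rule equivI)
    show "frac_rel R S \<subseteq> (carrier R \<times> S) \<times> (carrier R \<times> S)"
      by (auto simp: frac_rel_def)
    show "refl_on (carrier R \<times> S) (frac_rel R S)"
    proof (rule refl_onI)
      fix x assume "x \<in> carrier R \<times> S"
      then obtain a s where [simp]: "x = (a, s)" and as: "a \<in> carrier R" "s \<in> S" by auto
      then have "s \<in> carrier R" using S by auto
      then have "\<one>\<^bsub>R\<^esub> \<otimes>\<^bsub>R\<^esub> (a \<otimes>\<^bsub>R\<^esub> s \<ominus>\<^bsub>R\<^esub> a \<otimes>\<^bsub>R\<^esub> s) = \<zero>\<^bsub>R\<^esub>" using as by algebra
      then show "(x, x) \<in> frac_rel R S" using as S by (auto simp: frac_rel_def)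
    qed
    show "sym (frac_rel R S)"
    proof (rule symI)
      fix x y assume "(x, y) \<in> frac_rel R S"
      then obtain a s b t u where [simp]: "x = (a, s)" "y = (b, t)"
        and m: "a \<in> carrier R" "s \<in> S" "b \<in> carrier R" "t \<in> S" "u \<in> S"
        and e: "u \<otimes>\<^bsub>R\<^esub> (a \<otimes>\<^bsub>R\<^esub> t \<ominus>\<^bsub>R\<^esub> b \<otimes>\<^bsub>R\<^esub> s) = \<zero>\<^bsub>R\<^esub>"
        by (auto simp: frac_rel_def)
      have c: "s \<in> carrier R" "t \<in> carrier R" "u \<in> carrier R" using m S by auto
      have "u \<otimes>\<^bsub>R\<^esub> (b \<otimes>\<^bsub>R\<^esub> s \<ominus>\<^bsub>R\<^esub> a \<otimes>\<^bsub>R\<^esub> t) = \<ominus>\<^bsub>R\<^esub> (u \<otimes>\<^bsub>R\<^esub> (a \<otimes>\<^bsub>R\<^esub> t \<ominus>\<^bsub>R\<^esub> b \<otimes>\<^bsub>R\<^esub> s))"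
        using m(1,3) c by algebra
      with e have "u \<otimes>\<^bsub>R\<^esub> (b \<otimes>\<^bsub>R\<^esub> s \<ominus>\<^bsub>R\<^esub> a \<otimes>\<^bsub>R\<^esub> t) = \<zero>\<^bsub>R\<^esub>" by simp
      then show "(y, x) \<in> frac_rel R S" using m by (auto simp: frac_rel_def)
    qed
    show "trans (frac_rel R S)"
    proof (rule transI)
      fix x y z assume "(x, y) \<in> frac_rel R S" "(y, z) \<in> frac_rel R S"
      then obtain a s b t d w u u' where [simp]: "x = (a, s)" "y = (b, t)" "z = (d, w)"
        and m: "a \<in> carrier R" "s \<in> S" "b \<in> carrier R" "t \<in> S" "u \<in> S"
          "d \<in> carrier R" "w \<in> S" "u' \<in> S"
        and e: "u \<otimes>\<^bsub>R\<^esub> (a \<otimes>\<^bsub>R\<^esub> t \<ominus>\<^bsub>R\<^esub> b \<otimes>\<^bsub>R\<^esub> s) = \<zero>\<^bsub>R\<^esub>"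
          "u' \<otimes>\<^bsub>R\<^esub> (b \<otimes>\<^bsub>R\<^esub> w \<ominus>\<^bsub>R\<^esub> d \<otimes>\<^bsub>R\<^esub> t) = \<zero>\<^bsub>R\<^esub>"
        by (auto simp: frac_rel_def)
      have c: "s \<in> carrier R" "t \<in> carrier R" "u \<in> carrier R" "w \<in> carrier R" "u' \<in> carrier R"
        using m S by auto
      have "(u \<otimes>\<^bsub>R\<^esub> u' \<otimes>\<^bsub>R\<^esub> t) \<otimes>\<^bsub>R\<^esub> (a \<otimes>\<^bsub>R\<^esub> w \<ominus>\<^bsub>R\<^esub> d \<otimes>\<^bsub>R\<^esub> s) =
          u' \<otimes>\<^bsub>R\<^esub> w \<otimes>\<^bsub>R\<^esub> (u \<otimes>\<^bsub>R\<^esub> (a \<otimes>\<^bsub>R\<^esub> t \<ominus>\<^bsub>R\<^esub> b \<otimes>\<^bsub>R\<^esub> s)) \<oplus>\<^bsub>R\<^esub>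
          u \<otimes>\<^bsub>R\<^esub> s \<otimes>\<^bsub>R\<^esub> (u' \<otimes>\<^bsub>R\<^esub> (b \<otimes>\<^bsub>R\<^esub> w \<ominus>\<^bsub>R\<^esub> d \<otimes>\<^bsub>R\<^esub> t))"
        using m(1,3,6) c by algebra
      then have "(u \<otimes>\<^bsub>R\<^esub> u' \<otimes>\<^bsub>R\<^esub> t) \<otimes>\<^bsub>R\<^esub> (a \<otimes>\<^bsub>R\<^esub> w \<ominus>\<^bsub>R\<^esub> d \<otimes>\<^bsub>R\<^esub> s) = \<zero>\<^bsub>R\<^esub>"
        using c by (simp add: e)
      moreover have "u \<otimes>\<^bsub>R\<^esub> u' \<otimes>\<^bsub>R\<^esub> t \<in> S" using m by (intro S(3))
      ultimately show "(x, z) \<in> frac_rel R S" using m by (auto simp: frac_rel_def)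
    qed
  qed
qed

lemma cring_localization:
  assumes "cring R" and S: "S \<subseteq> carrier R" "\<one>\<^bsub>R\<^esub> \<in> S"
    "\<And>s t. s \<in> S \<Longrightarrow> t \<in> S \<Longrightarrow> s \<otimes>\<^bsub>R\<^esub> t \<in> S"
  shows "cring (localization R S)"
proof -
  interpret cring R by fact
  note eq = equiv_frac_rel[OF assms]
  let ?L = "localization R S"
  let ?f = "frac R S"
  have Sc: "s \<in> carrier R" if "s \<in> S" for s using that S by auto
  have fracI: "?f a s = ?f b t" if "a \<in> carrier R" "s \<in> S" "b \<in> carrier R" "t \<in> S"
      "u \<in> S" "u \<otimes>\<^bsub>R\<^esub> (a \<otimes>\<^bsub>R\<^esub> t \<ominus>\<^bsub>R\<^esub> b \<otimes>\<^bsub>R\<^esub> s) = \<zero>\<^bsub>R\<^esub>" for a s b t u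
    unfolding frac_def by (rule equiv_class_eq[OF eq]) (use that in \<open>auto simp: frac_rel_def\<close>)
  have fracI1: "?f a s = ?f b t" if "a \<in> carrier R" "s \<in> S" "b \<in> carrier R" "t \<in> S"
      "a \<otimes>\<^bsub>R\<^esub> t = b \<otimes>\<^bsub>R\<^esub> s" for a s b t
    using that by (intro fracI[where u = "\<one>\<^bsub>R\<^esub>"]) (auto simp: S Sc a_minus_def r_neg)
  have fracD: "\<exists>u\<in>S. a' \<in> carrier R \<and> s' \<in> S \<and>
      u \<otimes>\<^bsub>R\<^esub> (a \<otimes>\<^bsub>R\<^esub> s' \<ominus>\<^bsub>R\<^esub> a' \<otimes>\<^bsub>R\<^esub> s) = \<zero>\<^bsub>R\<^esub>"
    if "(a', s') \<in> ?f a s" for a s a' s'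
    using that by (auto simp: frac_def frac_rel_def)
  have self: "(a, s) \<in> ?f a s" if "a \<in> carrier R" "s \<in> S" for a s
    unfolding frac_def by (rule equiv_class_self[OF eq]) (use that in auto)
  have mul: "?f a s \<otimes>\<^bsub>?L\<^esub> ?f b t = ?f (a \<otimes>\<^bsub>R\<^esub> b) (s \<otimes>\<^bsub>R\<^esub> t)"
    if m: "a \<in> carrier R" "s \<in> S" "b \<in> carrier R" "t \<in> S" for a s b t
  proof -
    have "?f (a' \<otimes>\<^bsub>R\<^esub> b') (s' \<otimes>\<^bsub>R\<^esub> t') = ?f (a \<otimes>\<^bsub>R\<^esub> b) (s \<otimes>\<^bsub>R\<^esub> t)"
      if h: "(a', s') \<in> ?f a s" "(b', t') \<in> ?f b t" for a' s' b' t'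
    proof -
      from fracD[OF h(1)] fracD[OF h(2)] obtain u w where
        m': "u \<in> S" "a' \<in> carrier R" "s' \<in> S" "w \<in> S" "b' \<in> carrier R" "t' \<in> S"
        and e: "u \<otimes>\<^bsub>R\<^esub> (a \<otimes>\<^bsub>R\<^esub> s' \<ominus>\<^bsub>R\<^esub> a' \<otimes>\<^bsub>R\<^esub> s) = \<zero>\<^bsub>R\<^esub>"
          "w \<otimes>\<^bsub>R\<^esub> (b \<otimes>\<^bsub>R\<^esub> t' \<ominus>\<^bsub>R\<^esub> b' \<otimes>\<^bsub>R\<^esub> t) = \<zero>\<^bsub>R\<^esub>" by auto
      have c: "s \<in> carrier R" "t \<in> carrier R" "s' \<in> carrier R" "t' \<in> carrier R"
        "u \<in> carrier R" "w \<in> carrier R" using m m' Sc by auto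
      have "(u \<otimes>\<^bsub>R\<^esub> w) \<otimes>\<^bsub>R\<^esub> ((a' \<otimes>\<^bsub>R\<^esub> b') \<otimes>\<^bsub>R\<^esub> (s \<otimes>\<^bsub>R\<^esub> t) \<ominus>\<^bsub>R\<^esub> (a \<otimes>\<^bsub>R\<^esub> b) \<otimes>\<^bsub>R\<^esub> (s' \<otimes>\<^bsub>R\<^esub> t'))
        = \<ominus>\<^bsub>R\<^esub> (w \<otimes>\<^bsub>R\<^esub> b \<otimes>\<^bsub>R\<^esub> t' \<otimes>\<^bsub>R\<^esub> (u \<otimes>\<^bsub>R\<^esub> (a \<otimes>\<^bsub>R\<^esub> s' \<ominus>\<^bsub>R\<^esub> a' \<otimes>\<^bsub>R\<^esub> s)) \<oplus>\<^bsub>R\<^esub>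
          u \<otimes>\<^bsub>R\<^esub> a' \<otimes>\<^bsub>R\<^esub> s \<otimes>\<^bsub>R\<^esub> (w \<otimes>\<^bsub>R\<^esub> (b \<otimes>\<^bsub>R\<^esub> t' \<ominus>\<^bsub>R\<^esub> b' \<otimes>\<^bsub>R\<^esub> t)))"
        using m(1,3) m'(2,5) c by algebra
      also have "\<dots> = \<zero>\<^bsub>R\<^esub>" using m(1,3) m'(2,5) c by (simp add: e)
      finally show ?thesis
        using m m' by (intro fracI[where u = "u \<otimes>\<^bsub>R\<^esub> w"]) (auto intro: S)
    qed
    then have "?f (fst x \<otimes>\<^bsub>R\<^esub> fst y) (snd x \<otimes>\<^bsub>R\<^esub> snd y) = ?f (a \<otimes>\<^bsub>R\<^esub> b) (s \<otimes>\<^bsub>R\<^esub> t)"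
      if "x \<in> ?f a s" "y \<in> ?f b t" for x y
      using that by (cases x; cases y) simp
    then have "?f a s \<otimes>\<^bsub>?L\<^esub> ?f b t = (\<Union>x\<in>?f a s. \<Union>y\<in>?f b t. ?f (a \<otimes>\<^bsub>R\<^esub> b) (s \<otimes>\<^bsub>R\<^esub> t))"
      by (simp add: localization_def case_prod_beta cong: SUP_cong)
    also have "\<dots> = ?f (a \<otimes>\<^bsub>R\<^esub> b) (s \<otimes>\<^bsub>R\<^esub> t)" using self m by blast
    finally show ?thesis .
  qed
  have add: "?f a s \<oplus>\<^bsub>?L\<^esub> ?f b t = ?f (a \<otimes>\<^bsub>R\<^esub> t \<oplus>\<^bsub>R\<^esub> b \<otimes>\<^bsub>R\<^esub> s) (s \<otimes>\<^bsub>R\<^esub> t)"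
    if m: "a \<in> carrier R" "s \<in> S" "b \<in> carrier R" "t \<in> S" for a s b t
  proof -
    have "?f (a' \<otimes>\<^bsub>R\<^esub> t' \<oplus>\<^bsub>R\<^esub> b' \<otimes>\<^bsub>R\<^esub> s') (s' \<otimes>\<^bsub>R\<^esub> t') = ?f (a \<otimes>\<^bsub>R\<^esub> t \<oplus>\<^bsub>R\<^esub> b \<otimes>\<^bsub>R\<^esub> s) (s \<otimes>\<^bsub>R\<^esub> t)"
      if h: "(a', s') \<in> ?f a s" "(b', t') \<in> ?f b t" for a' s' b' t'
    proof -
      from fracD[OF h(1)] fracD[OF h(2)] obtain u w where
        m': "u \<in> S" "a' \<in> carrier R" "s' \<in> S" "w \<in> S" "b' \<in> carrier R" "t' \<in> S"
        and e: "u \<otimes>\<^bsub>R\<^esub> (a \<otimes>\<^bsub>R\<^esub> s' \<ominus>\<^bsub>R\<^esub> a' \<otimes>\<^bsub>R\<^esub> s) = \<zero>\<^bsub>R\<^esub>"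
          "w \<otimes>\<^bsub>R\<^esub> (b \<otimes>\<^bsub>R\<^esub> t' \<ominus>\<^bsub>R\<^esub> b' \<otimes>\<^bsub>R\<^esub> t) = \<zero>\<^bsub>R\<^esub>" by auto
      have c: "s \<in> carrier R" "t \<in> carrier R" "s' \<in> carrier R" "t' \<in> carrier R"
        "u \<in> carrier R" "w \<in> carrier R" using m m' Sc by auto
      have "(u \<otimes>\<^bsub>R\<^esub> w) \<otimes>\<^bsub>R\<^esub> ((a' \<otimes>\<^bsub>R\<^esub> t' \<oplus>\<^bsub>R\<^esub> b' \<otimes>\<^bsub>R\<^esub> s') \<otimes>\<^bsub>R\<^esub> (s \<otimes>\<^bsub>R\<^esub> t) \<ominus>\<^bsub>R\<^esub>
            (a \<otimes>\<^bsub>R\<^esub> t \<oplus>\<^bsub>R\<^esub> b \<otimes>\<^bsub>R\<^esub> s) \<otimes>\<^bsub>R\<^esub> (s' \<otimes>\<^bsub>R\<^esub> t'))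
        = \<ominus>\<^bsub>R\<^esub> (w \<otimes>\<^bsub>R\<^esub> t \<otimes>\<^bsub>R\<^esub> t' \<otimes>\<^bsub>R\<^esub> (u \<otimes>\<^bsub>R\<^esub> (a \<otimes>\<^bsub>R\<^esub> s' \<ominus>\<^bsub>R\<^esub> a' \<otimes>\<^bsub>R\<^esub> s)) \<oplus>\<^bsub>R\<^esub>
          u \<otimes>\<^bsub>R\<^esub> s \<otimes>\<^bsub>R\<^esub> s' \<otimes>\<^bsub>R\<^esub> (w \<otimes>\<^bsub>R\<^esub> (b \<otimes>\<^bsub>R\<^esub> t' \<ominus>\<^bsub>R\<^esub> b' \<otimes>\<^bsub>R\<^esub> t)))"
        using m(1,3) m'(2,5) c by algebra
      also have "\<dots> = \<zero>\<^bsub>R\<^esub>" using m(1,3) m'(2,5) c by (simp add: e)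
      finally show ?thesis
        using m m' c by (intro fracI[where u = "u \<otimes>\<^bsub>R\<^esub> w"]) (auto intro: S)
    qed
    then have "?f (fst x \<otimes>\<^bsub>R\<^esub> snd y \<oplus>\<^bsub>R\<^esub> fst y \<otimes>\<^bsub>R\<^esub> snd x) (snd x \<otimes>\<^bsub>R\<^esub> snd y) = ?f (a \<otimes>\<^bsub>R\<^esub> t \<oplus>\<^bsub>R\<^esub> b \<otimes>\<^bsub>R\<^esub> s) (s \<otimes>\<^bsub>R\<^esub> t)"
      if "x \<in> ?f a s" "y \<in> ?f b t" for x y
      using that by (cases x; cases y) simp
    then have "?f a s \<oplus>\<^bsub>?L\<^esub> ?f b t = (\<Union>x\<in>?f a s. \<Union>y\<in>?f b t. ?f (a \<otimes>\<^bsub>R\<^esub> t \<oplus>\<^bsub>R\<^esub> b \<otimes>\<^bsub>R\<^esub> s) (s \<otimes>\<^bsub>R\<^esub> t))"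
      by (simp add: localization_def case_prod_beta cong: SUP_cong)
    also have "\<dots> = ?f (a \<otimes>\<^bsub>R\<^esub> t \<oplus>\<^bsub>R\<^esub> b \<otimes>\<^bsub>R\<^esub> s) (s \<otimes>\<^bsub>R\<^esub> t)" using self m by blast
    finally show ?thesis .
  qed
  have car: "x \<in> carrier ?L \<longleftrightarrow> (\<exists>a\<in>carrier R. \<exists>s\<in>S. x = ?f a s)" for x
    by (auto simp: localization_def quotient_def frac_def)
  have fc: "?f a s \<in> carrier ?L" if "a \<in> carrier R" "s \<in> S" for a s
    using that car by auto
  have one: "\<one>\<^bsub>?L\<^esub> = ?f \<one>\<^bsub>R\<^esub> \<one>\<^bsub>R\<^esub>" and zero: "\<zero>\<^bsub>?L\<^esub> = ?f \<zero>\<^bsub>R\<^esub> \<one>\<^bsub>R\<^esub>"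
    by (auto simp: localization_def)
  have S3: "s \<otimes>\<^bsub>R\<^esub> t \<in> S" if "s \<in> S" "t \<in> S" for s t using that S by auto
  show ?thesis
  proof (rule cringI)
    show "abelian_group ?L"
    proof (rule abelian_groupI)
      fix x assume "x \<in> carrier ?L"
      then obtain a s where x: "a \<in> carrier R" "s \<in> S" "x = ?f a s" by (auto simp: car)
      have c: "s \<in> carrier R" using x Sc by auto
      have "?f (\<ominus>\<^bsub>R\<^esub> a) s \<oplus>\<^bsub>?L\<^esub> x = \<zero>\<^bsub>?L\<^esub>"
        unfolding x(3) zero using x(1,2) c
        by (subst add) (simp_all add: fracI1 S S3 l_minus l_neg)
      then show "\<exists>y\<in>carrier ?L. y \<oplus>\<^bsub>?L\<^esub> x = \<zero>\<^bsub>?L\<^esub>"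
        using fc[of "\<ominus>\<^bsub>R\<^esub> a" s] x by auto
      show "\<zero>\<^bsub>?L\<^esub> \<oplus>\<^bsub>?L\<^esub> x = x"
        unfolding x(3) zero using x(1,2) c
        by (subst add) (simp_all add: S S3)
    next
      fix x y assume "x \<in> carrier ?L" "y \<in> carrier ?L"
      then obtain a s b t where x: "a \<in> carrier R" "s \<in> S" "b \<in> carrier R" "t \<in> S"
        and [simp]: "x = ?f a s" "y = ?f b t" by (auto simp: car)
      have c: "s \<in> carrier R" "t \<in> carrier R" using x Sc by auto
      show "x \<oplus>\<^bsub>?L\<^esub> y \<in> carrier ?L" using x c by (simp add: add fc S3)
      show "x \<oplus>\<^bsub>?L\<^esub> y = y \<oplus>\<^bsub>?L\<^esub> x" using x c by (simp add: add m_comm a_comm)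
    next
      fix x y z assume "x \<in> carrier ?L" "y \<in> carrier ?L" "z \<in> carrier ?L"
      then obtain a s b t d w where x: "a \<in> carrier R" "b \<in> carrier R" "d \<in> carrier R"
          "s \<in> S" "t \<in> S" "w \<in> S"
        and [simp]: "x = ?f a s" "y = ?f b t" "z = ?f d w" by (auto simp: car)
      have c: "s \<in> carrier R" "t \<in> carrier R" "w \<in> carrier R" using x Sc by auto
      have "(a \<otimes>\<^bsub>R\<^esub> t \<oplus>\<^bsub>R\<^esub> b \<otimes>\<^bsub>R\<^esub> s) \<otimes>\<^bsub>R\<^esub> w \<oplus>\<^bsub>R\<^esub> d \<otimes>\<^bsub>R\<^esub> (s \<otimes>\<^bsub>R\<^esub> t) =
          a \<otimes>\<^bsub>R\<^esub> (t \<otimes>\<^bsub>R\<^esub> w) \<oplus>\<^bsub>R\<^esub> (b \<otimes>\<^bsub>R\<^esub> w \<oplus>\<^bsub>R\<^esub> d \<otimes>\<^bsub>R\<^esub> t) \<otimes>\<^bsub>R\<^esub> s"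
        using x(1-3) c by algebra
      then show "x \<oplus>\<^bsub>?L\<^esub> y \<oplus>\<^bsub>?L\<^esub> z = x \<oplus>\<^bsub>?L\<^esub> (y \<oplus>\<^bsub>?L\<^esub> z)"
        using x c by (simp add: add S3 m_assoc)
    qed (simp add: zero fc S)
    show "comm_monoid ?L"
    proof (rule comm_monoidI)
      fix x assume "x \<in> carrier ?L"
      then obtain a s where x: "a \<in> carrier R" "s \<in> S" "x = ?f a s" by (auto simp: car)
      then show "\<one>\<^bsub>?L\<^esub> \<otimes>\<^bsub>?L\<^esub> x = x" by (simp add: one mul S Sc)
    next
      fix x y assume "x \<in> carrier ?L" "y \<in> carrier ?L"
      then obtain a s b t where x: "a \<in> carrier R" "s \<in> S" "b \<in> carrier R" "t \<in> S"
        and [simp]: "x = ?f a s" "y = ?f b t" by (auto simp: car)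
      have c: "s \<in> carrier R" "t \<in> carrier R" using x Sc by auto
      show "x \<otimes>\<^bsub>?L\<^esub> y \<in> carrier ?L" using x c by (simp add: mul fc S3)
      show "x \<otimes>\<^bsub>?L\<^esub> y = y \<otimes>\<^bsub>?L\<^esub> x" using x c by (simp add: mul m_comm)
    next
      fix x y z assume "x \<in> carrier ?L" "y \<in> carrier ?L" "z \<in> carrier ?L"
      then show "x \<otimes>\<^bsub>?L\<^esub> y \<otimes>\<^bsub>?L\<^esub> z = x \<otimes>\<^bsub>?L\<^esub> (y \<otimes>\<^bsub>?L\<^esub> z)"
        by (auto simp: car mul S3 m_assoc Sc)
    qed (simp add: one fc S)
    fix x y z assume "x \<in> carrier ?L" "y \<in> carrier ?L" "z \<in> carrier ?L"
    then obtain a s b t d w where x: "a \<in> carrier R" "b \<in> carrier R" "d \<in> carrier R"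
        "s \<in> S" "t \<in> S" "w \<in> S"
      and [simp]: "x = ?f a s" "y = ?f b t" "z = ?f d w" by (auto simp: car)
    have c: "s \<in> carrier R" "t \<in> carrier R" "w \<in> carrier R" using x Sc by auto
    have "((a \<otimes>\<^bsub>R\<^esub> t \<oplus>\<^bsub>R\<^esub> b \<otimes>\<^bsub>R\<^esub> s) \<otimes>\<^bsub>R\<^esub> d) \<otimes>\<^bsub>R\<^esub> ((s \<otimes>\<^bsub>R\<^esub> w) \<otimes>\<^bsub>R\<^esub> (t \<otimes>\<^bsub>R\<^esub> w)) =
        ((a \<otimes>\<^bsub>R\<^esub> d) \<otimes>\<^bsub>R\<^esub> (t \<otimes>\<^bsub>R\<^esub> w) \<oplus>\<^bsub>R\<^esub> (b \<otimes>\<^bsub>R\<^esub> d) \<otimes>\<^bsub>R\<^esub> (s \<otimes>\<^bsub>R\<^esub> w)) \<otimes>\<^bsub>R\<^esub> ((s \<otimes>\<^bsub>R\<^esub> t) \<otimes>\<^bsub>R\<^esub> w)"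
      using x(1-3) c by algebra
    then show "(x \<oplus>\<^bsub>?L\<^esub> y) \<otimes>\<^bsub>?L\<^esub> z = x \<otimes>\<^bsub>?L\<^esub> z \<oplus>\<^bsub>?L\<^esub> y \<otimes>\<^bsub>?L\<^esub> z"
      using x c by (simp add: add mul S3, intro fracI1) (auto simp: S3)
  qed
qed

lemma cring_localization_at:
  assumes "maximalideal P R" "cring R"
  shows "cring (localization_at R P)"
proof -
  interpret cring R by fact
  interpret P: primeideal P R
    by (rule maximalideal_prime[OF assms(1)])
  show ?thesis
  proof (rule cring_localization[OF assms(2)])
    show "\<one>\<^bsub>R\<^esub> \<in> carrier R - P"
      using P.one_imp_carrier P.I_notcarr by blast
    show "s \<otimes>\<^bsub>R\<^esub> t \<in> carrier R - P" if "s \<in> carrier R - P" "t \<in> carrier R - P" for s t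
      using that P.I_prime m_closed by blast
  qed blast
qed

end

theory Submission
  imports Defs
begin

text \<open>
Ideals of \<open>R\<^sub>P\<close> are compared through divisibility: \<open>R\<^sub>P\<close> is a chain ring if and only if no two
elements of \<open>R\<close> are incomparable at \<open>P\<close>, that is, for any two of them one divides the other in \<open>R\<^sub>P\<close>
(\<open>chain_ring_localization_iff\<close>).

Quasi-flatness is only used for ideals with two generators. It shows that if \<open>a\<close> and \<open>b\<close> are
incomparable at \<open>P\<close>, then every relation \<open>r a + s b = 0\<close> has coefficients that annihilate \<open>a\<close> and \<open>b\<close>
in \<open>R\<^sub>P\<close> (\<open>incomparable_relation\<close>). Consequently \<open>a\<close> and \<open>b\<close> have no common multiple in \<open>R\<^sub>P\<close> except
zero, they have the same annihilator there, and \<open>a\<^sup>2 = a b = 0\<close>.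

Since \<open>N\<close> is the only minimal prime ideal, it lies in every prime ideal and its elements are nilpotent.
So incomparable elements belong to \<open>N\<close>. If there is an incomparable pair at \<open>P\<close>, comparing other
elements with this pair shows that in \<open>R\<^sub>P\<close> every element outside \<open>N\<close> is regular and the product of
any two elements of \<open>N\<close> vanishes (\<open>regular_outside_prime\<close>, \<open>nilpotent_product_zero\<close>). Regularity of
the elements outside \<open>N\<close> lets the pair stay incomparable at every other maximal ideal
(\<open>incomparable_at_other_prime\<close>), which is the first assertion. The two vanishing statements then hold
at every maximal ideal, hence in \<open>R\<close>.

For the second assertion, a finitely generated ideal \<open>I\<close> is quasi-projective as soon as, at every
maximal ideal \<open>P\<close>, it has a basis over \<open>R\<^sub>P\<close> modulo its annihilator with a common denominator
(\<open>quasi_projective_of_local_bases\<close>). If \<open>R\<close> is arithmetical, or if \<open>I\<close> is not contained in \<open>N\<close>, one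
element of \<open>I\<close> divides all generators at \<open>P\<close> and is such a basis. Otherwise \<open>I \<subseteq> N\<close> is a torsion-free
module over the domain \<open>R/N\<close>, whose localizations at maximal ideals are chain rings, and a
spanning set that cannot be shrunk is a basis, by the usual argument over valuation rings
(\<open>local_basis_in_minimal_prime\<close>).
\<close>

section \<open>Minimal prime ideals and maximal ideals\<close>

text \<open>Expanding \<open>(x \<oplus> y)\<^sup>n\<^sup>+\<^sup>m\<close> one factor at a time, every factor raises the exponent of \<open>x\<close> or of
\<open>y\<close> in the monomial collected so far, until it is divisible by \<open>x\<^sup>n\<close> or by \<open>y\<^sup>m\<close>.\<close>

lemma (in cring) sum_power_annihilated:
  assumes c: "s \<in> carrier R" "x \<in> carrier R" "y \<in> carrier R"
    and x: "s \<otimes> x [^] (n::nat) = \<zero>" and y: "s \<otimes> y [^] (m::nat) = \<zero>"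
  shows "\<exists>k::nat. s \<otimes> (x \<oplus> y) [^] k = \<zero>"
proof -
  have "s \<otimes> (x [^] i \<otimes> y [^] j) \<otimes> (x \<oplus> y) [^] k = \<zero>"
    if "k = (n - i) + (m - j)" "i \<le> n" "j \<le> m" for i j k :: nat
    using that
  proof (induction k arbitrary: i j)
    case 0
    then have [simp]: "i = n" by simp
    have "s \<otimes> (x [^] n \<otimes> y [^] j) = (s \<otimes> x [^] n) \<otimes> y [^] j" using c by (simp add: m_assoc)
    then show ?case using c by (simp add: x)
  next
    case (Suc k)
    have a: "s \<otimes> (x [^] i \<otimes> y [^] j) \<otimes> (x \<oplus> y) [^] Suc k =
        s \<otimes> (x [^] Suc i \<otimes> y [^] j) \<otimes> (x \<oplus> y) [^] k \<oplus>
        s \<otimes> (x [^] i \<otimes> y [^] Suc j) \<otimes> (x \<oplus> y) [^] k"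
    proof -
      have p: "x [^] i \<in> carrier R" "y [^] j \<in> carrier R" "(x \<oplus> y) [^] k \<in> carrier R" using c by auto
      show ?thesis unfolding nat_pow_Suc using c p by algebra
    qed
    show ?case
    proof (cases "i < n \<and> j < m")
      case True
      then have "k = (n - Suc i) + (m - j)" "k = (n - i) + (m - Suc j)" using Suc.prems by auto
      then show ?thesis unfolding a using Suc.IH[of "Suc i" j] Suc.IH[of i "Suc j"] True by simp
    next
      case False
      then consider "i = n" | "j = m" using Suc.prems by linarith
      then show ?thesis
      proof cases
        case 1
        have "s \<otimes> (x [^] n \<otimes> y [^] j) = (s \<otimes> x [^] n) \<otimes> y [^] j" using c by (simp add: m_assoc)
        then show ?thesis using c 1 by (simp add: x)
      next
        case 2
        have "s \<otimes> (x [^] i \<otimes> y [^] m) = x [^] i \<otimes> (s \<otimes> y [^] m)" using c by (simp add: m_lcomm)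
        then show ?thesis using c 2 by (simp add: y)
      qed
    qed
  qed
  from this[of "n + m" 0 0] show ?thesis using c by auto
qed

text \<open>Zorn's lemma yields a maximal multiplicative set \<open>U \<supseteq> T\<close> without zero. If \<open>x \<notin> U\<close>, the set of all
\<open>s x\<^sup>n\<close> with \<open>s \<in> U\<close> must contain zero. This description of the complement of \<open>U\<close> shows that it
is an ideal, and it is a minimal prime ideal because a smaller prime ideal would have a larger
multiplicative complement.\<close>

lemma (in cring) minimal_prime_avoiding:
  assumes T: "T \<subseteq> carrier R" "\<one> \<in> T" "\<And>s t. s \<in> T \<Longrightarrow> t \<in> T \<Longrightarrow> s \<otimes> t \<in> T"
    and "\<zero> \<notin> T"
  obtains Q where "minimal_primeideal Q R" "Q \<inter> T = {}"
proof -
  define F where "F = {U. T \<subseteq> U \<and> U \<subseteq> carrier R \<and> \<zero> \<notin> U \<and> (\<forall>s\<in>U. \<forall>t\<in>U. s \<otimes> t \<in> U)}"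
  have "\<exists>U\<in>F. \<forall>X\<in>F. U \<subseteq> X \<longrightarrow> X = U"
  proof (rule subset_Zorn_nonempty)
    show "F \<noteq> {}" using assms by (auto simp: F_def)
    fix \<C> assume "\<C> \<noteq> {}" and ch: "subset.chain F \<C>"
    then have m: "U \<in> F" if "U \<in> \<C>" for U using that by (auto simp: subset_chain_def)
    have "s \<otimes> t \<in> \<Union>\<C>" if "s \<in> \<Union>\<C>" "t \<in> \<Union>\<C>" for s t
    proof -
      from that obtain U V where UV: "U \<in> \<C>" "s \<in> U" "V \<in> \<C>" "t \<in> V" by blast
      with ch have "U \<subseteq> V \<or> V \<subseteq> U" unfolding subset_chain_def by blast
      with UV m[of U] m[of V] show ?thesis unfolding F_def by blast
    qed
    moreover have "T \<subseteq> \<Union>\<C>" "\<Union>\<C> \<subseteq> carrier R" "\<zero> \<notin> \<Union>\<C>"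
      using m \<open>\<C> \<noteq> {}\<close> unfolding F_def by blast+
    ultimately show "\<Union>\<C> \<in> F" unfolding F_def by blast
  qed
  then obtain U where U: "U \<in> F" and max: "\<And>X. X \<in> F \<Longrightarrow> U \<subseteq> X \<Longrightarrow> X = U" by blast
  have Uc: "s \<in> carrier R" if "s \<in> U" for s using U that by (auto simp: F_def)
  have U1: "\<one> \<in> U" and U0: "\<zero> \<notin> U" and Um: "\<And>s t. s \<in> U \<Longrightarrow> t \<in> U \<Longrightarrow> s \<otimes> t \<in> U"
    using U T by (auto simp: F_def)
  have Up: "s [^] (n::nat) \<in> U" if "s \<in> U" for s n using that U1 Um by (induction n) auto
  have nil: "\<exists>s\<in>U. \<exists>n::nat. s \<otimes> x [^] n = \<zero>" if x: "x \<in> carrier R" "x \<notin> U" for x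
  proof (rule ccontr)
    assume ne: "\<not> ?thesis"
    define V where "V = {y. \<exists>s\<in>U. \<exists>n::nat. y = s \<otimes> x [^] n}"
    have UV: "U \<subseteq> V"
    proof
      fix s assume "s \<in> U"
      then have "s = s \<otimes> x [^] (0::nat)" "s \<in> U" using Uc by simp_all
      then show "s \<in> V" unfolding V_def by blast
    qed
    have "V \<in> F"
      unfolding F_def
    proof (intro CollectI conjI ballI)
      show "T \<subseteq> V" using UV U by (auto simp: F_def)
      show "V \<subseteq> carrier R" using Uc x by (auto simp: V_def)
      show "\<zero> \<notin> V" using ne unfolding V_def by fastforce
      fix a b assume "a \<in> V" "b \<in> V"
      then obtain s n t m where st: "s \<in> U" "t \<in> U" and "a = s \<otimes> x [^] (n::nat)"
        "b = t \<otimes> x [^] (m::nat)"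
        by (auto simp: V_def)
      then have "a \<otimes> b = (s \<otimes> t) \<otimes> x [^] (n + m)"
        using Uc[OF st(1)] Uc[OF st(2)] x by (simp add: nat_pow_mult[symmetric] m_ac)
      with st Um show "a \<otimes> b \<in> V" by (auto simp: V_def)
    qed
    with UV max have "V = U" by blast
    moreover have "x = \<one> \<otimes> x [^] (1::nat)" using x by simp
    then have "x \<in> V" unfolding V_def using U1 by blast
    ultimately show False using x by simp
  qed
  define Q where "Q = carrier R - U"
  have nilQ: "\<exists>s\<in>U. \<exists>n::nat. s \<otimes> x [^] n = \<zero>" if "x \<in> Q" for x
    using that nil[of x] by (simp add: Q_def)
  have mQ: "r \<otimes> x \<in> Q" if x: "x \<in> Q" and r: "r \<in> carrier R" for r x
  proof (rule ccontr)
    assume "r \<otimes> x \<notin> Q"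
    with x r have i: "r \<otimes> x \<in> U" by (auto simp: Q_def)
    from nilQ[OF x] obtain s and n :: nat where s: "s \<in> U" "s \<otimes> x [^] n = \<zero>" by blast
    have c: "x \<in> carrier R" "s \<in> carrier R" using x Uc s by (auto simp: Q_def)
    have "s \<otimes> (r \<otimes> x) [^] n = r [^] n \<otimes> (s \<otimes> x [^] n)"
      using c r by (simp add: nat_pow_distrib m_ac)
    then have "s \<otimes> (r \<otimes> x) [^] n = \<zero>" using s r by simp
    with Um[OF s(1) Up[OF i, of n]] U0 show False by simp
  qed
  have Qp: "primeideal Q R"
  proof (rule primeidealI)
    show "ideal Q R"
    proof (rule idealI[OF ring_axioms])
      show "subgroup Q (add_monoid R)"
      proof (rule add.subgroupI)
        show "Q \<subseteq> carrier R" by (auto simp: Q_def)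
        have "\<zero> \<in> Q" using U0 by (auto simp: Q_def)
        then show "Q \<noteq> {}" by auto
      next
        fix x assume x: "x \<in> Q"
        then have "\<ominus> x = (\<ominus> \<one>) \<otimes> x" by (auto simp: Q_def l_minus)
        then show "\<ominus> x \<in> Q" using mQ[OF x, of "\<ominus> \<one>"] by simp
      next
        fix x y assume x: "x \<in> Q" and y: "y \<in> Q"
        from nilQ[OF x] obtain s and n :: nat where s: "s \<in> U" "s \<otimes> x [^] n = \<zero>" by blast
        from nilQ[OF y] obtain t and m :: nat where t: "t \<in> U" "t \<otimes> y [^] m = \<zero>" by blast
        have c: "x \<in> carrier R" "y \<in> carrier R" "s \<in> carrier R" "t \<in> carrier R"
          using x y Uc s t by (auto simp: Q_def)
        have "(s \<otimes> t) \<otimes> x [^] n = t \<otimes> (s \<otimes> x [^] n)" "(s \<otimes> t) \<otimes> y [^] m = s \<otimes> (t \<otimes> y [^] m)"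
          using c by (simp_all add: m_ac)
        then obtain k :: nat where k: "(s \<otimes> t) \<otimes> (x \<oplus> y) [^] k = \<zero>"
          using sum_power_annihilated[of "s \<otimes> t" x y n m] c s t by auto
        show "x \<oplus> y \<in> Q"
          using Um[OF Um[OF s(1) t(1)] Up[of "x \<oplus> y" k]] k U0 c by (auto simp: Q_def)
      qed
    next
      fix a x assume "a \<in> Q" "x \<in> carrier R"
      then show "x \<otimes> a \<in> Q" "a \<otimes> x \<in> Q" using mQ[of a x] by (auto simp: Q_def m_comm)
    qed
    show "cring R" by (rule is_cring)
    show "carrier R \<noteq> Q" using U1 by (auto simp: Q_def)
    show "a \<in> Q \<or> b \<in> Q" if "a \<in> carrier R" "b \<in> carrier R" "a \<otimes> b \<in> Q" for a b
      using that Um by (auto simp: Q_def)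
  qed
  have "minimal_primeideal Q R"
    unfolding minimal_primeideal_def
  proof (intro conjI allI impI Qp)
    fix Q' assume Q': "primeideal Q' R" "Q' \<subseteq> Q"
    then interpret Q': primeideal Q' R by blast
    have "carrier R - Q' \<in> F"
      using Q' U Q'.I_prime Q'.zero_closed unfolding F_def Q_def by blast
    then have "carrier R - Q' = U" using max[of "carrier R - Q'"] Q'(2) Uc by (auto simp: Q_def)
    then show "Q' = Q" using Q'.a_subset unfolding Q_def by blast
  qed
  moreover have "Q \<inter> T = {}" using U by (auto simp: F_def Q_def)
  ultimately show ?thesis by (rule that)
qed

text \<open>The uniqueness of the minimal prime ideal \<open>N\<close> enters through the next two lemmas: \<open>N\<close> lies in
every prime ideal and consists of nilpotent elements. Both come from a minimal prime ideal that
avoids a suitable multiplicative set and can only be \<open>N\<close>.\<close>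

lemma (in cring) unique_minimal_prime_subset_prime:
  assumes N: "\<And>Q. minimal_primeideal Q R \<Longrightarrow> Q = N" and P: "primeideal P R"
  shows "N \<subseteq> P"
proof -
  interpret P: primeideal P R by fact
  obtain Q where Q: "minimal_primeideal Q R" "Q \<inter> (carrier R - P) = {}"
  proof (rule minimal_prime_avoiding)
    show "\<one> \<in> carrier R - P" using P.I_notcarr P.one_imp_carrier by auto
    show "s \<otimes> t \<in> carrier R - P" if "s \<in> carrier R - P" "t \<in> carrier R - P" for s t
      using that P.I_prime by auto
  qed auto
  interpret Q: primeideal Q R using Q(1) by (simp add: minimal_primeideal_def)
  have "Q \<subseteq> carrier R" by (rule Q.a_subset)
  with N[OF Q(1)] Q(2) show ?thesis by auto
qed

lemma (in cring) unique_minimal_prime_nilpotent: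
  assumes N: "\<And>Q. minimal_primeideal Q R \<Longrightarrow> Q = N" and x: "x \<in> N" "x \<in> carrier R"
  shows "\<exists>n::nat. x [^] n = \<zero>"
proof (rule ccontr)
  assume ne: "\<not> ?thesis"
  obtain Q where Q: "minimal_primeideal Q R" "Q \<inter> range (\<lambda>n::nat. x [^] n) = {}"
  proof (rule minimal_prime_avoiding)
    show "\<one> \<in> range (\<lambda>n::nat. x [^] n)" using nat_pow_0[of x] by (metis rangeI)
    show "s \<otimes> t \<in> range (\<lambda>n::nat. x [^] n)"
      if "s \<in> range (\<lambda>n::nat. x [^] n)" "t \<in> range (\<lambda>n::nat. x [^] n)" for s t
      proof -
      from that obtain n m :: nat where "s = x [^] n" "t = x [^] m" by blast
      then have "s \<otimes> t = x [^] (n + m)" using x by (simp add: nat_pow_mult)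
      then show ?thesis by blast
    qed
    show "\<zero> \<notin> range (\<lambda>n::nat. x [^] n)" using ne by force
  qed (use x in auto)
  have "x [^] (1::nat) \<in> range (\<lambda>n::nat. x [^] n)" by blast
  then have "x \<in> range (\<lambda>n::nat. x [^] n)" using x by simp
  with N[OF Q(1)] Q(2) x show False by blast
qed

lemma (in ring) ideal_subset_maximalideal:
  assumes J: "ideal J R" "\<one> \<notin> J"
  obtains P where "maximalideal P R" "J \<subseteq> P"
proof -
  define F where "F = {I. ideal I R \<and> J \<subseteq> I \<and> \<one> \<notin> I}"
  have "\<exists>P\<in>F. \<forall>X\<in>F. P \<subseteq> X \<longrightarrow> X = P"
  proof (rule subset_Zorn_nonempty)
    show "F \<noteq> {}" using J by (auto simp: F_def)
    fix \<C> assume ne: "\<C> \<noteq> {}" and ch: "subset.chain F \<C>"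
    then have m: "ideal I R" if "I \<in> \<C>" for I using that by (auto simp: subset_chain_def F_def)
    have "ideal (\<Union>\<C>) R"
    proof (rule idealI[OF ring_axioms])
      show "subgroup (\<Union>\<C>) (add_monoid R)"
      proof (rule add.subgroupI)
        show "\<Union>\<C> \<subseteq> carrier R" using m ideal.Icarr by fast
        obtain I where "I \<in> \<C>" using ne by blast
        then show "\<Union>\<C> \<noteq> {}" using additive_subgroup.zero_closed[OF ideal.axioms(1)[OF m]] by blast
        show "\<ominus> x \<in> \<Union>\<C>" if "x \<in> \<Union>\<C>" for x
          using that additive_subgroup.a_inv_closed[OF ideal.axioms(1)[OF m]] by blast
        fix x y assume "x \<in> \<Union>\<C>" "y \<in> \<Union>\<C>"
        then obtain I J where IJ: "I \<in> \<C>" "x \<in> I" "J \<in> \<C>" "y \<in> J" by blast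
        with ch have "I \<subseteq> J \<or> J \<subseteq> I" unfolding subset_chain_def by blast
        with IJ obtain K where K: "K \<in> \<C>" "x \<in> K" "y \<in> K" by blast
        then show "x \<oplus> y \<in> \<Union>\<C>"
          using additive_subgroup.a_closed[OF ideal.axioms(1)[OF m[OF K(1)]]] by blast
      qed
      fix a x assume a: "a \<in> \<Union>\<C>" and x: "x \<in> carrier R"
      then obtain I where I: "I \<in> \<C>" "a \<in> I" by blast
      show "x \<otimes> a \<in> \<Union>\<C>" "a \<otimes> x \<in> \<Union>\<C>"
        using I ideal.I_l_closed[OF m[OF I(1)] I(2) x] ideal.I_r_closed[OF m[OF I(1)] I(2) x] by auto
    qed
    then show "\<Union>\<C> \<in> F" using ne ch unfolding subset_chain_def F_def by blast
  qed
  then obtain P where P: "P \<in> F" and max: "\<And>X. X \<in> F \<Longrightarrow> P \<subseteq> X \<Longrightarrow> X = P" by blast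
  have "maximalideal P R"
  proof (rule maximalidealI)
    show "ideal P R" "carrier R \<noteq> P" using P by (auto simp: F_def)
    fix I assume I: "ideal I R" "P \<subseteq> I" "I \<subseteq> carrier R"
    show "I = P \<or> I = carrier R"
    proof (cases "\<one> \<in> I")
      case True then show ?thesis using ideal.one_imp_carrier[OF I(1)] by simp
    next
      case False then show ?thesis using max[of I] I P by (auto simp: F_def)
    qed
  qed
  moreover have "J \<subseteq> P" using P by (auto simp: F_def)
  ultimately show ?thesis by (rule that)
qed

section \<open>Quotient modules\<close>

lemma module_homsD:
  assumes "f \<in> module_homs R M N"
  shows "x \<in> carrier M \<Longrightarrow> f x \<in> carrier N"
    and "x \<in> carrier M \<Longrightarrow> y \<in> carrier M \<Longrightarrow> f (x \<oplus>\<^bsub>M\<^esub> y) = f x \<oplus>\<^bsub>N\<^esub> f y"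
    and "a \<in> carrier R \<Longrightarrow> x \<in> carrier M \<Longrightarrow> f (a \<odot>\<^bsub>M\<^esub> x) = a \<odot>\<^bsub>N\<^esub> f x"
  using assms by (auto simp: module_homs_def hom_def)

lemma module_homsI:
  assumes "\<And>x. x \<in> carrier M \<Longrightarrow> f x \<in> carrier N"
    and "\<And>x y. x \<in> carrier M \<Longrightarrow> y \<in> carrier M \<Longrightarrow> f (x \<oplus>\<^bsub>M\<^esub> y) = f x \<oplus>\<^bsub>N\<^esub> f y"
    and "\<And>a x. a \<in> carrier R \<Longrightarrow> x \<in> carrier M \<Longrightarrow> f (a \<odot>\<^bsub>M\<^esub> x) = a \<odot>\<^bsub>N\<^esub> f x"
  shows "f \<in> module_homs R M N"
  using assms by (auto simp: module_homs_def hom_def)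

lemma module_homs_zero:
  assumes "module R M" "module R N" and f: "f \<in> module_homs R M N"
  shows "f \<zero>\<^bsub>M\<^esub> = \<zero>\<^bsub>N\<^esub>"
proof -
  interpret M: module R M by fact
  interpret N: module R N by fact
  have "f \<zero>\<^bsub>M\<^esub> = f (\<zero>\<^bsub>R\<^esub> \<odot>\<^bsub>M\<^esub> \<zero>\<^bsub>M\<^esub>)" by simp
  also have "\<dots> = \<zero>\<^bsub>R\<^esub> \<odot>\<^bsub>N\<^esub> f \<zero>\<^bsub>M\<^esub>" by (rule module_homsD(3)[OF f]) auto
  also have "\<dots> = \<zero>\<^bsub>N\<^esub>" using module_homsD(1)[OF f] by simp
  finally show ?thesis .
qed

lemma module_homs_diff:
  assumes "module R M" "module R N" and f: "f \<in> module_homs R M N"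
    and x: "x \<in> carrier M" "y \<in> carrier M"
  shows "f (x \<ominus>\<^bsub>M\<^esub> y) = f x \<ominus>\<^bsub>N\<^esub> f y"
proof -
  interpret M: module R M by fact
  interpret N: module R N by fact
  have "f (x \<ominus>\<^bsub>M\<^esub> y) \<oplus>\<^bsub>N\<^esub> f y = f ((x \<ominus>\<^bsub>M\<^esub> y) \<oplus>\<^bsub>M\<^esub> y)"
    using module_homsD(2)[OF f] x by simp
  also have "(x \<ominus>\<^bsub>M\<^esub> y) \<oplus>\<^bsub>M\<^esub> y = x" using x by (simp add: M.M.minus_eq M.M.a_assoc M.M.l_neg)
  finally have "f x = f (x \<ominus>\<^bsub>M\<^esub> y) \<oplus>\<^bsub>N\<^esub> f y" ..
  moreover have "f (x \<ominus>\<^bsub>M\<^esub> y) \<in> carrier N" "f y \<in> carrier N"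
    using module_homsD(1)[OF f] x by auto
  ultimately show ?thesis by (simp add: N.M.minus_eq N.M.a_assoc N.M.r_neg)
qed

text \<open>Homomorphisms out of an ideal \<open>(a, b)\<close> and out of \<open>R\<^sup>2/(r, s)\<close> are both defined below as
homomorphisms out of \<open>R\<^sup>2\<close> that vanish on the relations.\<close>

lemma module_homs_factor:
  assumes "module R L" "module R V" "module R W"
    and p: "p \<in> module_homs R L V" "p ` carrier L = carrier V"
    and g: "g \<in> module_homs R L W"
    and ker: "\<And>x. x \<in> carrier L \<Longrightarrow> p x = \<zero>\<^bsub>V\<^esub> \<Longrightarrow> g x = \<zero>\<^bsub>W\<^esub>"
  obtains u where "u \<in> module_homs R V W" "\<And>x. x \<in> carrier L \<Longrightarrow> u (p x) = g x"
proof -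
  interpret L: module R L by fact
  interpret V: module R V by fact
  interpret W: module R W by fact
  define u where "u y = g (inv_into (carrier L) p y)" for y
  have u: "u (p x) = g x" if x: "x \<in> carrier L" for x
  proof -
    let ?z = "inv_into (carrier L) p (p x)"
    have z: "?z \<in> carrier L" "p ?z = p x"
      using x by (auto intro: inv_into_into f_inv_into_f)
    have "p (?z \<ominus>\<^bsub>L\<^esub> x) = \<zero>\<^bsub>V\<^esub>"
      using module_homs_diff[OF assms(1,2) p(1) z(1) x] z(2) module_homsD(1)[OF p(1) x]
      by (simp add: V.M.minus_eq V.M.r_neg)
    with ker z x have "g (?z \<ominus>\<^bsub>L\<^esub> x) = \<zero>\<^bsub>W\<^esub>" by simp
    then have "g ?z \<ominus>\<^bsub>W\<^esub> g x = \<zero>\<^bsub>W\<^esub>" using module_homs_diff[OF assms(1,3) g z(1) x] by simp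
    then show ?thesis
      unfolding u_def using module_homsD(1)[OF g] x z by (metis W.M.add.inv_closed W.M.minus_eq W.M.minus_equality W.M.minus_minus)
  qed
  show ?thesis
  proof
    show "u \<in> module_homs R V W"
    proof (rule module_homsI)
      fix x assume "x \<in> carrier V"
      then obtain x' where x': "x' \<in> carrier L" "x = p x'" using p(2) by blast
      then show "u x \<in> carrier W" using u module_homsD(1)[OF g] by simp
      fix a assume "a \<in> carrier R"
      with x' have "a \<odot>\<^bsub>V\<^esub> x = p (a \<odot>\<^bsub>L\<^esub> x')" using module_homsD(3)[OF p(1)] by simp
      then show "u (a \<odot>\<^bsub>V\<^esub> x) = a \<odot>\<^bsub>W\<^esub> u x"
        using u x' \<open>a \<in> carrier R\<close> module_homsD(3)[OF g] by simp
    next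
      fix x y assume "x \<in> carrier V" "y \<in> carrier V"
      then obtain x' y' where x': "x' \<in> carrier L" "x = p x'" "y' \<in> carrier L" "y = p y'"
        using p(2) by blast
      then have "x \<oplus>\<^bsub>V\<^esub> y = p (x' \<oplus>\<^bsub>L\<^esub> y')" using module_homsD(2)[OF p(1)] by simp
      then show "u (x \<oplus>\<^bsub>V\<^esub> y) = u x \<oplus>\<^bsub>W\<^esub> u y" using u x' module_homsD(2)[OF g] by simp
    qed
  qed (rule u)
qed

lemma
  assumes "module R M" "submodule X R M"
  shows carrier_quot_module: "carrier (quot_module R M X) = (\<lambda>x. X +>\<^bsub>M\<^esub> x) ` carrier M"
    and zero_quot_module: "\<zero>\<^bsub>quot_module R M X\<^esub> = X"
    and rcoset_module_homs: "(\<lambda>x. X +>\<^bsub>M\<^esub> x) \<in> module_homs R M (quot_module R M X)"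
    and rcoset_eq_iff: "\<And>x y. x \<in> carrier M \<Longrightarrow> y \<in> carrier M \<Longrightarrow>
      X +>\<^bsub>M\<^esub> x = X +>\<^bsub>M\<^esub> y \<longleftrightarrow> x \<ominus>\<^bsub>M\<^esub> y \<in> X"
proof -
  interpret module R M by fact
  interpret X: submodule X R M by fact
  interpret A: abelian_subgroup X M
    using additive_subgroup.intro[OF X.subgroup_axioms] module.axioms(2)[OF assms(1)]
    by (rule abelian_subgroupI3)
  let ?Q = "quot_module R M X"
  show car: "carrier ?Q = (\<lambda>x. X +>\<^bsub>M\<^esub> x) ` carrier M"
    by (auto simp: quot_module_def A_RCOSETS_def')
  show "\<zero>\<^bsub>?Q\<^esub> = X" by (simp add: quot_module_def)
  show eq: "X +>\<^bsub>M\<^esub> x = X +>\<^bsub>M\<^esub> y \<longleftrightarrow> x \<ominus>\<^bsub>M\<^esub> y \<in> X"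
    if xy: "x \<in> carrier M" "y \<in> carrier M" for x y
  proof
    assume e: "X +>\<^bsub>M\<^esub> x = X +>\<^bsub>M\<^esub> y"
    have "x \<in> X +>\<^bsub>M\<^esub> x" by (rule A.a_rcos_self[OF xy(1)])
    then obtain h where h: "h \<in> X" "x = h \<oplus>\<^bsub>M\<^esub> y" unfolding e by (auto simp: a_r_coset_def')
    moreover have "h \<in> carrier M" using h(1) A.a_subset by auto
    ultimately show "x \<ominus>\<^bsub>M\<^esub> y \<in> X" using xy by (simp add: M.minus_eq M.a_assoc M.r_neg)
  next
    assume e: "x \<ominus>\<^bsub>M\<^esub> y \<in> X"
    have "x = (x \<ominus>\<^bsub>M\<^esub> y) \<oplus>\<^bsub>M\<^esub> y" using xy by (simp add: M.minus_eq M.a_assoc M.l_neg)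
    with e have "x \<in> X +>\<^bsub>M\<^esub> y" by (auto simp: a_r_coset_def')
    then show "X +>\<^bsub>M\<^esub> x = X +>\<^bsub>M\<^esub> y" using A.a_repr_independence' xy by simp
  qed
  show "(\<lambda>x. X +>\<^bsub>M\<^esub> x) \<in> module_homs R M ?Q"
  proof (rule module_homsI)
    show "X +>\<^bsub>M\<^esub> x \<in> carrier ?Q" if "x \<in> carrier M" for x using that car by auto
    show "X +>\<^bsub>M\<^esub> (x \<oplus>\<^bsub>M\<^esub> y) = (X +>\<^bsub>M\<^esub> x) \<oplus>\<^bsub>?Q\<^esub> (X +>\<^bsub>M\<^esub> y)"
      if "x \<in> carrier M" "y \<in> carrier M" for x y
      using that A.a_rcos_sum by (auto simp: quot_module_def)
    fix a x assume a: "a \<in> carrier R" and x: "x \<in> carrier M"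
    have "X +>\<^bsub>M\<^esub> (a \<odot>\<^bsub>M\<^esub> y) = X +>\<^bsub>M\<^esub> (a \<odot>\<^bsub>M\<^esub> x)" if y: "y \<in> X +>\<^bsub>M\<^esub> x" for y
    proof -
      from y obtain h where h: "h \<in> X" and [simp]: "y = h \<oplus>\<^bsub>M\<^esub> x"
        by (auto simp: a_r_coset_def')
      have hM: "h \<in> carrier M" using h A.a_subset by auto
      have "a \<odot>\<^bsub>M\<^esub> y \<in> X +>\<^bsub>M\<^esub> (a \<odot>\<^bsub>M\<^esub> x)"
        using a x h hM by (auto simp: smult_r_distr a_r_coset_def')
      then show ?thesis using a x A.a_repr_independence' by simp
    qed
    then have "a \<odot>\<^bsub>?Q\<^esub> (X +>\<^bsub>M\<^esub> x) = (\<Union>y\<in>X +>\<^bsub>M\<^esub> x. X +>\<^bsub>M\<^esub> (a \<odot>\<^bsub>M\<^esub> x))"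
      by (simp add: quot_module_def cong: SUP_cong)
    also have "\<dots> = X +>\<^bsub>M\<^esub> (a \<odot>\<^bsub>M\<^esub> x)" using A.a_rcos_self[OF x] by blast
    finally show "X +>\<^bsub>M\<^esub> (a \<odot>\<^bsub>M\<^esub> x) = a \<odot>\<^bsub>?Q\<^esub> (X +>\<^bsub>M\<^esub> x)" ..
  qed
qed

lemma module_free_module: "cring R \<Longrightarrow> module R (free_module R n)"
  unfolding free_module_def
  by (intro module_power_module module_ideal_module ring.oneideal cring.axioms(1))

lemma
  assumes "module R M" "submodule X R M"
  shows rcoset_eq_self_iff: "x \<in> carrier M \<Longrightarrow> X +>\<^bsub>M\<^esub> x = X \<longleftrightarrow> x \<in> X"
    and submodule_subset_carrier: "X \<subseteq> carrier M"
proof -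
  interpret module R M by fact
  interpret X: submodule X R M by fact
  show s: "X \<subseteq> carrier M" using X.subset by simp
  assume x: "x \<in> carrier M"
  have m0: "\<ominus>\<^bsub>M\<^esub> \<zero>\<^bsub>M\<^esub> = \<zero>\<^bsub>M\<^esub>" by (metis M.r_neg M.l_zero M.a_inv_closed M.zero_closed)
  have "X +>\<^bsub>M\<^esub> \<zero>\<^bsub>M\<^esub> = X" using s by simp
  then show "X +>\<^bsub>M\<^esub> x = X \<longleftrightarrow> x \<in> X"
    using rcoset_eq_iff[OF assms x, of "\<zero>\<^bsub>M\<^esub>"] x m0 by (simp add: M.minus_eq)
qed

lemma finitely_presented_quot_free_module:
  assumes R: "cring R" and X: "submodule X R (free_module R n)"
    and fg: "fin_gen_submodule R (free_module R n) X"
  shows "finitely_presented R (quot_module R (free_module R n) X)"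
proof -
  note F = module_free_module[OF R, of n]
  have "{x \<in> carrier (free_module R n). X +>\<^bsub>free_module R n\<^esub> x =
      \<zero>\<^bsub>quot_module R (free_module R n) X\<^esub>} = X"
    using rcoset_eq_self_iff[OF F X] submodule_subset_carrier[OF F X] by (auto simp: zero_quot_module[OF F X])
  with fg show ?thesis
    unfolding finitely_presented_def
    using module_quot_module[OF F X] rcoset_module_homs[OF F X] carrier_quot_module[OF F X]
    by (intro conjI exI[of _ n] bexI[of _ "\<lambda>x. X +>\<^bsub>free_module R n\<^esub> x"]) auto
qed

lemma cyclic_submodule:
  assumes "module R M" and e: "e \<in> carrier M"
  shows "submodule ((\<lambda>c. c \<odot>\<^bsub>M\<^esub> e) ` carrier R) R M"
    and "fin_gen_submodule R M ((\<lambda>c. c \<odot>\<^bsub>M\<^esub> e) ` carrier R)"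
proof -
  interpret module R M by fact
  let ?X = "(\<lambda>c. c \<odot>\<^bsub>M\<^esub> e) ` carrier R"
  show s: "submodule ?X R M"
  proof (rule submoduleI)
    show "?X \<subseteq> carrier M" using e by auto
    show "\<zero>\<^bsub>M\<^esub> \<in> ?X" using e by (intro image_eqI[of _ _ "\<zero>\<^bsub>R\<^esub>"]) auto
    show "\<ominus>\<^bsub>M\<^esub> a \<in> ?X" if "a \<in> ?X" for a
      using that e by (auto simp: smult_l_minus[symmetric])
    show "a \<oplus>\<^bsub>M\<^esub> b \<in> ?X" if "a \<in> ?X" "b \<in> ?X" for a b
      using that e by (auto simp: smult_l_distr[symmetric])
    show "a \<odot>\<^bsub>M\<^esub> x \<in> ?X" if "a \<in> carrier R" "x \<in> ?X" for a x
      using that e by (auto simp: smult_assoc1[symmetric])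
  qed
  have "?X \<subseteq> H" if "submodule H R M" "{e} \<subseteq> H" for H
    using that submodule.smult_closed by fastforce
  moreover have "e \<in> ?X" using e by (intro image_eqI[of _ _ "\<one>\<^bsub>R\<^esub>"]) auto
  ultimately have "?X = \<Inter>{H. submodule H R M \<and> {e} \<subseteq> H}" using s by blast
  with e show "fin_gen_submodule R M ?X"
    unfolding fin_gen_submodule_def by (intro exI[of _ "{e}"]) auto
qed

section \<open>Relations between two elements of an fqf-ring\<close>

lemma (in cring) genideal_pair:
  assumes "a \<in> carrier R" "b \<in> carrier R"
  shows "Idl {a, b} = {x \<otimes> a \<oplus> y \<otimes> b | x y. x \<in> carrier R \<and> y \<in> carrier R}" (is "_ = ?J")
proof
  have "ideal ?J R"
  proof (rule idealI[OF ring_axioms])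
    show "subgroup ?J (add_monoid R)"
    proof (rule add.subgroupI)
      show "?J \<subseteq> carrier R" "?J \<noteq> {}" using assms by auto
      fix u assume "u \<in> ?J"
      then obtain x y where "x \<in> carrier R" "y \<in> carrier R" "u = x \<otimes> a \<oplus> y \<otimes> b" by blast
      moreover from this have "\<ominus> u = (\<ominus> x) \<otimes> a \<oplus> (\<ominus> y) \<otimes> b" using assms by algebra
      ultimately show "\<ominus> u \<in> ?J" using a_inv_closed by blast
    next
      fix u v assume "u \<in> ?J" "v \<in> ?J"
      then obtain x y x' y' where c: "x \<in> carrier R" "y \<in> carrier R" "x' \<in> carrier R" "y' \<in> carrier R"
        "u = x \<otimes> a \<oplus> y \<otimes> b" "v = x' \<otimes> a \<oplus> y' \<otimes> b" by blast
      then have "u \<oplus> v = (x \<oplus> x') \<otimes> a \<oplus> (y \<oplus> y') \<otimes> b" using assms by algebra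
      with c show "u \<oplus> v \<in> ?J" using a_closed by blast
    qed
    fix u r assume "u \<in> ?J" and r: "r \<in> carrier R"
    then obtain x y where c: "x \<in> carrier R" "y \<in> carrier R" "u = x \<otimes> a \<oplus> y \<otimes> b" by blast
    then have "r \<otimes> u = (r \<otimes> x) \<otimes> a \<oplus> (r \<otimes> y) \<otimes> b" "u \<otimes> r = (r \<otimes> x) \<otimes> a \<oplus> (r \<otimes> y) \<otimes> b"
      using assms r by algebra+
    with c r show "r \<otimes> u \<in> ?J" "u \<otimes> r \<in> ?J" using m_closed by blast+
  qed
  moreover have "a = \<one> \<otimes> a \<oplus> \<zero> \<otimes> b" "b = \<zero> \<otimes> a \<oplus> \<one> \<otimes> b" using assms by simp_all
  then have "{a, b} \<subseteq> ?J" using zero_closed one_closed by blast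
  ultimately show "Idl {a, b} \<subseteq> ?J" by (rule genideal_minimal)
  interpret J: ideal "Idl {a, b}" R by (rule genideal_ideal) (use assms in auto)
  have "a \<in> Idl {a, b}" "b \<in> Idl {a, b}" using genideal_self[of "{a, b}"] assms by auto
  then show "?J \<subseteq> Idl {a, b}" using J.I_l_closed J.a_closed by blast
qed

abbreviation (input) pair :: "'a \<Rightarrow> 'a \<Rightarrow> nat \<Rightarrow> 'a" where
  "pair x y \<equiv> \<lambda>i\<in>{..<2}. if i = 0 then x else y"

text \<open>Let \<open>I = (a, b)\<close> and \<open>w = (a, b) \<in> I\<^sup>2\<close>. Since \<open>w\<close> generates a copy of \<open>R/ann I\<close> in \<open>I\<^sup>2\<close>, being
\<open>I\<^sup>2\<close>-flat makes \<open>I\<close> behave like a flat module over \<open>R/ann I\<close>. Concretely, let \<open>K\<close> consist of the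
\<open>\<alpha> w\<close> with \<open>\<alpha> a \<in> R b\<close>; this is just what makes \<open>u: x a + y b \<mapsto> x w + K\<close> a well defined map from
\<open>I\<close> to \<open>I\<^sup>2/K\<close>. The relation \<open>r a + s b = 0\<close> gives a map \<open>v\<close> from \<open>G = R\<^sup>2/(r, s)\<close> to \<open>I\<close>. A lift of
\<open>u v\<close> to \<open>I\<^sup>2\<close> sends the two generators of \<open>G\<close> to elements \<open>(1 + \<alpha>) w\<close> and \<open>\<beta> w\<close> with
\<open>\<alpha> w, \<beta> w \<in> K\<close>, and the relation of \<open>G\<close> becomes \<open>(r (1 + \<alpha>) + s \<beta>) w = 0\<close>.\<close>

lemma (in cring) fqf_ring_relation:
  assumes fqf: "fqf_ring R"
    and c: "a \<in> carrier R" "b \<in> carrier R" "r \<in> carrier R" "s \<in> carrier R"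
    and rel: "r \<otimes> a \<oplus> s \<otimes> b = \<zero>"
  shows "\<exists>\<alpha>\<in>carrier R. \<exists>\<beta>\<in>carrier R. \<exists>c\<in>carrier R. \<exists>d\<in>carrier R.
    \<alpha> \<otimes> a = c \<otimes> b \<and> \<beta> \<otimes> a = d \<otimes> b \<and>
    (r \<otimes> (\<one> \<oplus> \<alpha>) \<oplus> s \<otimes> \<beta>) \<otimes> a = \<zero> \<and> (r \<otimes> (\<one> \<oplus> \<alpha>) \<oplus> s \<otimes> \<beta>) \<otimes> b = \<zero>"
proof -
  define I where "I = Idl {a, b}"
  define V where "V = ideal_module R I"
  define F where "F = free_module R 2"
  define \<pi> where "\<pi> x = x 0 \<otimes> a \<oplus> x 1 \<otimes> b" for x :: "nat \<Rightarrow> 'a"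
  define M where "M = power_module V 2"
  define K where "K = {pair (\<alpha> \<otimes> a) (\<alpha> \<otimes> b) | \<alpha>. \<alpha> \<in> carrier R \<and> (\<exists>c\<in>carrier R. \<alpha> \<otimes> a = c \<otimes> b)}"
  define X where "X = (\<lambda>c. c \<odot>\<^bsub>F\<^esub> pair r s) ` carrier R"
  define G where "G = quot_module R F X"
  have I: "ideal I R" unfolding I_def by (rule genideal_ideal) (use c in auto)
  interpret I: ideal I R by (rule I)
  have Ieq: "I = {x \<otimes> a \<oplus> y \<otimes> b | x y. x \<in> carrier R \<and> y \<in> carrier R}"
    unfolding I_def by (rule genideal_pair) (use c in auto)
  have ab: "a \<in> I" "b \<in> I" unfolding I_def using genideal_self[of "{a, b}"] c by auto
  have mV: "module R V" unfolding V_def by (rule module_ideal_module[OF is_cring I])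
  have mF: "module R F" unfolding F_def by (rule module_free_module[OF is_cring])
  have mM: "module R M" unfolding M_def by (rule module_power_module[OF mV])
  interpret F: module R F by (rule mF)
  interpret M: module R M by (rule mM)
  have Vs: "carrier V = I" "\<zero>\<^bsub>V\<^esub> = \<zero>" "x \<oplus>\<^bsub>V\<^esub> y = x \<oplus> y" "t \<odot>\<^bsub>V\<^esub> x = t \<otimes> x" for x y t
    by (simp_all add: V_def ideal_module_def)
  have Fs: "carrier F = {..<2} \<rightarrow>\<^sub>E carrier R" "\<zero>\<^bsub>F\<^esub> = pair \<zero> \<zero>"
    "x \<oplus>\<^bsub>F\<^esub> y = pair (x 0 \<oplus> y 0) (x 1 \<oplus> y 1)" "t \<odot>\<^bsub>F\<^esub> x = pair (t \<otimes> x 0) (t \<otimes> x 1)" for x y t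
    by (auto simp: F_def free_module_def power_module_def ideal_module_def less_2_cases_iff )
  have Ms: "carrier M = {..<2} \<rightarrow>\<^sub>E I" "\<zero>\<^bsub>M\<^esub> = pair \<zero> \<zero>"
    "x \<oplus>\<^bsub>M\<^esub> y = pair (x 0 \<oplus> y 0) (x 1 \<oplus> y 1)" "t \<odot>\<^bsub>M\<^esub> x = pair (t \<otimes> x 0) (t \<otimes> x 1)" for x y t
    by (auto simp: M_def power_module_def Vs less_2_cases_iff )
  have pairF: "pair x y \<in> carrier F" if "x \<in> carrier R" "y \<in> carrier R" for x y
    using that by (auto simp: Fs(1))
  have pairM: "pair x y \<in> carrier M" if "x \<in> I" "y \<in> I" for x y
    using that by (auto simp: Ms(1))
  have F01: "x 0 \<in> carrier R" "x 1 \<in> carrier R" if "x \<in> carrier F" for x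
    using that unfolding Fs(1) by (simp_all add: PiE_iff)
  have pi: "\<pi> \<in> module_homs R F V"
  proof (rule module_homsI)
    fix x assume x: "x \<in> carrier F"
    show "\<pi> x \<in> carrier V" using F01[OF x] ab I.I_l_closed I.a_closed by (auto simp: \<pi>_def Vs)
    show "\<pi> (t \<odot>\<^bsub>F\<^esub> x) = t \<odot>\<^bsub>V\<^esub> \<pi> x" if "t \<in> carrier R" for t
      using F01[OF x] that c by (simp add: \<pi>_def Fs Vs) algebra
    fix y assume y: "y \<in> carrier F"
    show "\<pi> (x \<oplus>\<^bsub>F\<^esub> y) = \<pi> x \<oplus>\<^bsub>V\<^esub> \<pi> y"
      using F01[OF x] F01[OF y] c by (simp add: \<pi>_def Fs Vs) algebra
  qed
  have pis: "\<pi> ` carrier F = carrier V"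
  proof
    show "\<pi> ` carrier F \<subseteq> carrier V" using module_homsD(1)[OF pi] by blast
    show "carrier V \<subseteq> \<pi> ` carrier F"
    proof
      fix z assume "z \<in> carrier V"
      then obtain x y where xy: "x \<in> carrier R" "y \<in> carrier R" "z = x \<otimes> a \<oplus> y \<otimes> b"
        unfolding Vs Ieq by blast
      then have "z = \<pi> (pair x y)" by (simp add: \<pi>_def)
      then show "z \<in> \<pi> ` carrier F" using pairF[OF xy(1,2)] by (rule image_eqI)
    qed
  qed
  have Xs: "submodule X R F" and Xf: "fin_gen_submodule R F X"
    unfolding X_def using cyclic_submodule[OF mF pairF[OF c(3,4)]] by simp_all
  have fpG: "finitely_presented R G"
    unfolding G_def F_def
    by (rule finitely_presented_quot_free_module[OF is_cring]) (use Xs Xf in \<open>simp_all add: F_def\<close>)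
  have mG: "module R G" using fpG by (simp add: finitely_presented_def)
  note X_hom = rcoset_module_homs[OF mF Xs, folded G_def]
  obtain v where v: "v \<in> module_homs R G V" "\<And>x. x \<in> carrier F \<Longrightarrow> v (X +>\<^bsub>F\<^esub> x) = \<pi> x"
  proof (rule module_homs_factor[OF mF mG mV X_hom _ pi])
    show "(+>\<^bsub>F\<^esub>) X ` carrier F = carrier G"
      unfolding G_def carrier_quot_module[OF mF Xs] ..
    fix x assume x: "x \<in> carrier F" "X +>\<^bsub>F\<^esub> x = \<zero>\<^bsub>G\<^esub>"
    then have "x \<in> X" using rcoset_eq_self_iff[OF mF Xs] by (simp add: G_def zero_quot_module[OF mF Xs])
    then obtain t where t: "t \<in> carrier R" "x = t \<odot>\<^bsub>F\<^esub> pair r s" by (auto simp: X_def)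
    then have "\<pi> x = t \<otimes> (r \<otimes> a \<oplus> s \<otimes> b)"
      using c by (simp add: \<pi>_def Fs(4) r_distr m_assoc)
    then show "\<pi> x = \<zero>\<^bsub>V\<^esub>" using t by (simp add: rel Vs)
  qed (rule that)
  have KI: "pair (\<alpha> \<otimes> a) (\<alpha> \<otimes> b) \<in> K"
    if "\<alpha> \<in> carrier R" "d \<in> carrier R" "\<alpha> \<otimes> a = d \<otimes> b" for \<alpha> d
    unfolding K_def using that by blast
  have Ks: "submodule K R M"
  proof (rule M.submoduleI)
    show "K \<subseteq> carrier M" using pairM ab I.I_l_closed by (auto simp: K_def)
    have smK: "t \<odot>\<^bsub>M\<^esub> k \<in> K" if t: "t \<in> carrier R" and k: "k \<in> K" for t k
    proof -
      from k obtain \<alpha> d where k: "\<alpha> \<in> carrier R" "d \<in> carrier R" "\<alpha> \<otimes> a = d \<otimes> b"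
        "k = pair (\<alpha> \<otimes> a) (\<alpha> \<otimes> b)"
        unfolding K_def by blast
      then have "t \<odot>\<^bsub>M\<^esub> k = pair ((t \<otimes> \<alpha>) \<otimes> a) ((t \<otimes> \<alpha>) \<otimes> b)" "(t \<otimes> \<alpha>) \<otimes> a = (t \<otimes> d) \<otimes> b"
        using t c by (simp_all add: Ms m_assoc cong: if_cong)
      with KI[of "t \<otimes> \<alpha>" "t \<otimes> d"] t k show ?thesis by simp
    qed
    then show "t \<odot>\<^bsub>M\<^esub> k \<in> K" if "t \<in> carrier R" "k \<in> K" for t k using that .
    show "\<zero>\<^bsub>M\<^esub> \<in> K" using KI[of \<zero> \<zero>] c by (simp add: Ms(2) cong: if_cong)
    show "\<ominus>\<^bsub>M\<^esub> k \<in> K" if "k \<in> K" for k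
    proof -
      have "k \<in> carrier M" using \<open>K \<subseteq> carrier M\<close> that by blast
      then have "\<ominus>\<^bsub>M\<^esub> k = (\<ominus> \<one>) \<odot>\<^bsub>M\<^esub> k" by (simp add: M.smult_l_minus)
      with smK that show ?thesis by simp
    qed
    fix k l assume "k \<in> K" "l \<in> K"
    then obtain \<alpha> d \<beta> e where k: "\<alpha> \<in> carrier R" "d \<in> carrier R" "\<alpha> \<otimes> a = d \<otimes> b"
        "\<beta> \<in> carrier R" "e \<in> carrier R" "\<beta> \<otimes> a = e \<otimes> b"
        "k = pair (\<alpha> \<otimes> a) (\<alpha> \<otimes> b)" "l = pair (\<beta> \<otimes> a) (\<beta> \<otimes> b)"
      unfolding K_def by blast
    then have "k \<oplus>\<^bsub>M\<^esub> l = pair ((\<alpha> \<oplus> \<beta>) \<otimes> a) ((\<alpha> \<oplus> \<beta>) \<otimes> b)" "(\<alpha> \<oplus> \<beta>) \<otimes> a = (d \<oplus> e) \<otimes> b"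
      using c by (simp_all add: Ms l_distr cong: if_cong)
    with KI[of "\<alpha> \<oplus> \<beta>" "d \<oplus> e"] k show "k \<oplus>\<^bsub>M\<^esub> l \<in> K" by simp
  qed
  define M' where "M' = quot_module R M K"
  have mM': "module R M'" unfolding M'_def by (rule module_quot_module[OF mM Ks])
  note K_hom = rcoset_module_homs[OF mM Ks, folded M'_def]
  define w where "w = pair a b"
  have wM: "w \<in> carrier M" unfolding w_def using pairM ab by simp
  have sw: "t \<odot>\<^bsub>M\<^esub> w = pair (t \<otimes> a) (t \<otimes> b)" for t by (simp add: w_def Ms cong: if_cong)
  have fst_hom: "(\<lambda>x. x 0 \<odot>\<^bsub>M\<^esub> w) \<in> module_homs R F M"
  proof (rule module_homsI)
    fix x assume x: "x \<in> carrier F"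
    show "x 0 \<odot>\<^bsub>M\<^esub> w \<in> carrier M" using F01[OF x] wM by simp
    show "(t \<odot>\<^bsub>F\<^esub> x) 0 \<odot>\<^bsub>M\<^esub> w = t \<odot>\<^bsub>M\<^esub> (x 0 \<odot>\<^bsub>M\<^esub> w)" if "t \<in> carrier R" for t
      using F01[OF x] that wM by (simp add: Fs M.smult_assoc1)
    show "(x \<oplus>\<^bsub>F\<^esub> y) 0 \<odot>\<^bsub>M\<^esub> w = x 0 \<odot>\<^bsub>M\<^esub> w \<oplus>\<^bsub>M\<^esub> y 0 \<odot>\<^bsub>M\<^esub> w" if y: "y \<in> carrier F" for y
      using F01[OF x] F01[OF y] wM by (simp add: Fs(3) M.smult_l_distr)
  qed
  obtain u where u: "u \<in> module_homs R V M'"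
    "\<And>x. x \<in> carrier F \<Longrightarrow> u (\<pi> x) = K +>\<^bsub>M\<^esub> (x 0 \<odot>\<^bsub>M\<^esub> w)"
  proof (rule module_homs_factor[OF mF mV mM' pi pis module_homs_comp[OF fst_hom K_hom]])
    fix x assume x: "x \<in> carrier F" "\<pi> x = \<zero>\<^bsub>V\<^esub>"
    have cx: "x 0 \<in> carrier R" "x 1 \<in> carrier R" using F01[OF x(1)] by auto
    have "x 0 \<otimes> a \<oplus> x 1 \<otimes> b = \<zero>" using x(2) by (simp add: \<pi>_def Vs)
    then have "x 0 \<otimes> a = (\<ominus> x 1) \<otimes> b"
      using cx c by (metis l_minus m_closed minus_equality)
    then have "x 0 \<odot>\<^bsub>M\<^esub> w \<in> K"
      unfolding sw using KI[of "x 0" "\<ominus> x 1"] cx by simp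
    then show "K +>\<^bsub>M\<^esub> (x 0 \<odot>\<^bsub>M\<^esub> w) = \<zero>\<^bsub>M'\<^esub>"
      using rcoset_eq_self_iff[OF mM Ks] wM cx by (simp add: M'_def zero_quot_module[OF mM Ks])
  qed (rule that)
  have "fin_gen_ideal I R" unfolding fin_gen_ideal_def I_def using c by (intro exI[of _ "{a, b}"]) auto
  with fqf have "quasi_flat R V" by (simp add: fqf_ring_def V_def)
  then have flat: "relatively_flat R M V" unfolding quasi_flat_def M_def by simp
  have "(\<lambda>x. K +>\<^bsub>M\<^esub> x) ` carrier M = carrier M'"
    unfolding M'_def carrier_quot_module[OF mM Ks] ..
  from flat[unfolded relatively_flat_def, rule_format, OF mM' K_hom this u(1) fpG v(1)] obtain q where q: "q \<in> module_homs R G M"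
    and qe: "\<And>x. x \<in> carrier G \<Longrightarrow> K +>\<^bsub>M\<^esub> q x = u (v x)"
    by blast
  \<comment> \<open>The lift, pulled back to \<open>R\<^sup>2\<close>, agrees with \<open>x \<mapsto> x\<^sub>0 w\<close> modulo \<open>K\<close>.\<close>
  define h where "h x = q (X +>\<^bsub>F\<^esub> x)" for x
  have h: "h \<in> module_homs R F M" unfolding h_def by (rule module_homs_comp[OF X_hom q])
  have he: "h x \<ominus>\<^bsub>M\<^esub> x 0 \<odot>\<^bsub>M\<^esub> w \<in> K" if x: "x \<in> carrier F" for x
  proof -
    have "K +>\<^bsub>M\<^esub> h x = K +>\<^bsub>M\<^esub> (x 0 \<odot>\<^bsub>M\<^esub> w)"
      unfolding h_def using qe[of "X +>\<^bsub>F\<^esub> x"] module_homsD(1)[OF X_hom x] v(2)[OF x] u(2)[OF x] by simp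
    then show ?thesis
      using rcoset_eq_iff[OF mM Ks] module_homsD(1)[OF h x] F01[OF x] wM by simp
  qed
  have hK: "\<exists>\<alpha>\<in>carrier R. \<exists>c\<in>carrier R. \<alpha> \<otimes> a = c \<otimes> b \<and> h x = (x 0 \<oplus> \<alpha>) \<odot>\<^bsub>M\<^esub> w"
    if x: "x \<in> carrier F" for x
  proof -
    from he[OF x] obtain \<alpha> d where \<alpha>: "\<alpha> \<in> carrier R" "d \<in> carrier R" "\<alpha> \<otimes> a = d \<otimes> b"
      "h x \<ominus>\<^bsub>M\<^esub> x 0 \<odot>\<^bsub>M\<^esub> w = \<alpha> \<odot>\<^bsub>M\<^esub> w"
      unfolding K_def sw by blast
    have "h x = (h x \<ominus>\<^bsub>M\<^esub> x 0 \<odot>\<^bsub>M\<^esub> w) \<oplus>\<^bsub>M\<^esub> x 0 \<odot>\<^bsub>M\<^esub> w"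
      using module_homsD(1)[OF h x] F01[OF x] wM by (simp add: M.M.minus_eq M.M.a_assoc M.M.l_neg)
    also have "\<dots> = (x 0 \<oplus> \<alpha>) \<odot>\<^bsub>M\<^esub> w"
      unfolding \<alpha>(4) using F01[OF x] wM \<alpha>(1) by (simp add: M.smult_l_distr M.M.a_comm)
    finally show ?thesis using \<alpha> by blast
  qed
  have e1: "pair \<one> \<zero> \<in> carrier F" and e2: "pair \<zero> \<one> \<in> carrier F" by (auto intro!: pairF)
  from hK[OF e1] obtain \<alpha> d where \<alpha>: "\<alpha> \<in> carrier R" "d \<in> carrier R" "\<alpha> \<otimes> a = d \<otimes> b"
    "h (pair \<one> \<zero>) = (\<one> \<oplus> \<alpha>) \<odot>\<^bsub>M\<^esub> w" by auto
  from hK[OF e2] obtain \<beta> e where \<beta>: "\<beta> \<in> carrier R" "e \<in> carrier R" "\<beta> \<otimes> a = e \<otimes> b"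
    "h (pair \<zero> \<one>) = \<beta> \<odot>\<^bsub>M\<^esub> w" by auto
  have rs: "pair r s = r \<odot>\<^bsub>F\<^esub> pair \<one> \<zero> \<oplus>\<^bsub>F\<^esub> s \<odot>\<^bsub>F\<^esub> pair \<zero> \<one>"
    using c by (simp add: Fs cong: if_cong)
  have "h (pair r s) = r \<odot>\<^bsub>M\<^esub> ((\<one> \<oplus> \<alpha>) \<odot>\<^bsub>M\<^esub> w) \<oplus>\<^bsub>M\<^esub> s \<odot>\<^bsub>M\<^esub> (\<beta> \<odot>\<^bsub>M\<^esub> w)"
    unfolding rs using c e1 e2 \<alpha>(4) \<beta>(4) module_homsD(2,3)[OF h] by simp
  also have "\<dots> = (r \<otimes> (\<one> \<oplus> \<alpha>) \<oplus> s \<otimes> \<beta>) \<odot>\<^bsub>M\<^esub> w"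
    using c \<alpha>(1) \<beta>(1) wM by (simp add: M.smult_l_distr M.smult_assoc1)
  finally have h1: "h (pair r s) = (r \<otimes> (\<one> \<oplus> \<alpha>) \<oplus> s \<otimes> \<beta>) \<odot>\<^bsub>M\<^esub> w" .
  have prs: "pair r s \<in> carrier F" using pairF c by simp
  have "pair r s = \<one> \<odot>\<^bsub>F\<^esub> pair r s" using prs by simp
  then have "pair r s \<in> X" unfolding X_def using one_closed by blast
  then have "X +>\<^bsub>F\<^esub> pair r s = \<zero>\<^bsub>G\<^esub>"
    using rcoset_eq_self_iff[OF mF Xs] prs by (simp add: G_def zero_quot_module[OF mF Xs])
  then have "h (pair r s) = \<zero>\<^bsub>M\<^esub>" unfolding h_def using module_homs_zero[OF mG mM q] by simp
  with h1 have z: "pair ((r \<otimes> (\<one> \<oplus> \<alpha>) \<oplus> s \<otimes> \<beta>) \<otimes> a) ((r \<otimes> (\<one> \<oplus> \<alpha>) \<oplus> s \<otimes> \<beta>) \<otimes> b) = pair \<zero> \<zero>"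
    by (simp only: sw Ms(2))
  have "(r \<otimes> (\<one> \<oplus> \<alpha>) \<oplus> s \<otimes> \<beta>) \<otimes> a = \<zero>" "(r \<otimes> (\<one> \<oplus> \<alpha>) \<oplus> s \<otimes> \<beta>) \<otimes> b = \<zero>"
    using fun_cong[OF z, of 0] fun_cong[OF z, of 1] by simp_all
  with \<alpha> \<beta> show ?thesis by blast
qed

section \<open>Divisibility in the localization at a prime ideal\<close>

text \<open>This is \<open>b \<in> a R\<^sub>P\<close> with the denominators cleared. In particular \<open>local_dvd P \<zero> x\<close> says that \<open>x\<close>
vanishes in \<open>R\<^sub>P\<close>.\<close>

definition (in cring) local_dvd :: "'a set \<Rightarrow> 'a \<Rightarrow> 'a \<Rightarrow> bool" where
  "local_dvd P a b \<longleftrightarrow> (\<exists>t\<in>carrier R - P. \<exists>c\<in>carrier R. t \<otimes> b = c \<otimes> a)"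

abbreviation (in cring) incomparable_at :: "'a set \<Rightarrow> 'a \<Rightarrow> 'a \<Rightarrow> bool" where
  "incomparable_at P a b \<equiv> \<not> local_dvd P a b \<and> \<not> local_dvd P b a"

context cring
begin

context
  fixes P assumes P: "primeideal P R"
begin

interpretation P: primeideal P R by (rule P)

lemma one_notin_prime: "\<one> \<in> carrier R - P"
  using P.I_notcarr P.one_imp_carrier by auto

lemma mult_notin_prime: "s \<in> carrier R - P \<Longrightarrow> t \<in> carrier R - P \<Longrightarrow> s \<otimes> t \<in> carrier R - P"
  using P.I_prime by auto

lemma local_dvd_refl: "a \<in> carrier R \<Longrightarrow> local_dvd P a a"
  unfolding local_dvd_def using one_notin_prime by auto

lemma local_dvd_multiple: "a \<in> carrier R \<Longrightarrow> c \<in> carrier R \<Longrightarrow> local_dvd P a (c \<otimes> a)"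
  unfolding local_dvd_def using one_notin_prime by (intro bexI[of _ "\<one>"] bexI[of _ c]) auto

lemma local_dvd_trans:
  assumes c: "a \<in> carrier R" "b \<in> carrier R" "c \<in> carrier R"
    and ab: "local_dvd P a b" and bc: "local_dvd P b c"
  shows "local_dvd P a c"
proof -
  from ab obtain t x where 1: "t \<in> carrier R - P" "x \<in> carrier R" "t \<otimes> b = x \<otimes> a"
    by (auto simp: local_dvd_def)
  from bc obtain u y where 2: "u \<in> carrier R - P" "y \<in> carrier R" "u \<otimes> c = y \<otimes> b"
    by (auto simp: local_dvd_def)
  have k: "t \<in> carrier R" "u \<in> carrier R" using 1 2 by auto
  have "(t \<otimes> u) \<otimes> c = t \<otimes> (u \<otimes> c)" using c k by (simp add: m_assoc)
  also have "\<dots> = y \<otimes> (t \<otimes> b)" using c k 2 by (simp add: m_lcomm)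
  also have "\<dots> = (y \<otimes> x) \<otimes> a" using c k 1 2 by (simp add: m_assoc)
  finally show ?thesis
    unfolding local_dvd_def using mult_notin_prime[OF 1(1) 2(1)] 1(2) 2(2) by blast
qed

lemma local_dvd_mult:
  assumes c: "a \<in> carrier R" "b \<in> carrier R" "r \<in> carrier R" and ab: "local_dvd P a b"
  shows "local_dvd P (r \<otimes> a) (r \<otimes> b)"
proof -
  from ab obtain t x where 1: "t \<in> carrier R - P" "x \<in> carrier R" "t \<otimes> b = x \<otimes> a"
    by (auto simp: local_dvd_def)
  have "t \<otimes> (r \<otimes> b) = r \<otimes> (t \<otimes> b)" using 1(1) c by (simp add: m_lcomm)
  also have "\<dots> = x \<otimes> (r \<otimes> a)" unfolding 1(3) using 1(2) c by (simp add: m_lcomm)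
  finally show ?thesis unfolding local_dvd_def using 1 by blast
qed

lemma local_dvd_zero: "a \<in> carrier R \<Longrightarrow> local_dvd P a \<zero>"
  using local_dvd_multiple[of a \<zero>] by simp

lemma zero_local_dvd_iff: "x \<in> carrier R \<Longrightarrow> local_dvd P \<zero> x \<longleftrightarrow> (\<exists>t\<in>carrier R - P. t \<otimes> x = \<zero>)"
  by (auto simp: local_dvd_def)

lemma zero_local_dvd_cancel:
  assumes "x \<in> carrier R" "t \<in> carrier R - P" "local_dvd P \<zero> (t \<otimes> x)"
  shows "local_dvd P \<zero> x"
proof -
  from assms obtain u where "u \<in> carrier R - P" "u \<otimes> (t \<otimes> x) = \<zero>"
    using zero_local_dvd_iff[of "t \<otimes> x"] by auto
  with assms have "(u \<otimes> t) \<otimes> x = \<zero>" "u \<otimes> t \<in> carrier R - P"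
    using mult_notin_prime by (auto simp: m_assoc)
  with assms show ?thesis using zero_local_dvd_iff by blast
qed

lemma zero_local_dvd_multiple:
  assumes "x \<in> carrier R" "c \<in> carrier R" "local_dvd P \<zero> x"
  shows "local_dvd P \<zero> (c \<otimes> x)"
  using local_dvd_mult[of \<zero> x c] assms by simp

lemma local_dvd_factor:
  assumes c: "a \<in> carrier R" "b \<in> carrier R" and "local_dvd P a b"
  obtains c where "c \<in> carrier R" "local_dvd P (c \<otimes> a) b" "local_dvd P b (c \<otimes> a)"
proof -
  from assms obtain t c where 1: "t \<in> carrier R - P" "c \<in> carrier R" "t \<otimes> b = c \<otimes> a"
    by (auto simp: local_dvd_def)
  have "t \<otimes> b = \<one> \<otimes> (c \<otimes> a)" using 1(2,3) c by simp
  then have "local_dvd P (c \<otimes> a) b" unfolding local_dvd_def using 1(1) by blast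
  moreover have "local_dvd P b (c \<otimes> a)"
    unfolding 1(3)[symmetric] using 1(1) c by (intro local_dvd_multiple) auto
  ultimately show ?thesis using that 1(2) by blast
qed

context
  assumes fqf: "fqf_ring R"
begin

text \<open>Incomparable elements are a minimal system of generators of \<open>(a, b) R\<^sub>P\<close>, and this ideal is free over
\<open>R\<^sub>P\<close> modulo its annihilator: every relation has coefficients in the annihilator. Indeed
\<open>fqf_ring_relation\<close>, applied to \<open>(a, b)\<close> and to \<open>(b, a)\<close>, says that a matrix with
diagonal \<open>1 + \<alpha>, 1 + \<alpha>'\<close> and off-diagonal entries \<open>\<beta>, \<beta>'\<close> maps \<open>(r, s)\<close> into the annihilator.
Incomparability puts \<open>\<alpha>, \<alpha>', \<beta>, \<beta>'\<close> into \<open>P\<close>, so its determinant \<open>D\<close> is invertible in \<open>R\<^sub>P\<close>.\<close>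

lemma incomparable_relation:
  assumes c: "a \<in> carrier R" "b \<in> carrier R" "r \<in> carrier R" "s \<in> carrier R"
    and inc: "incomparable_at P a b" and rel: "r \<otimes> a \<oplus> s \<otimes> b = \<zero>"
  shows "local_dvd P \<zero> (r \<otimes> a)" "local_dvd P \<zero> (r \<otimes> b)"
    "local_dvd P \<zero> (s \<otimes> a)" "local_dvd P \<zero> (s \<otimes> b)"
proof -
  have inP: "\<alpha> \<in> P" if "\<alpha> \<in> carrier R" "c \<in> carrier R" "\<alpha> \<otimes> x = c \<otimes> y" "\<not> local_dvd P y x"
    for \<alpha> c x y
    using that by (auto simp: local_dvd_def)
  from fqf_ring_relation[OF fqf c rel] obtain \<alpha> \<beta> d e where
    1: "\<alpha> \<in> carrier R" "\<beta> \<in> carrier R" "d \<in> carrier R" "e \<in> carrier R"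
      "\<alpha> \<otimes> a = d \<otimes> b" "\<beta> \<otimes> a = e \<otimes> b"
      "(r \<otimes> (\<one> \<oplus> \<alpha>) \<oplus> s \<otimes> \<beta>) \<otimes> a = \<zero>" "(r \<otimes> (\<one> \<oplus> \<alpha>) \<oplus> s \<otimes> \<beta>) \<otimes> b = \<zero>" by blast
  have rel': "s \<otimes> b \<oplus> r \<otimes> a = \<zero>" using rel c by (simp add: a_comm)
  from fqf_ring_relation[OF fqf c(2,1,4,3) rel'] obtain \<alpha>' \<beta>' d' e' where
    2: "\<alpha>' \<in> carrier R" "\<beta>' \<in> carrier R" "d' \<in> carrier R" "e' \<in> carrier R"
      "\<alpha>' \<otimes> b = d' \<otimes> a" "\<beta>' \<otimes> b = e' \<otimes> a"
      "(s \<otimes> (\<one> \<oplus> \<alpha>') \<oplus> r \<otimes> \<beta>') \<otimes> b = \<zero>" "(s \<otimes> (\<one> \<oplus> \<alpha>') \<oplus> r \<otimes> \<beta>') \<otimes> a = \<zero>" by blast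
  have p: "\<alpha> \<in> P" "\<beta> \<in> P" "\<alpha>' \<in> P" "\<beta>' \<in> P"
    using inP[of \<alpha> d a b] inP[of \<beta> e a b] inP[of \<alpha>' d' b a] inP[of \<beta>' e' b a] 1 2 inc by auto
  define D where "D = (\<one> \<oplus> \<alpha>) \<otimes> (\<one> \<oplus> \<alpha>') \<ominus> \<beta> \<otimes> \<beta>'"
  have D: "D \<in> carrier R - P"
  proof -
    have "\<one> = D \<oplus> (\<ominus> (\<alpha> \<oplus> (\<one> \<oplus> \<alpha>) \<otimes> \<alpha>') \<oplus> \<beta> \<otimes> \<beta>')"
      unfolding D_def using 1(1,2) 2(1,2) by algebra
    moreover have "\<ominus> (\<alpha> \<oplus> (\<one> \<oplus> \<alpha>) \<otimes> \<alpha>') \<oplus> \<beta> \<otimes> \<beta>' \<in> P"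
      using p 1(1,2) 2(1,2) by (intro P.a_closed P.a_inv_closed P.I_l_closed) auto
    ultimately have "\<one> \<in> P" if "D \<in> P" using that P.a_closed by metis
    then show ?thesis using one_notin_prime 1(1,2) 2(1,2) by (auto simp: D_def)
  qed
  have ab: "D \<otimes> (r \<otimes> z) = \<zero> \<and> D \<otimes> (s \<otimes> z) = \<zero>"
    if z: "z \<in> carrier R" "(r \<otimes> (\<one> \<oplus> \<alpha>) \<oplus> s \<otimes> \<beta>) \<otimes> z = \<zero>"
      "(s \<otimes> (\<one> \<oplus> \<alpha>') \<oplus> r \<otimes> \<beta>') \<otimes> z = \<zero>" for z
  proof -
    have "D \<otimes> (r \<otimes> z) = (\<one> \<oplus> \<alpha>') \<otimes> ((r \<otimes> (\<one> \<oplus> \<alpha>) \<oplus> s \<otimes> \<beta>) \<otimes> z) \<ominus>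
        \<beta> \<otimes> ((s \<otimes> (\<one> \<oplus> \<alpha>') \<oplus> r \<otimes> \<beta>') \<otimes> z)"
      unfolding D_def using c(3,4) z(1) 1(1,2) 2(1,2) by algebra
    moreover have "D \<otimes> (s \<otimes> z) = (\<one> \<oplus> \<alpha>) \<otimes> ((s \<otimes> (\<one> \<oplus> \<alpha>') \<oplus> r \<otimes> \<beta>') \<otimes> z) \<ominus>
        \<beta>' \<otimes> ((r \<otimes> (\<one> \<oplus> \<alpha>) \<oplus> s \<otimes> \<beta>) \<otimes> z)"
      unfolding D_def using c(3,4) z(1) 1(1,2) 2(1,2) by algebra
    ultimately show ?thesis unfolding z(2,3) using 1(1,2) 2(1,2) by (simp add: minus_eq)
  qed
  from ab[of a] ab[of b] 1(7,8) 2(7,8) c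
  show "local_dvd P \<zero> (r \<otimes> a)" "local_dvd P \<zero> (r \<otimes> b)"
    "local_dvd P \<zero> (s \<otimes> a)" "local_dvd P \<zero> (s \<otimes> b)"
    using D by (auto simp: zero_local_dvd_iff)
qed

lemma incomparable_common_multiple:
  assumes c: "a \<in> carrier R" "b \<in> carrier R" "x \<in> carrier R"
    and inc: "incomparable_at P a b" and ax: "local_dvd P a x" and bx: "local_dvd P b x"
  shows "local_dvd P \<zero> x"
proof -
  from ax obtain t d where 1: "t \<in> carrier R - P" "d \<in> carrier R" "t \<otimes> x = d \<otimes> a"
    by (auto simp: local_dvd_def)
  from bx obtain u e where 2: "u \<in> carrier R - P" "e \<in> carrier R" "u \<otimes> x = e \<otimes> b"
    by (auto simp: local_dvd_def)
  have k: "t \<in> carrier R" "u \<in> carrier R" using 1 2 by auto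
  have "(u \<otimes> d) \<otimes> a \<oplus> (\<ominus> (t \<otimes> e)) \<otimes> b = u \<otimes> (d \<otimes> a) \<ominus> t \<otimes> (e \<otimes> b)"
    using c k 1(2) 2(2) by algebra
  also have "\<dots> = u \<otimes> (t \<otimes> x) \<ominus> t \<otimes> (u \<otimes> x)" unfolding 1(3) 2(3) ..
  also have "\<dots> = \<zero>" using c k by algebra
  finally have "local_dvd P \<zero> ((u \<otimes> d) \<otimes> a)"
    using incomparable_relation(1)[of a b "u \<otimes> d" "\<ominus> (t \<otimes> e)"] c k 1(2) 2(2) inc by simp
  also have "(u \<otimes> d) \<otimes> a = (u \<otimes> t) \<otimes> x" using c k 1(2) by (simp add: m_assoc 1(3)[symmetric])
  finally show ?thesis using zero_local_dvd_cancel mult_notin_prime[OF 2(1) 1(1)] c by blast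
qed

lemma incomparable_annihilator:
  assumes c: "a \<in> carrier R" "b \<in> carrier R" "r \<in> carrier R"
    and inc: "incomparable_at P a b" and ra: "local_dvd P \<zero> (r \<otimes> a)"
  shows "local_dvd P \<zero> (r \<otimes> b)"
proof -
  from ra c obtain t where t: "t \<in> carrier R - P" "t \<otimes> (r \<otimes> a) = \<zero>"
    using zero_local_dvd_iff by auto
  then have "local_dvd P \<zero> ((t \<otimes> r) \<otimes> b)"
    using incomparable_relation(2)[of a b "t \<otimes> r" \<zero>] c inc by (simp add: m_assoc)
  then show ?thesis using zero_local_dvd_cancel[of "r \<otimes> b" t] t c by (simp add: m_assoc)
qed

lemma incomparable_products:
  assumes c: "a \<in> carrier R" "b \<in> carrier R" and inc: "incomparable_at P a b"
  shows "local_dvd P \<zero> (a \<otimes> b)" "local_dvd P \<zero> (a \<otimes> a)"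
proof -
  \<comment> \<open>The Koszul relation has the generators themselves as coefficients.\<close>
  have "b \<otimes> a \<oplus> (\<ominus> a) \<otimes> b = \<zero>" using c by algebra
  from incomparable_relation[OF c c(2) a_inv_closed[OF c(1)] inc this] c
  have 1: "local_dvd P \<zero> (b \<otimes> a)" and 2: "local_dvd P \<zero> ((\<ominus> a) \<otimes> a)" by auto
  from 1 show "local_dvd P \<zero> (a \<otimes> b)" using c by (simp add: m_comm)
  have "a \<otimes> a = (\<ominus> \<one>) \<otimes> ((\<ominus> a) \<otimes> a)" using c by algebra
  with zero_local_dvd_multiple[OF _ _ 2, of "\<ominus> \<one>"] c show "local_dvd P \<zero> (a \<otimes> a)" by simp
qed

context
  fixes N assumes N: "primeideal N R" and NP: "N \<subseteq> P"
    and nilp: "\<And>x. x \<in> N \<Longrightarrow> \<exists>n::nat. x [^] n = \<zero>"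
begin

interpretation N: primeideal N R by (rule N)

lemma local_dvd_in_prime:
  assumes "local_dvd P x y" "x \<in> N" "y \<in> carrier R"
  shows "y \<in> N"
proof -
  from assms obtain t c where t: "t \<in> carrier R - P" "c \<in> carrier R" "t \<otimes> y = c \<otimes> x"
    by (auto simp: local_dvd_def)
  then have "t \<otimes> y \<in> N" using assms N.I_l_closed by simp
  with t assms show ?thesis using N.I_prime[of t y] NP by auto
qed

lemma incomparable_in_prime:
  assumes "a \<in> carrier R" "b \<in> carrier R" "incomparable_at P a b"
  shows "a \<in> N"
proof -
  have "a \<otimes> a \<in> N"
    using local_dvd_in_prime[OF incomparable_products(2)[OF assms]] assms by simp
  then show ?thesis using N.I_prime assms by blast
qed

text \<open>In \<open>R\<^sub>P\<close> write \<open>a = d x\<^sup>n\<^sup>+\<^sup>1\<close> and \<open>b = e x\<^sup>n\<^sup>+\<^sup>1\<close>. Then \<open>d\<close> and \<open>e\<close> are incomparable, so \<open>d\<^sup>2 = 0\<close>. If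
\<open>x\<close> did not divide \<open>d\<close>, then \<open>x d = 0\<close>, either by incomparability of \<open>x\<close> and \<open>d\<close> or because \<open>x\<close> is a
multiple of \<open>d\<close>; but \<open>x d = 0\<close> forces \<open>a = 0\<close>.\<close>

lemma local_dvd_power_step:
  assumes c: "a \<in> carrier R" "b \<in> carrier R" "x \<in> carrier R"
    and inc: "incomparable_at P a b"
    and ax: "local_dvd P (x [^] Suc n) a" and bx: "local_dvd P (x [^] Suc n) b"
  shows "local_dvd P (x [^] Suc (Suc n)) a"
proof -
  let ?y = "x [^] Suc n"
  have y: "?y \<in> carrier R" using c by simp
  obtain d where d: "d \<in> carrier R" "local_dvd P (d \<otimes> ?y) a" "local_dvd P a (d \<otimes> ?y)"
    by (rule local_dvd_factor[OF y c(1) ax])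
  obtain e where e: "e \<in> carrier R" "local_dvd P (e \<otimes> ?y) b" "local_dvd P b (e \<otimes> ?y)"
    by (rule local_dvd_factor[OF y c(2) bx])
  have inc': "incomparable_at P d e"
  proof -
    have "local_dvd P a b" if "local_dvd P d e"
      using local_dvd_mult[OF d(1) e(1) y that] d e c y
      by (metis local_dvd_trans m_closed m_comm)
    moreover have "local_dvd P b a" if "local_dvd P e d"
      using local_dvd_mult[OF e(1) d(1) y that] d e c y
      by (metis local_dvd_trans m_closed m_comm)
    ultimately show ?thesis using inc by blast
  qed
  have nz: "\<not> local_dvd P \<zero> (x \<otimes> d)"
  proof
    assume "local_dvd P \<zero> (x \<otimes> d)"
    then have "local_dvd P \<zero> ((x [^] n) \<otimes> (x \<otimes> d))"
      using zero_local_dvd_multiple c d by simp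
    also have "(x [^] n) \<otimes> (x \<otimes> d) = d \<otimes> ?y" using c d by (simp add: m_ac)
    finally have "local_dvd P \<zero> a" using d c y local_dvd_trans[of \<zero> "d \<otimes> ?y" a] by simp
    then have "local_dvd P b a"
      using local_dvd_trans[of b \<zero> a] local_dvd_zero c by simp
    with inc show False by simp
  qed
  have "local_dvd P x d"
  proof (rule ccontr)
    assume nd: "\<not> local_dvd P x d"
    have "local_dvd P d x"
      using nd nz incomparable_products(1)[OF c(3) d(1)] by blast
    then have "local_dvd P (d \<otimes> d) (x \<otimes> d)"
      using local_dvd_mult[of d x d] c d by (simp add: m_comm)
    then show False
      using nz incomparable_products(2)[OF d(1) e(1) inc'] local_dvd_trans[of \<zero> "d \<otimes> d" "x \<otimes> d"] c d
      by simp
  qed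
  then have "local_dvd P (?y \<otimes> x) (?y \<otimes> d)" using local_dvd_mult c d y by blast
  then show ?thesis
    using d c y local_dvd_trans[of "?y \<otimes> x" "d \<otimes> ?y" a] by (simp add: m_comm)
qed

context
  fixes a b assumes c: "a \<in> carrier R" "b \<in> carrier R" and inc: "incomparable_at P a b"
begin

text \<open>Since \<open>s \<notin> N\<close>, it divides both \<open>a\<close> and \<open>b\<close> in \<open>R\<^sub>P\<close>, say \<open>a = d s\<close> and \<open>b = e s\<close>. If \<open>d\<close> did not
divide \<open>x\<close>, then \<open>s x = 0\<close> would imply \<open>s d = 0\<close>: incomparable elements have the same annihilator,
and a multiple \<open>d\<close> of \<open>x\<close> is killed by \<open>s\<close> as well. So \<open>d\<close> divides \<open>x\<close>, and so does \<open>e\<close>; hence \<open>x\<close>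
lies in \<open>d R\<^sub>P \<inter> e R\<^sub>P = 0\<close>.\<close>

lemma regular_outside_prime:
  assumes s: "s \<in> carrier R" "s \<notin> N" and x: "x \<in> carrier R" "local_dvd P \<zero> (s \<otimes> x)"
  shows "local_dvd P \<zero> x"
proof -
  have aN: "a \<in> N" and bN: "b \<in> N" using incomparable_in_prime inc c by blast+
  have sd: "local_dvd P s z" if "z \<in> N" for z
    using incomparable_in_prime[of s z] local_dvd_in_prime[of z s] that s N.Icarr by blast
  obtain d where d: "d \<in> carrier R" "local_dvd P (d \<otimes> s) a" "local_dvd P a (d \<otimes> s)"
    by (rule local_dvd_factor[OF s(1) c(1) sd[OF aN]])
  obtain e where e: "e \<in> carrier R" "local_dvd P (e \<otimes> s) b" "local_dvd P b (e \<otimes> s)"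
    by (rule local_dvd_factor[OF s(1) c(2) sd[OF bN]])
  have inc': "incomparable_at P d e"
  proof -
    have "local_dvd P a b" if "local_dvd P d e"
      using local_dvd_mult[OF d(1) e(1) s(1) that] d e c s
      by (metis local_dvd_trans m_closed m_comm)
    moreover have "local_dvd P b a" if "local_dvd P e d"
      using local_dvd_mult[OF e(1) d(1) s(1) that] d e c s
      by (metis local_dvd_trans m_closed m_comm)
    ultimately show ?thesis using inc by blast
  qed
  have dvd: "local_dvd P f x"
    if f: "f \<in> carrier R" and nz: "\<not> local_dvd P \<zero> (s \<otimes> f)" for f
  proof (rule ccontr)
    assume nf: "\<not> local_dvd P f x"
    have "\<not> local_dvd P x f"
      using nz x s f local_dvd_mult[of x f s] local_dvd_trans[of \<zero> "s \<otimes> x" "s \<otimes> f"] by auto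
    with nf show False using incomparable_annihilator[of x f s] x s f nz by blast
  qed
  have "\<not> local_dvd P \<zero> (s \<otimes> d)"
    using d c s inc local_dvd_zero[of b] local_dvd_trans[of \<zero> "d \<otimes> s" a] local_dvd_trans[of b \<zero> a]
    by (auto simp: m_comm)
  moreover have "\<not> local_dvd P \<zero> (s \<otimes> e)"
    using e c s inc local_dvd_zero[of a] local_dvd_trans[of \<zero> "e \<otimes> s" b] local_dvd_trans[of a \<zero> b]
    by (auto simp: m_comm)
  ultimately show ?thesis
    using incomparable_common_multiple[OF d(1) e(1) x(1) inc'] dvd d e by blast
qed

text \<open>If \<open>x\<^sup>2 \<noteq> 0\<close> in \<open>R\<^sub>P\<close>, then \<open>x\<close> is comparable with \<open>a\<close> and with \<open>b\<close>. As these two are incomparable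
and have no common multiple except zero, \<open>x\<close> divides both of them. But then all powers of \<open>x\<close> do,
although \<open>x\<close> is nilpotent.\<close>

lemma nilpotent_square_zero:
  assumes xN: "x \<in> N"
  shows "local_dvd P \<zero> (x \<otimes> x)"
proof (rule ccontr)
  assume nz: "\<not> ?thesis"
  have x: "x \<in> carrier R" using xN N.Icarr by blast
  have "\<not> local_dvd P \<zero> x" using nz zero_local_dvd_multiple x by blast
  then have "\<not> (local_dvd P a x \<and> local_dvd P b x)"
    using incomparable_common_multiple c inc x by blast
  moreover have "local_dvd P a x \<or> local_dvd P x a" "local_dvd P b x \<or> local_dvd P x b"
    using incomparable_products(2)[OF x] nz c by blast+
  ultimately have xa: "local_dvd P x a" and xb: "local_dvd P x b"
    using inc c x local_dvd_trans by blast+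
  have "local_dvd P (x [^] Suc n) a \<and> local_dvd P (x [^] Suc n) b" for n
  proof (induction n)
    case 0 then show ?case using xa xb x by simp
  next
    case (Suc n)
    then show ?case
      using local_dvd_power_step[of a b x n] local_dvd_power_step[of b a x n] inc c x by blast
  qed
  moreover from nilp[OF xN] obtain n :: nat where "x [^] n = \<zero>" ..
  ultimately have "local_dvd P \<zero> a" using x by (metis l_null nat_pow_Suc)
  then have "local_dvd P b a" using local_dvd_trans[of b \<zero> a] local_dvd_zero c by simp
  with inc show False by simp
qed

lemma nilpotent_product_zero:
  assumes x: "x \<in> N" "y \<in> N"
  shows "local_dvd P \<zero> (x \<otimes> y)"
proof -
  have k: "x \<in> carrier R" "y \<in> carrier R" using x N.Icarr by blast+
  consider "incomparable_at P x y" | "local_dvd P x y" | "local_dvd P y x" by blast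
  then show ?thesis
  proof cases
    case 1 then show ?thesis using incomparable_products k by blast
  next
    case 2
    from local_dvd_mult[OF k k(1) 2] show ?thesis
      using nilpotent_square_zero[OF x(1)] local_dvd_trans[of \<zero> "x \<otimes> x" "x \<otimes> y"] k by simp
  next
    case 3
    from local_dvd_mult[OF k(2,1,2) 3] show ?thesis
      using nilpotent_square_zero[OF x(2)] local_dvd_trans[of \<zero> "y \<otimes> y" "x \<otimes> y"] k
      by (simp add: m_comm)
  qed
qed

text \<open>Suppose that \<open>s y = r x\<close> with \<open>s \<notin> Q\<close>. Then \<open>s \<notin> N\<close>, so \<open>s\<close> and \<open>r\<close> are comparable in \<open>R\<^sub>P\<close>. The one
that divides the other is outside \<open>N\<close>, hence regular in \<open>R\<^sub>P\<close>, and cancelling it from the equation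
makes \<open>x\<close> and \<open>y\<close> comparable in \<open>R\<^sub>P\<close>.\<close>

lemma incomparable_at_other_prime:
  assumes Q: "primeideal Q R" and NQ: "N \<subseteq> Q"
  shows "incomparable_at Q a b"
proof -
  have key: "local_dvd P y x \<or> local_dvd P x y"
    if k: "x \<in> carrier R" "y \<in> carrier R" and d: "local_dvd Q x y" for x y
  proof -
    from d obtain s r where s: "s \<in> carrier R - Q" "r \<in> carrier R" "s \<otimes> y = r \<otimes> x"
      by (auto simp: local_dvd_def)
    then have sN: "s \<in> carrier R" "s \<notin> N" using NQ by auto
    consider "local_dvd P s r" | "local_dvd P r s"
      using incomparable_in_prime[of s r] sN s(2) by blast
    then show ?thesis
    proof cases
      case 1
      then obtain t e where t: "t \<in> carrier R - P" "e \<in> carrier R" "t \<otimes> r = e \<otimes> s"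
        by (auto simp: local_dvd_def)
      have tc: "t \<in> carrier R" using t by simp
      have "s \<otimes> (t \<otimes> y \<ominus> e \<otimes> x) = t \<otimes> (s \<otimes> y) \<ominus> (e \<otimes> s) \<otimes> x"
        using k sN(1) tc t(2) by algebra
      also have "\<dots> = \<zero>" unfolding s(3) t(3)[symmetric] using k tc s(2) by algebra
      finally have "local_dvd P \<zero> (s \<otimes> (t \<otimes> y \<ominus> e \<otimes> x))" using local_dvd_zero by simp
      then have "local_dvd P \<zero> (t \<otimes> y \<ominus> e \<otimes> x)"
        using regular_outside_prime[OF sN, of "t \<otimes> y \<ominus> e \<otimes> x"] k tc t(2) by simp
      then obtain w where w: "w \<in> carrier R - P" "w \<otimes> (t \<otimes> y \<ominus> e \<otimes> x) = \<zero>"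
        using zero_local_dvd_iff k tc t(2) by auto
      have "(w \<otimes> t) \<otimes> y = w \<otimes> (t \<otimes> y \<ominus> e \<otimes> x) \<oplus> (w \<otimes> e) \<otimes> x"
      proof -
        have "w \<in> carrier R" using w by simp
        then show ?thesis using k tc t(2) by algebra
      qed
      also have "\<dots> = (w \<otimes> e) \<otimes> x" using w k t(2) by simp
      finally have "local_dvd P x y"
        unfolding local_dvd_def using mult_notin_prime[OF w(1) t(1)] w(1) t(2) by blast
      then show ?thesis ..
    next
      case 2
      then obtain t e where t: "t \<in> carrier R - P" "e \<in> carrier R" "t \<otimes> s = e \<otimes> r"
        by (auto simp: local_dvd_def)
      have tc: "t \<in> carrier R" using t by simp
      have rN: "r \<notin> N"
      proof
        assume "r \<in> N"
        then have "t \<otimes> s \<in> N" using t N.I_l_closed by simp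
        then show False using N.I_prime[OF tc sN(1)] sN(2) t(1) NP by blast
      qed
      have "r \<otimes> (e \<otimes> y \<ominus> t \<otimes> x) = (e \<otimes> r) \<otimes> y \<ominus> t \<otimes> (r \<otimes> x)"
        using k s(2) tc t(2) by algebra
      also have "\<dots> = \<zero>" unfolding s(3)[symmetric] t(3)[symmetric] using k tc sN(1) by algebra
      finally have "local_dvd P \<zero> (r \<otimes> (e \<otimes> y \<ominus> t \<otimes> x))" using local_dvd_zero by simp
      then have "local_dvd P \<zero> (e \<otimes> y \<ominus> t \<otimes> x)"
        using regular_outside_prime[OF s(2) rN, of "e \<otimes> y \<ominus> t \<otimes> x"] k tc t(2) by simp
      then obtain w where w: "w \<in> carrier R - P" "w \<otimes> (e \<otimes> y \<ominus> t \<otimes> x) = \<zero>"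
        using zero_local_dvd_iff k tc t(2) by auto
      have "(w \<otimes> e) \<otimes> y = w \<otimes> (e \<otimes> y \<ominus> t \<otimes> x) \<oplus> (w \<otimes> t) \<otimes> x"
      proof -
        have "w \<in> carrier R" using w by simp
        then show ?thesis using k tc t(2) by algebra
      qed
      also have "\<dots> = (w \<otimes> t) \<otimes> x" using w k tc by simp
      finally have "(w \<otimes> t) \<otimes> x = (w \<otimes> e) \<otimes> y" ..
      then have "local_dvd P y x"
        unfolding local_dvd_def using mult_notin_prime[OF w(1) t(1)] w(1) t(2) by blast
      then show ?thesis ..
    qed
  qed
  show ?thesis using key[OF c] key[OF c(2,1)] inc by blast
qed

end

end

end

end

end

section \<open>Localizations that are chain rings\<close>

context cring
begin

context
  fixes P assumes P: "primeideal P R"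
begin

interpretation P: primeideal P R by (rule P)

lemma equiv_frac_rel_prime: "equiv (carrier R \<times> (carrier R - P)) (frac_rel R (carrier R - P))"
  using one_notin_prime[OF P] mult_notin_prime[OF P] by (intro equiv_frac_rel[OF is_cring]) auto

lemma cring_localization_prime: "cring (localization_at R P)"
  using one_notin_prime[OF P] mult_notin_prime[OF P] by (intro cring_localization[OF is_cring]) auto

lemma carrier_localization_at:
  "carrier (localization_at R P) = {frac R (carrier R - P) a s | a s. a \<in> carrier R \<and> s \<in> carrier R - P}"
  by (auto simp: localization_def quotient_def frac_def)

lemma frac_eq_iff:
  assumes "a \<in> carrier R" "s \<in> carrier R - P" "b \<in> carrier R" "t \<in> carrier R - P"
  shows "frac R (carrier R - P) a s = frac R (carrier R - P) b t \<longleftrightarrow>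
    (\<exists>u\<in>carrier R - P. u \<otimes> (a \<otimes> t \<ominus> b \<otimes> s) = \<zero>)"
proof -
  have "frac R (carrier R - P) a s = frac R (carrier R - P) b t \<longleftrightarrow>
      ((a, s), (b, t)) \<in> frac_rel R (carrier R - P)"
    unfolding frac_def using assms by (intro eq_equiv_class_iff[OF equiv_frac_rel_prime]) auto
  then show ?thesis using assms by (auto simp: frac_rel_def)
qed

lemma frac_mult:
  assumes m: "a \<in> carrier R" "s \<in> carrier R - P" "b \<in> carrier R" "t \<in> carrier R - P"
  shows "frac R (carrier R - P) a s \<otimes>\<^bsub>localization_at R P\<^esub> frac R (carrier R - P) b t =
    frac R (carrier R - P) (a \<otimes> b) (s \<otimes> t)"
proof -
  let ?f = "frac R (carrier R - P)"
  have mem: "x \<in> carrier R \<and> u \<in> carrier R - P \<and> ?f x u = ?f a s"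
    if xu: "(x, u) \<in> ?f a s" for x u a s
  proof -
    have rel: "((a, s), (x, u)) \<in> frac_rel R (carrier R - P)" using xu by (simp add: frac_def)
    then have "?f a s = ?f x u" unfolding frac_def by (rule equiv_class_eq[OF equiv_frac_rel_prime])
    moreover have "x \<in> carrier R" "u \<in> carrier R - P" using rel by (auto simp: frac_rel_def)
    ultimately show ?thesis by simp
  qed
  have self: "(x, u) \<in> ?f x u" if "x \<in> carrier R" "u \<in> carrier R - P" for x u
    unfolding frac_def by (rule equiv_class_self[OF equiv_frac_rel_prime]) (use that in auto)
  have "?f (x \<otimes> y) (u \<otimes> w) = ?f (a \<otimes> b) (s \<otimes> t)"
    if xu: "(x, u) \<in> ?f a s" and yw: "(y, w) \<in> ?f b t" for x u y w
  proof -
    note 1 = mem[OF xu] and 2 = mem[OF yw]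
    from 1 m obtain p where p: "p \<in> carrier R - P" "p \<otimes> (x \<otimes> s \<ominus> a \<otimes> u) = \<zero>"
      using frac_eq_iff[of x u a s] by blast
    from 2 m obtain q where q: "q \<in> carrier R - P" "q \<otimes> (y \<otimes> t \<ominus> b \<otimes> w) = \<zero>"
      using frac_eq_iff[of y w b t] by blast
    have c: "x \<in> carrier R" "u \<in> carrier R" "y \<in> carrier R" "w \<in> carrier R" "p \<in> carrier R"
      "q \<in> carrier R" "s \<in> carrier R" "t \<in> carrier R"
      using 1 2 p q m by auto
    have "(p \<otimes> q) \<otimes> ((x \<otimes> y) \<otimes> (s \<otimes> t) \<ominus> (a \<otimes> b) \<otimes> (u \<otimes> w)) =
        q \<otimes> y \<otimes> t \<otimes> (p \<otimes> (x \<otimes> s \<ominus> a \<otimes> u)) \<oplus> p \<otimes> a \<otimes> u \<otimes> (q \<otimes> (y \<otimes> t \<ominus> b \<otimes> w))"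
      using c m(1,3) by algebra
    also have "\<dots> = \<zero>" unfolding p(2) q(2) using c m(1,3) by simp
    finally have *: "(p \<otimes> q) \<otimes> ((x \<otimes> y) \<otimes> (s \<otimes> t) \<ominus> (a \<otimes> b) \<otimes> (u \<otimes> w)) = \<zero>" .
    have "u \<in> carrier R - P" "w \<in> carrier R - P" using 1 2 by auto
    then show ?thesis
      using * mult_notin_prime[OF P] p(1) q(1) m c by (subst frac_eq_iff) (auto simp del: m_closed)
  qed
  then have "frac R (carrier R - P) (fst v \<otimes> fst z) (snd v \<otimes> snd z) = ?f (a \<otimes> b) (s \<otimes> t)"
    if "v \<in> ?f a s" "z \<in> ?f b t" for v z
    using that by (cases v; cases z) simp
  then have "?f a s \<otimes>\<^bsub>localization_at R P\<^esub> ?f b t =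
      (\<Union>v\<in>?f a s. \<Union>z\<in>?f b t. ?f (a \<otimes> b) (s \<otimes> t))"
    by (simp add: localization_def case_prod_beta cong: SUP_cong)
  also have "\<dots> = ?f (a \<otimes> b) (s \<otimes> t)" using self m by blast
  finally show ?thesis .
qed

lemma local_dvd_iff_frac:
  assumes c: "a \<in> carrier R" "b \<in> carrier R" and st: "s \<in> carrier R - P" "t \<in> carrier R - P"
  shows "local_dvd P a b \<longleftrightarrow> (\<exists>z\<in>carrier (localization_at R P).
    frac R (carrier R - P) b t = z \<otimes>\<^bsub>localization_at R P\<^esub> frac R (carrier R - P) a s)"
proof
  assume "local_dvd P a b"
  then obtain u d where u: "u \<in> carrier R - P" "d \<in> carrier R" "u \<otimes> b = d \<otimes> a"
    by (auto simp: local_dvd_def)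
  have k: "s \<in> carrier R" "t \<in> carrier R" "u \<in> carrier R" using st u by auto
  have ut: "u \<otimes> t \<in> carrier R - P" using mult_notin_prime[OF P] u(1) st by blast
  have uts: "(u \<otimes> t) \<otimes> s \<in> carrier R - P" using mult_notin_prime[OF P] ut st by blast
  have "\<one> \<otimes> (b \<otimes> ((u \<otimes> t) \<otimes> s) \<ominus> ((d \<otimes> s) \<otimes> a) \<otimes> t) = (s \<otimes> t) \<otimes> (u \<otimes> b \<ominus> d \<otimes> a)"
    using c k u(2) by algebra
  also have "\<dots> = \<zero>" unfolding u(3) using c k u(2) by (simp add: minus_eq r_neg)
  finally have "frac R (carrier R - P) b t =
      frac R (carrier R - P) ((d \<otimes> s) \<otimes> a) ((u \<otimes> t) \<otimes> s)"
    using frac_eq_iff[OF c(2) st(2) _ uts, of "(d \<otimes> s) \<otimes> a"] one_notin_prime[OF P] c k u(2) by auto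
  also have "\<dots> = frac R (carrier R - P) (d \<otimes> s) (u \<otimes> t) \<otimes>\<^bsub>localization_at R P\<^esub> frac R (carrier R - P) a s"
    using c k u(2) ut st by (subst frac_mult) auto
  finally show "\<exists>z\<in>carrier (localization_at R P).
      frac R (carrier R - P) b t = z \<otimes>\<^bsub>localization_at R P\<^esub> frac R (carrier R - P) a s"
    using ut u(2) k unfolding carrier_localization_at by blast
next
  assume "\<exists>z\<in>carrier (localization_at R P).
    frac R (carrier R - P) b t = z \<otimes>\<^bsub>localization_at R P\<^esub> frac R (carrier R - P) a s"
  then obtain d w where d: "d \<in> carrier R" "w \<in> carrier R - P"
    "frac R (carrier R - P) b t =
     frac R (carrier R - P) d w \<otimes>\<^bsub>localization_at R P\<^esub> frac R (carrier R - P) a s"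
    unfolding carrier_localization_at by blast
  have ws: "w \<otimes> s \<in> carrier R - P" using mult_notin_prime[OF P] d(2) st by blast
  have "frac R (carrier R - P) b t = frac R (carrier R - P) (d \<otimes> a) (w \<otimes> s)"
    unfolding d(3) by (rule frac_mult[OF d(1,2) c(1) st(1)])
  then obtain u where u: "u \<in> carrier R - P" "u \<otimes> (b \<otimes> (w \<otimes> s) \<ominus> (d \<otimes> a) \<otimes> t) = \<zero>"
    using frac_eq_iff[OF c(2) st(2) _ ws, of "d \<otimes> a"] d(1) c by auto
  have k: "s \<in> carrier R" "t \<in> carrier R" "u \<in> carrier R" "w \<in> carrier R" using st u d by auto
  have "(u \<otimes> (w \<otimes> s)) \<otimes> b = u \<otimes> (b \<otimes> (w \<otimes> s) \<ominus> (d \<otimes> a) \<otimes> t) \<oplus> (u \<otimes> d \<otimes> t) \<otimes> a"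
    using c k d(1) by algebra
  also have "\<dots> = (u \<otimes> d \<otimes> t) \<otimes> a" unfolding u(2) using c k d(1) by simp
  finally show "local_dvd P a b"
    unfolding local_dvd_def using mult_notin_prime[OF P u(1) ws] k d(1) by blast
qed

lemma chain_ring_localization_iff:
  "chain_ring (localization_at R P) \<longleftrightarrow>
    (\<forall>a\<in>carrier R. \<forall>b\<in>carrier R. local_dvd P a b \<or> local_dvd P b a)"
proof -
  interpret L: cring "localization_at R P" by (rule cring_localization_prime)
  let ?f = "frac R (carrier R - P)" and ?L = "localization_at R P"
  show ?thesis
  proof
    assume ch: "chain_ring ?L"
    show "\<forall>a\<in>carrier R. \<forall>b\<in>carrier R. local_dvd P a b \<or> local_dvd P b a"
    proof (intro ballI)
      fix a b assume c: "a \<in> carrier R" "b \<in> carrier R"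
      note one = one_notin_prime[OF P]
      have k: "?f a \<one> \<in> carrier ?L" "?f b \<one> \<in> carrier ?L"
        using c one by (auto simp: carrier_localization_at)
      from ch have "PIdl\<^bsub>?L\<^esub> ?f a \<one> \<subseteq> PIdl\<^bsub>?L\<^esub> ?f b \<one> \<or> PIdl\<^bsub>?L\<^esub> ?f b \<one> \<subseteq> PIdl\<^bsub>?L\<^esub> ?f a \<one>"
        using L.cgenideal_ideal k by (auto simp: chain_ring_def)
      then have "?f a \<one> \<in> PIdl\<^bsub>?L\<^esub> ?f b \<one> \<or> ?f b \<one> \<in> PIdl\<^bsub>?L\<^esub> ?f a \<one>"
        using L.cgenideal_self k by blast
      then show "local_dvd P a b \<or> local_dvd P b a"
        unfolding local_dvd_iff_frac[OF c one one] local_dvd_iff_frac[OF c(2,1) one one] cgenideal_def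
        by blast
    qed
  next
    assume tot: "\<forall>a\<in>carrier R. \<forall>b\<in>carrier R. local_dvd P a b \<or> local_dvd P b a"
    have "J \<subseteq> I" if I: "ideal I ?L" and J: "ideal J ?L" and n: "\<not> I \<subseteq> J" for I J
    proof
      fix y assume y: "y \<in> J"
      from n obtain x where x: "x \<in> I" "x \<notin> J" by blast
      from ideal.Icarr[OF I x(1)] obtain a s where a: "a \<in> carrier R" "s \<in> carrier R - P" "x = ?f a s"
        unfolding carrier_localization_at by blast
      from ideal.Icarr[OF J y] obtain b t where b: "b \<in> carrier R" "t \<in> carrier R - P" "y = ?f b t"
        unfolding carrier_localization_at by blast
      have "\<not> local_dvd P b a"
        using local_dvd_iff_frac[OF b(1) a(1) b(2) a(2)] x(2) ideal.I_l_closed[OF J y]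
        unfolding a(3) b(3) by metis
      then have "local_dvd P a b" using tot a b by blast
      then show "y \<in> I"
        using local_dvd_iff_frac[OF a(1) b(1) a(2) b(2)] ideal.I_l_closed[OF I x(1)]
        unfolding a(3) b(3) by metis
    qed
    then show "chain_ring ?L" unfolding chain_ring_def using L.is_cring by blast
  qed
qed

end

end

section \<open>A local criterion for quasi-projectivity\<close>

text \<open>A choice of representatives turns a homomorphism from \<open>I\<close> to \<open>I/X\<close> into a map \<open>h\<close> on \<open>I\<close> that is linear
modulo \<open>X\<close>, which avoids computing with cosets.\<close>

lemma (in cring) quasi_projective_ideal_moduleI:
  assumes I: "ideal I R"
    and lift: "\<And>X h. ideal X R \<Longrightarrow> X \<subseteq> I \<Longrightarrow> (\<And>x. x \<in> I \<Longrightarrow> h x \<in> I) \<Longrightarrow>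
      (\<And>x y. x \<in> I \<Longrightarrow> y \<in> I \<Longrightarrow> h (x \<oplus> y) \<ominus> (h x \<oplus> h y) \<in> X) \<Longrightarrow>
      (\<And>a x. a \<in> carrier R \<Longrightarrow> x \<in> I \<Longrightarrow> h (a \<otimes> x) \<ominus> a \<otimes> h x \<in> X) \<Longrightarrow>
      \<exists>g\<in>module_homs R (ideal_module R I) (ideal_module R I). \<forall>x\<in>I. h x \<ominus> g x \<in> X"
  shows "quasi_projective R (ideal_module R I)"
  unfolding quasi_projective_def
proof (intro allI impI ballI)
  define V where "V = ideal_module R I"
  interpret I: ideal I R by (rule I)
  have mV: "module R V" unfolding V_def by (rule module_ideal_module[OF is_cring I])
  interpret V: module R V by (rule mV)
  have Vs: "carrier V = I" "\<zero>\<^bsub>V\<^esub> = \<zero>" "x \<oplus>\<^bsub>V\<^esub> y = x \<oplus> y" "t \<odot>\<^bsub>V\<^esub> x = t \<otimes> x" for x y t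
    by (simp_all add: V_def ideal_module_def)
  have Vneg: "\<ominus>\<^bsub>V\<^esub> y = \<ominus> y" if "y \<in> I" for y
    using V.M.minus_equality[of "\<ominus> y" y] that by (simp add: Vs l_neg)
  have Vminus: "x \<ominus>\<^bsub>V\<^esub> y = x \<ominus> y" if "y \<in> I" for x y
    using Vneg[OF that] by (simp add: V.M.minus_eq minus_eq Vs)
  fix X f assume "submodule X R (ideal_module R I)"
    and "f \<in> module_homs R (ideal_module R I) (quot_module R (ideal_module R I) X)"
  then have Xs: "submodule X R V" and f: "f \<in> module_homs R V (quot_module R V X)"
    by (simp_all add: V_def)
  note X = V.submoduleE[OF Xs, unfolded Vs]
  have Xid: "ideal X R"
  proof (rule idealI[OF ring_axioms])
    show "subgroup X (add_monoid R)"
    proof (rule add.subgroupI)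
      show "X \<subseteq> carrier R" "X \<noteq> {}" using X(1,2) I.Icarr by auto
      show "\<ominus> x \<in> X" if "x \<in> X" for x using X(3)[OF that] Vneg[of x] X(1) that by auto
      show "x \<oplus> y \<in> X" if "x \<in> X" "y \<in> X" for x y using X(5) that by simp
    qed
    fix a x assume a: "a \<in> X" "x \<in> carrier R"
    then show "x \<otimes> a \<in> X" using X(4) by simp
    then show "a \<otimes> x \<in> X" using a X(1) I.Icarr m_comm by auto
  qed
  have "\<exists>y\<in>I. f x = X +>\<^bsub>V\<^esub> y" if "x \<in> I" for x
    using module_homsD(1)[OF f, of x] that carrier_quot_module[OF mV Xs] by (auto simp: Vs)
  then obtain h where h: "\<And>x. x \<in> I \<Longrightarrow> h x \<in> I \<and> f x = X +>\<^bsub>V\<^esub> h x" by metis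
  note coset = rcoset_module_homs[OF mV Xs]
  have eq: "X +>\<^bsub>V\<^esub> x = X +>\<^bsub>V\<^esub> y \<longleftrightarrow> x \<ominus> y \<in> X" if "x \<in> I" "y \<in> I" for x y
    using rcoset_eq_iff[OF mV Xs, of x y] that Vminus by (simp add: Vs)
  have "\<exists>g\<in>module_homs R (ideal_module R I) (ideal_module R I). \<forall>x\<in>I. h x \<ominus> g x \<in> X"
  proof (rule lift[OF Xid X(1)])
    show "h x \<in> I" if "x \<in> I" for x using h that by blast
    fix x assume x: "x \<in> I"
    show "h (x \<oplus> y) \<ominus> (h x \<oplus> h y) \<in> X" if y: "y \<in> I" for y
    proof -
      have "X +>\<^bsub>V\<^esub> h (x \<oplus> y) = f (x \<oplus>\<^bsub>V\<^esub> y)" using h[of "x \<oplus> y"] x y by (simp add: Vs)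
      also have "\<dots> = X +>\<^bsub>V\<^esub> (h x \<oplus>\<^bsub>V\<^esub> h y)"
        using module_homsD(2)[OF f, of x y] module_homsD(2)[OF coset, of "h x" "h y"] h x y
        by (simp add: Vs(1))
      finally show ?thesis using eq[of "h (x \<oplus> y)" "h x \<oplus> h y"] h x y by (simp add: Vs)
    qed
    show "h (a \<otimes> x) \<ominus> a \<otimes> h x \<in> X" if a: "a \<in> carrier R" for a
    proof -
      have ax: "a \<otimes> x \<in> I" "a \<otimes> h x \<in> I" using I.I_l_closed a x h by auto
      then have "X +>\<^bsub>V\<^esub> h (a \<otimes> x) = f (a \<odot>\<^bsub>V\<^esub> x)" using h by (simp add: Vs)
      also have "\<dots> = X +>\<^bsub>V\<^esub> (a \<odot>\<^bsub>V\<^esub> h x)"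
        using module_homsD(3)[OF f a, of x] module_homsD(3)[OF coset a, of "h x"] h x
        by (simp add: Vs(1))
      finally show ?thesis using eq[of "h (a \<otimes> x)" "a \<otimes> h x"] h ax by (simp add: Vs)
    qed
  qed
  then obtain g where g: "g \<in> module_homs R V V" "\<forall>x\<in>I. h x \<ominus> g x \<in> X" unfolding V_def by blast
  have "f x = X +>\<^bsub>V\<^esub> g x" if x: "x \<in> I" for x
    using h[OF x] eq[of "h x" "g x"] g x module_homsD(1)[OF g(1), of x] by (simp add: Vs)
  with g show "\<exists>g\<in>module_homs R (ideal_module R I) (ideal_module R I).
      \<forall>x\<in>carrier (ideal_module R I). f x = X +>\<^bsub>ideal_module R I\<^esub> g x"
    unfolding V_def[symmetric] Vs by blast
qed

lemma ideal_module_homs_iff: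
  "g \<in> module_homs R (ideal_module R I) (ideal_module R I) \<longleftrightarrow>
    (\<forall>x\<in>I. g x \<in> I) \<and> (\<forall>x\<in>I. \<forall>y\<in>I. g (x \<oplus>\<^bsub>R\<^esub> y) = g x \<oplus>\<^bsub>R\<^esub> g y) \<and>
    (\<forall>a\<in>carrier R. \<forall>x\<in>I. g (a \<otimes>\<^bsub>R\<^esub> x) = a \<otimes>\<^bsub>R\<^esub> g x)"
  by (auto simp: module_homs_def hom_def ideal_module_def)

text \<open>For \<open>s \<notin> P\<close> this says that the images of the elements of \<open>B\<close> form a basis of \<open>I\<^sub>P\<close> over \<open>R\<^sub>P\<close> modulo
the annihilator of \<open>I\<^sub>P\<close>. It is essential that the single denominator \<open>s\<close> works for all \<open>x\<close> and all
relations at once.\<close>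

definition (in cring) local_basis :: "'a set \<Rightarrow> 'a \<Rightarrow> 'a set \<Rightarrow> bool" where
  "local_basis I s B \<longleftrightarrow> finite B \<and> B \<subseteq> I \<and>
    (\<forall>x\<in>I. \<exists>r\<in>B \<rightarrow> carrier R. s \<otimes> x = (\<Oplus>b\<in>B. r b \<otimes> b)) \<and>
    (\<forall>r\<in>B \<rightarrow> carrier R. (\<Oplus>b\<in>B. r b \<otimes> b) = \<zero> \<longrightarrow> (\<forall>b\<in>B. \<forall>x\<in>I. s \<otimes> (r b \<otimes> x) = \<zero>))"

lemma (in cring) finsum_smult:
  assumes "finite B" "B \<subseteq> carrier R" "r \<in> B \<rightarrow> carrier R" "a \<in> carrier R"
  shows "a \<otimes> (\<Oplus>b\<in>B. r b \<otimes> b) = (\<Oplus>b\<in>B. (a \<otimes> r b) \<otimes> b)"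
proof -
  have "a \<otimes> (\<Oplus>b\<in>B. r b \<otimes> b) = (\<Oplus>b\<in>B. a \<otimes> (r b \<otimes> b))"
    using assms by (intro finsum_rdistr) (auto simp: Pi_iff subset_iff)
  also have "\<dots> = (\<Oplus>b\<in>B. (a \<otimes> r b) \<otimes> b)"
    using assms by (intro finsum_cong') (auto simp: Pi_iff subset_iff m_assoc)
  finally show ?thesis .
qed

text \<open>If \<open>s x = \<Sum> r\<^sub>b b\<close>, then modulo \<open>X\<close> the value \<open>s (h x)\<close> is \<open>\<Sum> r\<^sub>b (h b)\<close>. Only the products
\<open>s r\<^sub>b\<close> are determined by \<open>x\<close>, and these up to the annihilator of \<open>I\<close>, so
\<open>x \<mapsto> s (\<Sum> r\<^sub>b (h b))\<close> is a well defined linear map; this second factor is why \<open>s\<^sup>2\<close> occurs.\<close>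

lemma (in cring) local_basis_lift:
  assumes I: "ideal I R" and s: "s \<in> carrier R" and B: "local_basis I s B"
    and X: "ideal X R"
    and h: "\<And>x. x \<in> I \<Longrightarrow> h x \<in> I"
    and hadd: "\<And>x y. x \<in> I \<Longrightarrow> y \<in> I \<Longrightarrow> h (x \<oplus> y) \<ominus> (h x \<oplus> h y) \<in> X"
    and hmult: "\<And>a x. a \<in> carrier R \<Longrightarrow> x \<in> I \<Longrightarrow> h (a \<otimes> x) \<ominus> a \<otimes> h x \<in> X"
  shows "\<exists>g\<in>module_homs R (ideal_module R I) (ideal_module R I).
    \<forall>x\<in>I. (s \<otimes> s) \<otimes> h x \<ominus> g x \<in> X"
proof -
  interpret I: ideal I R by (rule I)
  interpret X: ideal X R by (rule X)
  have fin: "finite B" and BI: "B \<subseteq> I" using B by (auto simp: local_basis_def)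
  have Bc: "b \<in> carrier R" if "b \<in> B" for b using BI I.Icarr that by blast
  have hc: "h b \<in> carrier R" if "b \<in> I" for b using h I.Icarr that by blast
  have "\<forall>x\<in>I. \<exists>r. r \<in> B \<rightarrow> carrier R \<and> s \<otimes> x = (\<Oplus>b\<in>B. r b \<otimes> b)"
    using B unfolding local_basis_def Bex_def by blast
  then obtain \<rho> where \<rho>: "\<And>x. x \<in> I \<Longrightarrow> \<rho> x \<in> B \<rightarrow> carrier R"
    "\<And>x. x \<in> I \<Longrightarrow> s \<otimes> x = (\<Oplus>b\<in>B. \<rho> x b \<otimes> b)" by metis
  have indep: "s \<otimes> (r b \<otimes> y) = \<zero>"
    if "r \<in> B \<rightarrow> carrier R" "(\<Oplus>b\<in>B. r b \<otimes> b) = \<zero>" "b \<in> B" "y \<in> I" for r b y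
    using B that unfolding local_basis_def by blast
  define g where "g x = s \<otimes> (\<Oplus>b\<in>B. \<rho> x b \<otimes> h b)" for x
  have comb: "(\<Oplus>b\<in>F. r b \<otimes> k b) \<in> J"
    if J: "ideal J R" and F: "finite F" "F \<subseteq> B" "r \<in> F \<rightarrow> carrier R" "\<And>b. b \<in> F \<Longrightarrow> k b \<in> J" for J F r k
    using F
  proof (induction F rule: finite_induct)
    case empty then show ?case using additive_subgroup.zero_closed[OF ideal.axioms(1)[OF J]] by simp
  next
    case (insert b F)
    have kc: "k c \<in> carrier R" if "c \<in> insert b F" for c by (rule ideal.Icarr[OF J insert.prems(3)[OF that]])
    have "(\<Oplus>b\<in>insert b F. r b \<otimes> k b) = r b \<otimes> k b \<oplus> (\<Oplus>b\<in>F. r b \<otimes> k b)"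
      using insert kc by (intro finsum_insert) (auto simp: Pi_iff)
    also have "\<dots> \<in> J"
      using insert ideal.I_l_closed[OF J] additive_subgroup.a_closed[OF ideal.axioms(1)[OF J]]
      by (auto simp: Pi_iff)
    finally show ?case .
  qed
  have uniq: "g x = s \<otimes> (\<Oplus>b\<in>B. r b \<otimes> h b)"
    if x: "x \<in> I" and r: "r \<in> B \<rightarrow> carrier R" "s \<otimes> x = (\<Oplus>b\<in>B. r b \<otimes> b)" for x r
  proof -
    have rc: "r b \<in> carrier R" "\<rho> x b \<in> carrier R" if "b \<in> B" for b using r(1) \<rho>(1)[OF x] that by auto
    have "(\<Oplus>b\<in>B. \<rho> x b \<otimes> b) = (\<Oplus>b\<in>B. r b \<otimes> b) \<oplus> (\<Oplus>b\<in>B. (\<rho> x b \<ominus> r b) \<otimes> b)"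
    proof -
      have "(\<Oplus>b\<in>B. r b \<otimes> b) \<oplus> (\<Oplus>b\<in>B. (\<rho> x b \<ominus> r b) \<otimes> b) =
          (\<Oplus>b\<in>B. r b \<otimes> b \<oplus> (\<rho> x b \<ominus> r b) \<otimes> b)"
        using rc Bc by (intro finsum_addf[symmetric]) auto
      also have "\<dots> = (\<Oplus>b\<in>B. \<rho> x b \<otimes> b)"
      proof (intro finsum_cong')
        fix b assume "b \<in> B"
        with rc[OF this] Bc[OF this] show "r b \<otimes> b \<oplus> (\<rho> x b \<ominus> r b) \<otimes> b = \<rho> x b \<otimes> b" by algebra
      qed (use rc Bc in auto)
      finally show ?thesis ..
    qed
    moreover have sc: "(\<Oplus>b\<in>B. (\<rho> x b \<ominus> r b) \<otimes> b) \<in> carrier R" "(\<Oplus>b\<in>B. r b \<otimes> b) \<in> carrier R"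
      using rc Bc by (auto intro!: finsum_closed)
    moreover have "v = \<zero>" if "u \<in> carrier R" "v \<in> carrier R" "u = u \<oplus> v" for u v
      using r_neg1[OF that(1,2)] l_neg[OF that(1)] that(3) by simp
    ultimately have "(\<Oplus>b\<in>B. (\<rho> x b \<ominus> r b) \<otimes> b) = \<zero>"
      using \<rho>(2)[OF x] r(2) by simp
    moreover have "(\<lambda>b. \<rho> x b \<ominus> r b) \<in> B \<rightarrow> carrier R" using rc by auto
    ultimately have z: "s \<otimes> ((\<rho> x b \<ominus> r b) \<otimes> h b) = \<zero>" if "b \<in> B" for b
      using indep[of "\<lambda>b. \<rho> x b \<ominus> r b" b "h b"] that BI h by blast
    have "g x = (\<Oplus>b\<in>B. s \<otimes> (\<rho> x b \<otimes> h b))"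
      unfolding g_def using rc hc BI s fin by (intro finsum_rdistr) (auto simp: subset_iff)
    also have "\<dots> = (\<Oplus>b\<in>B. s \<otimes> (r b \<otimes> h b))"
    proof (intro finsum_cong')
      fix b assume b: "b \<in> B"
      have "h b \<in> carrier R" using hc BI b by blast
      with rc[OF b] s have "s \<otimes> (\<rho> x b \<otimes> h b) = s \<otimes> ((\<rho> x b \<ominus> r b) \<otimes> h b) \<oplus> s \<otimes> (r b \<otimes> h b)"
        by algebra
      with z[OF b] show "s \<otimes> (\<rho> x b \<otimes> h b) = s \<otimes> (r b \<otimes> h b)"
        using rc[OF b] s \<open>h b \<in> carrier R\<close> by simp
    qed (use rc hc BI s in \<open>auto simp: subset_iff\<close>)
    also have "\<dots> = s \<otimes> (\<Oplus>b\<in>B. r b \<otimes> h b)"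
      using rc hc BI s fin by (intro finsum_rdistr[symmetric]) (auto simp: subset_iff)
    finally show ?thesis .
  qed
  have "g \<in> module_homs R (ideal_module R I) (ideal_module R I)"
    unfolding ideal_module_homs_iff
  proof (intro conjI ballI)
    fix x assume x: "x \<in> I"
    have rc: "\<rho> x b \<in> carrier R" if "b \<in> B" for b using \<rho>(1)[OF x] that by auto
    show "g x \<in> I"
      unfolding g_def using comb[OF I fin subset_refl \<rho>(1)[OF x], of h] h BI s I.I_l_closed by blast
    show "g (a \<otimes> x) = a \<otimes> g x" if a: "a \<in> carrier R" for a
    proof -
      have "s \<otimes> (a \<otimes> x) = a \<otimes> (s \<otimes> x)" using a s x I.Icarr by (simp add: m_lcomm)
      also have "\<dots> = (\<Oplus>b\<in>B. (a \<otimes> \<rho> x b) \<otimes> b)"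
        unfolding \<rho>(2)[OF x] using fin Bc \<rho>(1)[OF x] a by (intro finsum_smult) auto
      finally have "g (a \<otimes> x) = s \<otimes> (\<Oplus>b\<in>B. (a \<otimes> \<rho> x b) \<otimes> h b)"
        using uniq[of "a \<otimes> x" "\<lambda>b. a \<otimes> \<rho> x b"] rc a x I.I_l_closed by auto
      also have "(\<Oplus>b\<in>B. (a \<otimes> \<rho> x b) \<otimes> h b) = (\<Oplus>b\<in>B. a \<otimes> (\<rho> x b \<otimes> h b))"
        using rc hc BI a by (intro finsum_cong') (auto simp: subset_iff m_assoc)
      also have "\<dots> = a \<otimes> (\<Oplus>b\<in>B. \<rho> x b \<otimes> h b)"
        using rc hc BI a fin by (intro finsum_rdistr[symmetric]) (auto simp: subset_iff)
      also have "s \<otimes> (a \<otimes> (\<Oplus>b\<in>B. \<rho> x b \<otimes> h b)) = a \<otimes> g x"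
        unfolding g_def using rc hc BI a s by (intro m_lcomm finsum_closed) auto
      finally show ?thesis .
    qed
    fix y assume y: "y \<in> I"
    have rc': "\<rho> y b \<in> carrier R" if "b \<in> B" for b using \<rho>(1)[OF y] that by auto
    have "s \<otimes> (x \<oplus> y) = (\<Oplus>b\<in>B. \<rho> x b \<otimes> b) \<oplus> (\<Oplus>b\<in>B. \<rho> y b \<otimes> b)"
      using s x y I.Icarr by (simp add: r_distr \<rho>(2)[symmetric])
    also have "\<dots> = (\<Oplus>b\<in>B. \<rho> x b \<otimes> b \<oplus> \<rho> y b \<otimes> b)"
      using rc rc' Bc by (intro finsum_addf[symmetric]) auto
    also have "\<dots> = (\<Oplus>b\<in>B. (\<rho> x b \<oplus> \<rho> y b) \<otimes> b)"
      using rc rc' Bc by (intro finsum_cong') (auto simp: l_distr)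
    finally have "g (x \<oplus> y) = s \<otimes> (\<Oplus>b\<in>B. (\<rho> x b \<oplus> \<rho> y b) \<otimes> h b)"
      using uniq[of "x \<oplus> y" "\<lambda>b. \<rho> x b \<oplus> \<rho> y b"] rc rc' x y by auto
    also have "(\<Oplus>b\<in>B. (\<rho> x b \<oplus> \<rho> y b) \<otimes> h b) = (\<Oplus>b\<in>B. \<rho> x b \<otimes> h b \<oplus> \<rho> y b \<otimes> h b)"
      using rc rc' hc BI by (intro finsum_cong') (auto simp: l_distr subset_iff)
    also have "\<dots> = (\<Oplus>b\<in>B. \<rho> x b \<otimes> h b) \<oplus> (\<Oplus>b\<in>B. \<rho> y b \<otimes> h b)"
      using rc rc' hc BI by (intro finsum_addf) auto
    also have "s \<otimes> \<dots> = g x \<oplus> g y"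
      unfolding g_def using rc rc' hc BI s by (intro r_distr finsum_closed) auto
    finally show "g (x \<oplus> y) = g x \<oplus> g y" .
  qed
  moreover have "(s \<otimes> s) \<otimes> h x \<ominus> g x \<in> X" if x: "x \<in> I" for x
  proof -
    have hsum: "h (\<Oplus>b\<in>F. \<rho> x b \<otimes> b) \<ominus> (\<Oplus>b\<in>F. \<rho> x b \<otimes> h b) \<in> X" if F: "F \<subseteq> B" for F
    proof -
      have "finite F" using F fin by (rule finite_subset)
      then show ?thesis using F
      proof (induction F rule: finite_induct)
        case empty
        have "h (\<zero> \<otimes> \<zero>) \<ominus> \<zero> \<otimes> h \<zero> \<in> X" by (rule hmult) auto
        then show ?case using hc[of \<zero>] by simp
      next
        case (insert b F)
        have rc: "\<rho> x c \<in> carrier R" if "c \<in> insert b F" for c using \<rho>(1)[OF x] that insert by auto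
        define u where "u = (\<Oplus>b\<in>F. \<rho> x b \<otimes> b)"
        define w where "w = (\<Oplus>b\<in>F. \<rho> x b \<otimes> h b)"
        have uI: "u \<in> I" unfolding u_def
          by (rule comb[OF I]) (use insert BI rc in auto)
        have wI: "w \<in> I" unfolding w_def
          by (rule comb[OF I]) (use insert BI h rc in auto)
        have bI: "b \<in> I" "h b \<in> I" "\<rho> x b \<otimes> b \<in> I" "\<rho> x b \<in> carrier R"
          using insert BI h rc I.I_l_closed by auto
        have 1: "(\<Oplus>b\<in>insert b F. \<rho> x b \<otimes> b) = \<rho> x b \<otimes> b \<oplus> u"
          unfolding u_def using insert rc Bc by (intro finsum_insert) auto
        have 2: "(\<Oplus>b\<in>insert b F. \<rho> x b \<otimes> h b) = \<rho> x b \<otimes> h b \<oplus> w"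
          unfolding w_def using insert rc hc BI by (intro finsum_insert) auto
        have k: "h (\<rho> x b \<otimes> b \<oplus> u) \<in> carrier R" "h (\<rho> x b \<otimes> b) \<in> carrier R" "h u \<in> carrier R"
          "w \<in> carrier R" "h b \<in> carrier R"
          using uI wI bI hc I.Icarr by auto
        have "h (\<rho> x b \<otimes> b \<oplus> u) \<ominus> (\<rho> x b \<otimes> h b \<oplus> w) =
            (h (\<rho> x b \<otimes> b \<oplus> u) \<ominus> (h (\<rho> x b \<otimes> b) \<oplus> h u)) \<oplus>
            ((h (\<rho> x b \<otimes> b) \<ominus> \<rho> x b \<otimes> h b) \<oplus> (h u \<ominus> w))"
          using k bI(4) by algebra
        also have "\<dots> \<in> X"
          using hadd[OF bI(3) uI] hmult[OF bI(4,1)] insert.IH insert.prems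
          unfolding u_def[symmetric] w_def[symmetric] by (intro X.a_closed) auto
        finally show ?case unfolding 1 2 .
      qed
    qed
    define w where "w = (\<Oplus>b\<in>B. \<rho> x b \<otimes> h b)"
    have w: "w \<in> carrier R" unfolding w_def using \<rho>(1)[OF x] hc BI by (intro finsum_closed) auto
    have sx: "s \<otimes> x \<in> I" using s x I.I_l_closed by blast
    have 1: "h (s \<otimes> x) \<ominus> w \<in> X" unfolding w_def \<rho>(2)[OF x] by (rule hsum) simp
    have k: "h (s \<otimes> x) \<in> carrier R" "h x \<in> carrier R" using hc sx x by auto
    have "(s \<otimes> s) \<otimes> h x \<ominus> g x = s \<otimes> ((h (s \<otimes> x) \<ominus> w) \<ominus> (h (s \<otimes> x) \<ominus> s \<otimes> h x))"
      unfolding g_def w_def[symmetric] using s w k by algebra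
    also have "\<dots> \<in> X"
      using 1 hmult[OF s x] s X.I_l_closed X.a_closed X.a_inv_closed by (simp add: minus_eq)
    finally show ?thesis .
  qed
  ultimately show ?thesis by blast
qed

text \<open>The elements \<open>t\<close> for which \<open>t h\<close> agrees modulo \<open>X\<close> with an endomorphism of \<open>I\<close> form an ideal. By
\<open>local_basis_lift\<close> it is contained in no maximal ideal, so it contains \<open>\<one>\<close>.\<close>

lemma (in cring) quasi_projective_of_local_bases:
  assumes I: "ideal I R"
    and loc: "\<And>P. maximalideal P R \<Longrightarrow> \<exists>s\<in>carrier R - P. \<exists>B. local_basis I s B"
  shows "quasi_projective R (ideal_module R I)"
proof (rule quasi_projective_ideal_moduleI[OF I])
  interpret I: ideal I R by (rule I)
  let ?H = "module_homs R (ideal_module R I) (ideal_module R I)"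
  fix X h assume X: "ideal X R" and h: "\<And>x. x \<in> I \<Longrightarrow> h x \<in> I"
    and hadd: "\<And>x y. x \<in> I \<Longrightarrow> y \<in> I \<Longrightarrow> h (x \<oplus> y) \<ominus> (h x \<oplus> h y) \<in> X"
    and hmult: "\<And>a x. a \<in> carrier R \<Longrightarrow> x \<in> I \<Longrightarrow> h (a \<otimes> x) \<ominus> a \<otimes> h x \<in> X"
  interpret X: ideal X R by (rule X)
  define L where "L = {s \<in> carrier R. \<exists>g\<in>?H. \<forall>x\<in>I. s \<otimes> h x \<ominus> g x \<in> X}"
  have hc: "h x \<in> carrier R" if "x \<in> I" for x using h I.Icarr that by blast
  have gI: "g x \<in> I" "g x \<in> carrier R" if "g \<in> ?H" "x \<in> I" for g x
    using that I.Icarr by (auto simp: ideal_module_homs_iff)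
  have sm: "a \<otimes> s \<in> L" if s: "s \<in> L" and a: "a \<in> carrier R" for a s
  proof -
    from s obtain g where g: "g \<in> ?H" "\<forall>x\<in>I. s \<otimes> h x \<ominus> g x \<in> X" and sc: "s \<in> carrier R"
      by (auto simp: L_def)
    have "(\<lambda>x. a \<otimes> g x) \<in> ?H"
      using g(1) a I.I_l_closed I.Icarr by (auto simp: ideal_module_homs_iff r_distr m_lcomm)
    moreover have "(a \<otimes> s) \<otimes> h x \<ominus> a \<otimes> g x \<in> X" if x: "x \<in> I" for x
    proof -
      have "(a \<otimes> s) \<otimes> h x \<ominus> a \<otimes> g x = a \<otimes> (s \<otimes> h x \<ominus> g x)"
        using a sc hc[OF x] gI(2)[OF g(1) x] by algebra
      then show ?thesis using g(2) x a X.I_l_closed by simp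
    qed
    ultimately show ?thesis using a sc unfolding L_def by (intro CollectI conjI bexI) auto
  qed
  have idL: "ideal L R"
  proof (rule idealI[OF ring_axioms])
    show "subgroup L (add_monoid R)"
    proof (rule add.subgroupI)
      show "L \<subseteq> carrier R" by (auto simp: L_def)
      have "(\<lambda>x. \<zero>) \<in> ?H" by (auto simp: ideal_module_homs_iff)
      moreover have "\<zero> \<otimes> h x \<ominus> \<zero> \<in> X" if "x \<in> I" for x
        using hc[OF that] by (simp add: minus_eq)
      ultimately have "\<zero> \<in> L" unfolding L_def by (intro CollectI conjI bexI) auto
      then show "L \<noteq> {}" by blast
    next
      fix s assume s: "s \<in> L"
      then have "\<ominus> s = (\<ominus> \<one>) \<otimes> s" by (auto simp: L_def l_minus)
      then show "\<ominus> s \<in> L" using sm[OF s, of "\<ominus> \<one>"] by simp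
    next
      fix s t assume s: "s \<in> L" and t: "t \<in> L"
      from s obtain g where g: "g \<in> ?H" "\<forall>x\<in>I. s \<otimes> h x \<ominus> g x \<in> X" and sc: "s \<in> carrier R"
        by (auto simp: L_def)
      from t obtain k where k: "k \<in> ?H" "\<forall>x\<in>I. t \<otimes> h x \<ominus> k x \<in> X" and tc: "t \<in> carrier R"
        by (auto simp: L_def)
      have "(\<lambda>x. g x \<oplus> k x) \<in> ?H"
        unfolding ideal_module_homs_iff
      proof (intro conjI ballI)
        fix x assume x: "x \<in> I"
        show "g x \<oplus> k x \<in> I" using gI g k x by blast
        show "g (a \<otimes> x) \<oplus> k (a \<otimes> x) = a \<otimes> (g x \<oplus> k x)" if a: "a \<in> carrier R" for a
        proof -
          have "g (a \<otimes> x) = a \<otimes> g x" "k (a \<otimes> x) = a \<otimes> k x"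
            using g(1) k(1) a x by (auto simp: ideal_module_homs_iff)
          then show ?thesis using a gI(2)[OF g(1) x] gI(2)[OF k(1) x] by (simp add: r_distr)
        qed
        fix y assume y: "y \<in> I"
        have "g (x \<oplus> y) = g x \<oplus> g y" "k (x \<oplus> y) = k x \<oplus> k y"
          using g(1) k(1) x y by (auto simp: ideal_module_homs_iff)
        then show "g (x \<oplus> y) \<oplus> k (x \<oplus> y) = g x \<oplus> k x \<oplus> (g y \<oplus> k y)"
          using gI(2)[OF g(1) x] gI(2)[OF k(1) x] gI(2)[OF g(1) y] gI(2)[OF k(1) y]
          by (simp add: a_ac)
      qed
      moreover have "(s \<oplus> t) \<otimes> h x \<ominus> (g x \<oplus> k x) \<in> X" if x: "x \<in> I" for x
      proof -
        have "(s \<oplus> t) \<otimes> h x \<ominus> (g x \<oplus> k x) = (s \<otimes> h x \<ominus> g x) \<oplus> (t \<otimes> h x \<ominus> k x)"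
          using sc tc hc[OF x] gI(2)[OF g(1) x] gI(2)[OF k(1) x] by algebra
        then show ?thesis using g(2) k(2) x X.a_closed by simp
      qed
      ultimately show "s \<oplus> t \<in> L" using sc tc unfolding L_def by (intro CollectI conjI bexI) auto
    qed
    fix a x assume "a \<in> L" "x \<in> carrier R"
    moreover from this have "a \<in> carrier R" by (simp add: L_def)
    ultimately show "x \<otimes> a \<in> L" "a \<otimes> x \<in> L" using sm[of a x] by (auto simp: m_comm)
  qed
  have "\<one> \<in> L"
  proof (rule ccontr)
    assume "\<one> \<notin> L"
    from ideal_subset_maximalideal[OF idL this] obtain P where P: "maximalideal P R" "L \<subseteq> P" by blast
    from loc[OF P(1)] obtain s B where s: "s \<in> carrier R" "s \<notin> P" "local_basis I s B" by blast
    from local_basis_lift[OF I s(1,3) X h hadd hmult] have "s \<otimes> s \<in> L"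
      using s(1) unfolding L_def by simp
    then have "s \<otimes> s \<in> P" using P(2) by blast
    then show False
      using s primeideal.I_prime[OF maximalideal_prime[OF P(1)]] by blast
  qed
  then obtain g where g: "g \<in> ?H" "\<forall>x\<in>I. \<one> \<otimes> h x \<ominus> g x \<in> X" by (auto simp: L_def)
  have "\<forall>x\<in>I. h x \<ominus> g x \<in> X"
  proof
    fix x assume x: "x \<in> I"
    show "h x \<ominus> g x \<in> X" using g(2)[rule_format, OF x] hc[OF x] by simp
  qed
  with g(1) show "\<exists>g\<in>?H. \<forall>x\<in>I. h x \<ominus> g x \<in> X" by blast
qed

section \<open>Local bases of finitely generated ideals\<close>

context cring
begin

lemma genideal_finite_sum:
  assumes S: "finite S" "S \<subseteq> carrier R" and x: "x \<in> Idl S"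
  shows "\<exists>r\<in>S \<rightarrow> carrier R. x = (\<Oplus>b\<in>S. r b \<otimes> b)"
proof -
  define J where "J = {x. \<exists>r\<in>S \<rightarrow> carrier R. x = (\<Oplus>b\<in>S. r b \<otimes> b)}"
  have Sc: "b \<in> carrier R" if "b \<in> S" for b using S that by blast
  have JI: "(\<Oplus>b\<in>S. r b \<otimes> b) \<in> J" if "r \<in> S \<rightarrow> carrier R" for r
    unfolding J_def using that by blast
  have Jc: "x \<in> carrier R" if "x \<in> J" for x
    using that Sc by (auto simp: J_def intro!: finsum_closed)
  have sm: "a \<otimes> x \<in> J" if a: "a \<in> carrier R" and x: "x \<in> J" for a x
  proof -
    from x obtain r where r: "r \<in> S \<rightarrow> carrier R" "x = (\<Oplus>b\<in>S. r b \<otimes> b)" unfolding J_def by blast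
    have "a \<otimes> x = (\<Oplus>b\<in>S. (a \<otimes> r b) \<otimes> b)" unfolding r(2) by (rule finsum_smult[OF S r(1) a])
    moreover have "(\<lambda>b. a \<otimes> r b) \<in> S \<rightarrow> carrier R" using r(1) a by auto
    ultimately show ?thesis using JI[of "\<lambda>b. a \<otimes> r b"] by simp
  qed
  have "ideal J R"
  proof (rule idealI[OF ring_axioms])
    show "subgroup J (add_monoid R)"
    proof (rule add.subgroupI)
      show "J \<subseteq> carrier R" using Jc by blast
      show "J \<noteq> {}" using JI[of "\<lambda>b. \<zero>"] by auto
      show "\<ominus> x \<in> J" if x: "x \<in> J" for x
      proof -
        have "\<ominus> x = (\<ominus> \<one>) \<otimes> x" using Jc[OF x] by (simp add: l_minus)
        then show ?thesis using sm[OF _ x, of "\<ominus> \<one>"] by simp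
      qed
      fix x y assume "x \<in> J" "y \<in> J"
      then obtain r q where r: "r \<in> S \<rightarrow> carrier R" "x = (\<Oplus>b\<in>S. r b \<otimes> b)"
        and q: "q \<in> S \<rightarrow> carrier R" "y = (\<Oplus>b\<in>S. q b \<otimes> b)" unfolding J_def by blast
      have "x \<oplus> y = (\<Oplus>b\<in>S. r b \<otimes> b \<oplus> q b \<otimes> b)"
        unfolding r(2) q(2) using r(1) q(1) Sc by (intro finsum_addf[symmetric]) auto
      also have "\<dots> = (\<Oplus>b\<in>S. (r b \<oplus> q b) \<otimes> b)"
        using r(1) q(1) Sc by (intro finsum_cong') (auto simp: l_distr Pi_iff)
      finally have "x \<oplus> y = (\<Oplus>b\<in>S. (r b \<oplus> q b) \<otimes> b)" .
      moreover have "(\<lambda>b. r b \<oplus> q b) \<in> S \<rightarrow> carrier R" using r(1) q(1) by auto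
      ultimately show "x \<oplus> y \<in> J" using JI[of "\<lambda>b. r b \<oplus> q b"] by simp
    qed
    fix a x assume a: "a \<in> J" "x \<in> carrier R"
    then show "x \<otimes> a \<in> J" "a \<otimes> x \<in> J" using sm[of x a] Jc[OF a(1)] by (auto simp: m_comm)
  qed
  moreover have "S \<subseteq> J"
  proof
    fix a assume a: "a \<in> S"
    have "(\<Oplus>b\<in>S. (if a = b then \<one> else \<zero>) \<otimes> b) = (\<Oplus>b\<in>S. if a = b then b else \<zero>)"
      using Sc by (intro finsum_cong') auto
    also have "\<dots> = a" using finsum_singleton[OF a S(1), of "\<lambda>b. b"] S by blast
    finally have "a = (\<Oplus>b\<in>S. (if a = b then \<one> else \<zero>) \<otimes> b)" ..
    then show "a \<in> J" using JI[of "\<lambda>b. if a = b then \<one> else \<zero>"] by simp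
  qed
  ultimately have "Idl S \<subseteq> J" by (rule genideal_minimal)
  with x show ?thesis unfolding J_def by blast
qed

context
  fixes P assumes P: "primeideal P R"
begin

lemma common_denominator:
  assumes "finite F" "F \<subseteq> carrier R" "m \<in> carrier R" "\<And>y. y \<in> F \<Longrightarrow> local_dvd P m y"
  shows "\<exists>t\<in>carrier R - P. \<forall>y\<in>F. \<exists>c\<in>carrier R. t \<otimes> y = c \<otimes> m"
  using assms
proof (induction F rule: finite_induct)
  case empty then show ?case using one_notin_prime[OF P] by auto
next
  case (insert z F)
  then obtain t where t: "t \<in> carrier R - P" "\<forall>y\<in>F. \<exists>c\<in>carrier R. t \<otimes> y = c \<otimes> m" by auto
  from insert.prems(3)[of z] obtain u d where
    u: "u \<in> carrier R - P" "d \<in> carrier R" "u \<otimes> z = d \<otimes> m"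
    by (auto simp: local_dvd_def)
  have k: "t \<in> carrier R" "u \<in> carrier R" "z \<in> carrier R" using t u insert by auto
  have "\<exists>c\<in>carrier R. (t \<otimes> u) \<otimes> y = c \<otimes> m" if y: "y \<in> insert z F" for y
  proof (cases "y = z")
    case True
    have "(t \<otimes> u) \<otimes> z = (t \<otimes> d) \<otimes> m" using k u insert by (simp add: m_assoc)
    then show ?thesis using True k u by blast
  next
    case False
    then obtain c where c: "c \<in> carrier R" "t \<otimes> y = c \<otimes> m" using y t by blast
    have "y \<in> carrier R" using insert y by auto
    then have "(t \<otimes> u) \<otimes> y = u \<otimes> (t \<otimes> y)" using k by (simp add: m_ac)
    also have "\<dots> = (u \<otimes> c) \<otimes> m" unfolding c(2) using k c insert by (simp add: m_assoc)
    finally show ?thesis using k c by blast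
  qed
  then show ?case using mult_notin_prime[OF P t(1) u(1)] by blast
qed

text \<open>This serves twice: with \<open>N\<close> empty for a chain ring \<open>R\<^sub>P\<close>, and with \<open>N\<close> the minimal prime ideal if
only pairs inside \<open>N\<close> can be incomparable.\<close>

lemma local_gcd_in_finite_set:
  assumes cmp: "\<And>x y. x \<in> carrier R \<Longrightarrow> y \<in> carrier R \<Longrightarrow> x \<notin> N \<Longrightarrow> local_dvd P x y \<or> local_dvd P y x"
    and up: "\<And>x y. x \<in> N \<Longrightarrow> y \<in> carrier R \<Longrightarrow> local_dvd P x y \<Longrightarrow> y \<in> N"
    and F: "finite F" "F \<subseteq> carrier R" "\<not> F \<subseteq> N"
  shows "\<exists>m\<in>F. m \<notin> N \<and> (\<forall>y\<in>F. local_dvd P m y)"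
  using F
proof (induction F rule: finite_induct)
  case (insert z F)
  have z: "z \<in> carrier R" using insert by simp
  show ?case
  proof (cases "F \<subseteq> N")
    case True
    then have "z \<notin> N" using insert by auto
    moreover have "local_dvd P z y" if "y \<in> F" for y
      using cmp[of z y] up[of y z] that insert True \<open>z \<notin> N\<close> by blast
    ultimately show ?thesis using local_dvd_refl[OF P z] by blast
  next
    case False
    with insert obtain m where m: "m \<in> F" "m \<notin> N" "\<forall>y\<in>F. local_dvd P m y" by auto
    have mc: "m \<in> carrier R" using m insert by auto
    show ?thesis
    proof (cases "local_dvd P m z")
      case True then show ?thesis using m by blast
    next
      case False
      then have zm: "local_dvd P z m" using cmp[OF mc z] m by blast
      then have "z \<notin> N" using up mc m by blast
      moreover have "local_dvd P z y" if "y \<in> F" for y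
        using local_dvd_trans[OF P z mc _ zm] m that insert by blast
      ultimately show ?thesis using local_dvd_refl[OF P z] by blast
    qed
  qed
qed simp

text \<open>Here \<open>I\<^sub>P = a R\<^sub>P\<close>, and \<open>r a = 0\<close> implies that \<open>r\<close> annihilates \<open>I\<^sub>P\<close>.\<close>

lemma local_basis_principal:
  assumes S: "finite S" "S \<subseteq> carrier R" and a: "a \<in> Idl S" "\<And>b. b \<in> S \<Longrightarrow> local_dvd P a b"
  shows "\<exists>s\<in>carrier R - P. \<exists>B. local_basis (Idl S) s B"
proof -
  have I: "ideal (Idl S) R" by (rule genideal_ideal[OF S(2)])
  interpret I: ideal "Idl S" R by (rule I)
  have ac: "a \<in> carrier R" using a(1) I.Icarr by blast
  obtain t where t: "t \<in> carrier R - P" "\<forall>y\<in>S. \<exists>c\<in>carrier R. t \<otimes> y = c \<otimes> a"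
    using common_denominator[OF S ac a(2)] by blast
  have tc: "t \<in> carrier R" using t by simp
  have d: "\<exists>c\<in>carrier R. t \<otimes> x = c \<otimes> a" if x: "x \<in> Idl S" for x
  proof -
    from genideal_finite_sum[OF S x] obtain r where r: "r \<in> S \<rightarrow> carrier R" "x = (\<Oplus>b\<in>S. r b \<otimes> b)" by blast
    from t(2) obtain c where c: "\<And>y. y \<in> S \<Longrightarrow> c y \<in> carrier R \<and> t \<otimes> y = c y \<otimes> a" by metis
    have rc: "r b \<in> carrier R" "c b \<in> carrier R" "b \<in> carrier R" "t \<otimes> b = c b \<otimes> a" if "b \<in> S" for b
      using r(1) c S that by auto
    have "t \<otimes> x = (\<Oplus>b\<in>S. t \<otimes> (r b \<otimes> b))"
      unfolding r(2) using rc tc S by (intro finsum_rdistr) auto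
    also have "\<dots> = (\<Oplus>b\<in>S. (r b \<otimes> c b) \<otimes> a)"
    proof (intro finsum_cong')
      fix b assume b: "b \<in> S"
      have "t \<otimes> (r b \<otimes> b) = r b \<otimes> (t \<otimes> b)" using rc(1,3)[OF b] tc by (simp add: m_lcomm)
      also have "\<dots> = (r b \<otimes> c b) \<otimes> a" unfolding rc(4)[OF b] using rc(1,2)[OF b] ac by (simp add: m_assoc)
      finally show "t \<otimes> (r b \<otimes> b) = (r b \<otimes> c b) \<otimes> a" .
    qed (use rc ac in auto)
    also have "\<dots> = (\<Oplus>b\<in>S. r b \<otimes> c b) \<otimes> a"
      using rc ac S by (intro finsum_ldistr[symmetric]) auto
    finally show ?thesis using rc by (intro bexI[of _ "\<Oplus>b\<in>S. r b \<otimes> c b"]) (auto intro!: finsum_closed)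
  qed
  have "local_basis (Idl S) t {a}"
    unfolding local_basis_def
  proof (intro conjI ballI impI)
    fix x assume x: "x \<in> Idl S"
    from d[OF x] obtain c where c: "c \<in> carrier R" "t \<otimes> x = c \<otimes> a" by blast
    then show "\<exists>r\<in>{a} \<rightarrow> carrier R. t \<otimes> x = (\<Oplus>b\<in>{a}. r b \<otimes> b)"
      using ac by (intro bexI[of _ "\<lambda>_. c"]) auto
    fix r b assume r: "r \<in> {a} \<rightarrow> carrier R" "(\<Oplus>b\<in>{a}. r b \<otimes> b) = \<zero>" "b \<in> {a}"
    then have ra: "r a \<otimes> a = \<zero>" "r a \<in> carrier R" "b = a" using ac by auto
    have "t \<otimes> (r a \<otimes> x) = r a \<otimes> (t \<otimes> x)" using tc ra x I.Icarr by (simp add: m_lcomm)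
    also have "\<dots> = c \<otimes> (r a \<otimes> a)" unfolding c(2) using c ra ac by (simp add: m_lcomm)
    finally show "t \<otimes> (r b \<otimes> x) = \<zero>" using ra c by simp
  qed (use a in auto)
  then show ?thesis using t by blast
qed

text \<open>By the assumptions \<open>reg\<close> and \<open>sq\<close> the ideal is a torsion-free module over \<open>R/N\<close>, and by \<open>cmp\<close> the
localization of \<open>R/N\<close> at \<open>P\<close> is a chain ring. Start with the generating set \<open>S\<close> and shrink it: in a
relation \<open>\<Sum> r\<^sub>b b = 0\<close> whose coefficients are not all in \<open>N\<close>, some coefficient \<open>r\<^sub>m \<notin> N\<close> divides all
the others at \<open>P\<close>. It can be cancelled, and the resulting relation expresses \<open>m\<close> through the other
elements of \<open>B\<close>, so that \<open>m\<close> can be dropped.\<close>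

lemma local_basis_in_minimal_prime:
  assumes cmp: "\<And>x y. x \<in> carrier R \<Longrightarrow> y \<in> carrier R \<Longrightarrow> x \<notin> N \<Longrightarrow> local_dvd P x y \<or> local_dvd P y x"
    and up: "\<And>x y. x \<in> N \<Longrightarrow> y \<in> carrier R \<Longrightarrow> local_dvd P x y \<Longrightarrow> y \<in> N"
    and reg: "\<And>x y. x \<in> carrier R \<Longrightarrow> y \<in> carrier R \<Longrightarrow> x \<notin> N \<Longrightarrow> x \<otimes> y = \<zero> \<Longrightarrow> y = \<zero>"
    and sq: "\<And>x y. x \<in> N \<Longrightarrow> y \<in> N \<Longrightarrow> x \<otimes> y = \<zero>"
    and S: "finite S" "S \<subseteq> carrier R" and SN: "Idl S \<subseteq> N"
  shows "\<exists>s\<in>carrier R - P. \<exists>B. local_basis (Idl S) s B"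
proof -
  have I: "ideal (Idl S) R" by (rule genideal_ideal[OF S(2)])
  interpret I: ideal "Idl S" R by (rule I)
  have main: "\<exists>s\<in>carrier R - P. \<exists>B. local_basis (Idl S) s B"
    if "finite B" "B \<subseteq> S" "s \<in> carrier R - P"
      "\<And>x. x \<in> Idl S \<Longrightarrow> \<exists>r\<in>B \<rightarrow> carrier R. s \<otimes> x = (\<Oplus>b\<in>B. r b \<otimes> b)" for B s
    using that
  proof (induction B arbitrary: s rule: finite_psubset_induct)
    case (psubset B)
    have fin: "finite B" by (rule psubset.hyps)
    have BI: "B \<subseteq> Idl S" using psubset.prems(1) genideal_self[OF S(2)] by blast
    have sc: "s \<in> carrier R" using psubset.prems by simp
    show ?case
    proof (cases "local_basis (Idl S) s B")
      case True then show ?thesis using psubset.prems(2) by blast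
    next
      case False
      then obtain r b x where r: "r \<in> B \<rightarrow> carrier R" "(\<Oplus>b\<in>B. r b \<otimes> b) = \<zero>"
        and bx: "b \<in> B" "x \<in> Idl S" "s \<otimes> (r b \<otimes> x) \<noteq> \<zero>"
        unfolding local_basis_def using fin BI psubset.prems(3) by blast
      have Bc: "b \<in> carrier R" "r b \<in> carrier R" if "b \<in> B" for b using that r(1) BI I.Icarr by auto
      have "r b \<notin> N"
      proof
        assume "r b \<in> N"
        then have "r b \<otimes> x = \<zero>" using sq SN bx by blast
        with bx sc show False by simp
      qed
      with bx have rB: "finite (r ` B)" "r ` B \<subseteq> carrier R" "\<not> r ` B \<subseteq> N" using fin Bc by auto
      have "\<exists>z\<in>r ` B. z \<notin> N \<and> (\<forall>y\<in>r ` B. local_dvd P z y)"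
        by (rule local_gcd_in_finite_set) (fact cmp up rB)+
      then obtain m where
        m: "m \<in> B" "r m \<notin> N" "\<forall>y\<in>r ` B. local_dvd P (r m) y" by auto
      obtain t where t: "t \<in> carrier R - P" "\<forall>y\<in>r ` B. \<exists>c\<in>carrier R. t \<otimes> y = c \<otimes> r m"
        using common_denominator[of "r ` B" "r m"] m Bc fin by blast
      have tc: "t \<in> carrier R" using t by simp
      have "\<forall>b\<in>B. \<exists>c. c \<in> carrier R \<and> t \<otimes> r b = c \<otimes> r m" using t(2) by blast
      from bchoice[OF this] obtain d where
        d: "\<And>b. b \<in> B \<Longrightarrow> d b \<in> carrier R \<and> t \<otimes> r b = d b \<otimes> r m" by blast
      \<comment> \<open>The coefficient of \<open>m\<close> is set to \<open>t\<close> itself, so that it is invertible at \<open>P\<close>.\<close>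
      define c where "c b = (if b = m then t else d b)" for b
      have c: "c b \<in> carrier R" "t \<otimes> r b = c b \<otimes> r m" if "b \<in> B" for b
        using d[OF that] tc by (auto simp: c_def)
      have rm: "r m \<in> carrier R" "m \<in> carrier R" using Bc m by auto
      have "r m \<otimes> (\<Oplus>b\<in>B. c b \<otimes> b) = (\<Oplus>b\<in>B. (r m \<otimes> c b) \<otimes> b)"
        using fin Bc c rm by (intro finsum_smult) auto
      also have "\<dots> = (\<Oplus>b\<in>B. (t \<otimes> r b) \<otimes> b)"
        using Bc c rm by (intro finsum_cong') (auto simp: m_comm)
      also have "\<dots> = t \<otimes> (\<Oplus>b\<in>B. r b \<otimes> b)"
        using fin Bc tc by (intro finsum_smult[symmetric]) auto
      also have "\<dots> = \<zero>" using r(2) tc by simp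
      finally have "(\<Oplus>b\<in>B. c b \<otimes> b) = \<zero>"
        using reg[of "r m"] rm m(2) Bc c by (auto intro!: finsum_closed)
      moreover define C where "C = B - {m}"
      have split: "(\<Oplus>b\<in>B. q b \<otimes> b) = q m \<otimes> m \<oplus> (\<Oplus>b\<in>C. q b \<otimes> b)"
        if "\<And>b. b \<in> B \<Longrightarrow> q b \<in> carrier R" for q
      proof -
        have "B = insert m C" "m \<notin> C" using m(1) by (auto simp: C_def)
        moreover have "finite C" using fin by (simp add: C_def)
        ultimately show ?thesis
          using finsum_insert[of C m "\<lambda>b. q b \<otimes> b"] that Bc m(1) by (auto simp: C_def)
      qed
      ultimately have rel: "t \<otimes> m \<oplus> (\<Oplus>b\<in>C. c b \<otimes> b) = \<zero>"
        using split[of c] c by (simp add: c_def)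
      have CB: "b \<in> B" if "b \<in> C" for b using that by (simp add: C_def)
      have sumc: "(\<Oplus>b\<in>C. q b \<otimes> b) \<in> carrier R" if "\<And>b. b \<in> B \<Longrightarrow> q b \<in> carrier R" for q
        using that Bc CB by (intro finsum_closed) auto
      have finC: "finite C" using fin by (simp add: C_def)
      have span: "\<exists>r\<in>C \<rightarrow> carrier R. (t \<otimes> s) \<otimes> x = (\<Oplus>b\<in>C. r b \<otimes> b)" if x: "x \<in> Idl S" for x
      proof -
        from psubset.prems(3)[OF x] obtain q where
          q: "q \<in> B \<rightarrow> carrier R" "s \<otimes> x = (\<Oplus>b\<in>B. q b \<otimes> b)" by blast
        have qc: "q b \<in> carrier R" if "b \<in> B" for b using q(1) that by auto
        have qm: "q m \<in> carrier R" using qc m by blast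
        have xc: "x \<in> carrier R" using x I.Icarr by blast
        define u where "u = (\<Oplus>b\<in>C. q b \<otimes> b)"
        define w where "w = (\<Oplus>b\<in>C. c b \<otimes> b)"
        have uw: "u \<in> carrier R" "w \<in> carrier R" unfolding u_def w_def using sumc qc c by blast+
        have "(t \<otimes> s) \<otimes> x = t \<otimes> (q m \<otimes> m \<oplus> u)"
          using tc sc xc by (simp add: m_assoc q(2) split[OF qc] u_def)
        also have "\<dots> = q m \<otimes> (t \<otimes> m \<oplus> w) \<oplus> (t \<otimes> u \<oplus> (\<ominus> q m) \<otimes> w)"
          using tc qm rm(2) uw by algebra
        also have "\<dots> = t \<otimes> u \<oplus> (\<ominus> q m) \<otimes> w"
          using rel tc qm uw unfolding w_def[symmetric] by simp
        also have "\<dots> = (\<Oplus>b\<in>C. (t \<otimes> q b) \<otimes> b) \<oplus> (\<Oplus>b\<in>C. (\<ominus> q m \<otimes> c b) \<otimes> b)"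
          unfolding u_def w_def using finC Bc CB qc c tc qm by (subst (1 2) finsum_smult) auto
        also have "\<dots> = (\<Oplus>b\<in>C. (t \<otimes> q b) \<otimes> b \<oplus> (\<ominus> q m \<otimes> c b) \<otimes> b)"
          using Bc CB qc c tc qm by (intro finsum_addf[symmetric]) auto
        also have "\<dots> = (\<Oplus>b\<in>C. (t \<otimes> q b \<oplus> \<ominus> q m \<otimes> c b) \<otimes> b)"
          using Bc CB qc c tc qm by (intro finsum_cong') (auto simp: l_distr)
        finally show ?thesis
          using CB qc c tc qm by (intro bexI[of _ "\<lambda>b. t \<otimes> q b \<oplus> \<ominus> q m \<otimes> c b"]) auto
      qed
      have "C \<subset> B" using m(1) by (auto simp: C_def)
      moreover have "C \<subseteq> S" using psubset.prems(1) by (auto simp: C_def)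
      moreover have "t \<otimes> s \<in> carrier R - P" by (rule mult_notin_prime[OF P t(1) psubset.prems(2)])
      ultimately show ?thesis using psubset.IH[of C "t \<otimes> s"] span by blast
    qed
  qed
  have "\<exists>r\<in>S \<rightarrow> carrier R. \<one> \<otimes> x = (\<Oplus>b\<in>S. r b \<otimes> b)" if "x \<in> Idl S" for x
    using genideal_finite_sum[OF S that] that I.Icarr by simp
  then show ?thesis using main[OF S(1) _ one_notin_prime[OF P]] by blast
qed

end

lemma zero_if_locally_zero:
  assumes x: "x \<in> carrier R" and loc: "\<And>P. maximalideal P R \<Longrightarrow> local_dvd P \<zero> x"
  shows "x = \<zero>"
proof -
  define A where "A = {t \<in> carrier R. t \<otimes> x = \<zero>}"
  have "ideal A R"
  proof (rule idealI[OF ring_axioms])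
    show "subgroup A (add_monoid R)"
      by (rule add.subgroupI) (use x in \<open>auto simp: A_def l_distr l_minus\<close>)
    fix t r assume t: "t \<in> A" and r: "r \<in> carrier R"
    then have "(r \<otimes> t) \<otimes> x = r \<otimes> (t \<otimes> x)" "t \<in> carrier R" using x by (simp_all add: A_def m_assoc)
    then show "r \<otimes> t \<in> A" "t \<otimes> r \<in> A" using t r by (simp_all add: A_def m_comm)
  qed
  have "\<one> \<in> A"
  proof (rule ccontr)
    assume "\<one> \<notin> A"
    from ideal_subset_maximalideal[OF \<open>ideal A R\<close> this]
    obtain P where P: "maximalideal P R" "A \<subseteq> P" by blast
    from loc[OF P(1)] x P(2) show False by (auto simp: local_dvd_def A_def)
  qed
  then show ?thesis using x by (simp add: A_def)
qed

end

section \<open>Fqf-rings with a unique minimal prime ideal\<close>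

theorem proposition4p4:
  fixes R :: "('a, 'r) ring_scheme" and N :: "'a set"
  assumes "fqf_ring R"
    and "minimal_primeideal N R"
    and "\<And>Q. minimal_primeideal Q R \<Longrightarrow> Q = N"
  shows "(\<not> arithmetical R \<longrightarrow>
           (\<forall>P. maximalideal P R \<longrightarrow> \<not> chain_ring (localization_at R P))) \<and>
         fqp_ring R"
proof -
  interpret cring R using assms(1) by (simp add: fqf_ring_def)
  note fqf = assms(1)
  have N: "primeideal N R" using assms(2) by (simp add: minimal_primeideal_def)
  interpret N: primeideal N R by (rule N)
  have prime: "primeideal P R" if "maximalideal P R" for P by (rule maximalideal_prime[OF that])
  have NP: "N \<subseteq> P" if "maximalideal P R" for P
    by (rule unique_minimal_prime_subset_prime[OF assms(3) prime[OF that]])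
  have nilp: "\<exists>n::nat. x [^]\<^bsub>R\<^esub> n = \<zero>\<^bsub>R\<^esub>" if "x \<in> N" for x
    using unique_minimal_prime_nilpotent[OF assms(3)] that N.Icarr by blast
  have gens: "\<exists>S. finite S \<and> S \<subseteq> carrier R \<and> I = Idl\<^bsub>R\<^esub> S" if "fin_gen_ideal I R" for I
    using that by (simp add: fin_gen_ideal_def)
  show ?thesis
  proof (cases "arithmetical R")
    case True
    have "quasi_projective R (ideal_module R (Idl\<^bsub>R\<^esub> S))" if S: "finite S" "S \<subseteq> carrier R" for S
    proof (rule quasi_projective_of_local_bases[OF genideal_ideal[OF S(2)]])
      fix P assume P: "maximalideal P R"
      have tot: "local_dvd P x y \<or> local_dvd P y x" if "x \<in> carrier R" "y \<in> carrier R" for x y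
        using True P that chain_ring_localization_iff[OF prime[OF P]] by (auto simp: arithmetical_def)
      have "\<exists>a\<in>Idl\<^bsub>R\<^esub> S. \<forall>b\<in>S. local_dvd P a b"
      proof (cases "S = {}")
        case True
        then show ?thesis
          using additive_subgroup.zero_closed[OF ideal.axioms(1)[OF genideal_ideal[OF S(2)]]] by blast
      next
        case False
        have "\<exists>m\<in>S. m \<notin> {} \<and> (\<forall>y\<in>S. local_dvd P m y)"
          by (rule local_gcd_in_finite_set[OF prime[OF P]]) (use tot S False in auto)
        then show ?thesis using genideal_self[OF S(2)] by blast
      qed
      then show "\<exists>s\<in>carrier R - P. \<exists>B. local_basis (Idl\<^bsub>R\<^esub> S) s B"
        using local_basis_principal[OF prime[OF P] S] by blast
    qed
    then have "fqp_ring R" unfolding fqp_ring_def using gens is_cring by blast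
    then show ?thesis using True by blast
  next
    case False
    \<comment> \<open>One incomparable pair, found at \<open>P0\<close>, serves at all maximal ideals.\<close>
    then obtain P0 where P0: "maximalideal P0 R" "\<not> chain_ring (localization_at R P0)"
      using is_cring by (auto simp: arithmetical_def)
    then obtain a b where ab: "a \<in> carrier R" "b \<in> carrier R" and inc0: "incomparable_at P0 a b"
      using chain_ring_localization_iff[OF prime[OF P0(1)]] by blast
    have inc: "incomparable_at P a b" if "maximalideal P R" for P
      by (rule incomparable_at_other_prime[OF prime[OF P0(1)] fqf N NP[OF P0(1)] nilp ab inc0
            prime[OF that] NP[OF that]])
    have nonchain: "\<not> chain_ring (localization_at R P)" if "maximalideal P R" for P
      using chain_ring_localization_iff[OF prime[OF that]] inc[OF that] ab by blast
    have reg: "y = \<zero>\<^bsub>R\<^esub>" if "x \<in> carrier R" "y \<in> carrier R" "x \<notin> N" "x \<otimes>\<^bsub>R\<^esub> y = \<zero>\<^bsub>R\<^esub>" for x y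
    proof (rule zero_if_locally_zero[OF that(2)])
      fix P assume P: "maximalideal P R"
      show "local_dvd P \<zero>\<^bsub>R\<^esub> y"
        using regular_outside_prime[OF prime[OF P] fqf N NP[OF P] nilp ab inc[OF P] that(1,3,2)]
          local_dvd_refl[OF prime[OF P] zero_closed] that(4) by simp
    qed
    have sq: "x \<otimes>\<^bsub>R\<^esub> y = \<zero>\<^bsub>R\<^esub>" if "x \<in> N" "y \<in> N" for x y
    proof (rule zero_if_locally_zero)
      fix P assume P: "maximalideal P R"
      show "local_dvd P \<zero>\<^bsub>R\<^esub> (x \<otimes>\<^bsub>R\<^esub> y)"
        by (rule nilpotent_product_zero[OF prime[OF P] fqf N NP[OF P] nilp ab inc[OF P] that])
    qed (use that N.Icarr in auto)
    have "quasi_projective R (ideal_module R (Idl\<^bsub>R\<^esub> S))" if S: "finite S" "S \<subseteq> carrier R" for S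
    proof (rule quasi_projective_of_local_bases[OF genideal_ideal[OF S(2)]])
      fix P assume P: "maximalideal P R"
      have cmp: "local_dvd P x y \<or> local_dvd P y x"
        if "x \<in> carrier R" "y \<in> carrier R" "x \<notin> N" for x y
        using incomparable_in_prime[OF prime[OF P] fqf N NP[OF P] nilp] that by blast
      have up: "y \<in> N" if "x \<in> N" "y \<in> carrier R" "local_dvd P x y" for x y
        using local_dvd_in_prime[OF prime[OF P] fqf N NP[OF P] nilp] that by blast
      show "\<exists>s\<in>carrier R - P. \<exists>B. local_basis (Idl\<^bsub>R\<^esub> S) s B"
      proof (cases "S \<subseteq> N")
        case True
        then have SN: "Idl\<^bsub>R\<^esub> S \<subseteq> N" by (rule genideal_minimal[OF N.is_ideal])
        show ?thesis
          by (rule local_basis_in_minimal_prime[OF prime[OF P], where N = N]) (fact cmp up reg sq S SN)+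
      next
        case False
        have "\<exists>m\<in>S. m \<notin> N \<and> (\<forall>y\<in>S. local_dvd P m y)"
          by (rule local_gcd_in_finite_set[OF prime[OF P]]) (fact cmp up S False)+
        then show ?thesis
          using genideal_self[OF S(2)] local_basis_principal[OF prime[OF P] S] by blast
      qed
    qed
    then have "fqp_ring R" unfolding fqp_ring_def using gens is_cring by blast
    then show ?thesis using nonchain by blast
  qed
qed

end
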